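(* Let $0=t_0<\dots<t_N=T$, $k_n:=t_n-t_{n-1}$, $f^1,\dots,f^N\in L^2(\Omega)$, $u_h^0\in L^2(\Omega)$, and for each $n$ let $U_h^n\subseteq U$ be a closed subspace. Then for all $n=1,\dots,N$ the problem of finding $\mathbf u_h^n\in U_h^n$ with $$B'_{k_n}(\mathbf u_h^n,\mathbf v)=F'_n(\mathbf v;f^n,u_h^{n-1})\quad\text{for all }\mathbf v\in U_h^n$$ admits a unique solution $\mathbf u_h^n\in U_h^n$.
   Context: $\Omega\subset\mathbb{R}^d$ is a bounded Lipschitz domain with polygonal boundary; $(\cdot,\cdot)$, $\|\cdot\|$ denote the $L^2(\Omega)$ inner product and norm. Coefficients: $\mathbf{A}\in L^\infty(\Omega)^{d\times d}$ symmetric with $\lambda_{\min}(\mathbf{A})\ge\alpha_0>0$ a.e., $\boldsymbol\beta\in L^\infty(\Omega)^d$, $\gamma\in L^\infty(\Omega)$, with $\tfrac12\operatorname{div}\boldsymbol\beta+\gamma\in L^\infty(\Omega)$, $\tfrac12\operatorname{div}\boldsymbol\beta+\gamma\ge0$ a.e.; moreover $\boldsymbol\beta\in C^1(\mathcal T)^d\cap H(\operatorname{div},\Omega)$, $\gamma\in C^1(\mathcal T)$ for some simplicial mesh $\mathcal T$ of $\Omega$, where $C^1(\mathcal T)$ denotes elementwise $C^1$ functions. $U:=H^1_0(\Omega)\times H(\operatorname{div},\Omega)$. For $k>0$ and $\mathbf u=(u,\boldsymbol\sigma),\mathbf v=(v,\boldsymbol\tau)\in U$: $\tilde b'_k(\mathbf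 u,\mathbf v):=(-\operatorname{div}\boldsymbol\sigma+\gamma u,v)+k(-\operatorname{div}\boldsymbol\sigma+\gamma u,-\operatorname{div}\boldsymbol\tau+\gamma v)+(\mathbf A^{-1/2}\boldsymbol\sigma-\mathbf A^{1/2}\nabla u+\mathbf A^{-1/2}\boldsymbol\beta u,\mathbf A^{-1/2}\boldsymbol\tau-\mathbf A^{1/2}\nabla v+\mathbf A^{-1/2}\boldsymbol\beta v)$, $b'_k(\mathbf u,\mathbf v):=(u,-\operatorname{div}\boldsymbol\tau+\gamma v)+\tilde b'_k(\mathbf u,\mathbf v)$, $B'_k(\mathbf u,\mathbf v):=\frac1k(u,v)+b'_k(\mathbf u,\mathbf v)$, and for $g,w\in L^2(\Omega)$, $F'_n(\mathbf v;g,w):=\big(g+\tfrac{w}{k_n},v+k_n(-\operatorname{div}\boldsymbol\tau+\gamma v)\big)$. (This is the backward Euler least-squares scheme for the system $\dot u-\operatorname{div}\boldsymbol\sigma+\gamma u=f$, $\boldsymbol\sigma-\mathbf A\nabla u+\boldsymbol\beta u=0$, $u|_{\partial\Omega}=0$.) *)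

theory Defs
  imports "HOL-Analysis.Analysis"
begin

type_synonym 'd sfun = "real^('d::finite) \<Rightarrow> real"
type_synonym 'd vfun = "real^('d::finite) \<Rightarrow> real^'d"

definition L2 :: "(real^('d::finite)) set \<Rightarrow> 'd sfun \<Rightarrow> bool" where
  "L2 \<Omega> f \<longleftrightarrow> f \<in> borel_measurable (lebesgue_on \<Omega>)
                 \<and> integrable (lebesgue_on \<Omega>) (\<lambda>x. (f x)\<^sup>2)"

definition L2vec :: "(real^('d::finite)) set \<Rightarrow> 'd vfun \<Rightarrow> bool" where
  "L2vec \<Omega> \<sigma> \<longleftrightarrow> (\<forall>i. L2 \<Omega> (\<lambda>x. \<sigma> x $ i))"

definition Linf :: "(real^('d::finite)) set \<Rightarrow> 'd sfun \<Rightarrow> bool" where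
  "Linf \<Omega> f \<longleftrightarrow> f \<in> borel_measurable (lebesgue_on \<Omega>)
                  \<and> (\<exists>C. AE x in lebesgue_on \<Omega>. \<bar>f x\<bar> \<le> C)"

definition ip :: "(real^('d::finite)) set \<Rightarrow> 'd sfun \<Rightarrow> 'd sfun \<Rightarrow> real" where
  "ip \<Omega> f g = (LINT x|lebesgue_on \<Omega>. f x * g x)"

definition vip :: "(real^('d::finite)) set \<Rightarrow> 'd vfun \<Rightarrow> 'd vfun \<Rightarrow> real" where
  "vip \<Omega> \<sigma> \<tau> = (LINT x|lebesgue_on \<Omega>. \<sigma> x \<bullet> \<tau> x)"

definition ae_eq :: "(real^('d::finite)) set \<Rightarrow> ('d sfun \<times> 'd vfun) \<Rightarrow> ('d sfun \<times> 'd vfun) \<Rightarrow> bool" where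
  "ae_eq \<Omega> U V \<longleftrightarrow> (AE x in lebesgue_on \<Omega>. fst U x = fst V x \<and> snd U x = snd V x)"

definition pd :: "'d::finite \<Rightarrow> 'd sfun \<Rightarrow> 'd sfun" where
  "pd i f x = frechet_derivative f (at x) (axis i 1)"

fun iter_pd :: "('d::finite) list \<Rightarrow> 'd sfun \<Rightarrow> 'd sfun" where
  "iter_pd [] f = f"
| "iter_pd (i # is) f = pd i (iter_pd is f)"

definition smooth :: "('d::finite) sfun \<Rightarrow> bool" where
  "smooth f \<longleftrightarrow> (\<forall>is. (\<forall>x. iter_pd is f differentiable (at x))
                     \<and> continuous_on UNIV (iter_pd is f))"

definition grad :: "('d::finite) sfun \<Rightarrow> 'd vfun" where
  "grad f x = (\<chi> i. pd i f x)"

definition test_fun :: "(real^('d::finite)) set \<Rightarrow> 'd sfun \<Rightarrow> bool" where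
  "test_fun \<Omega> \<phi> \<longleftrightarrow> smooth \<phi> \<and> compact (closure {x. \<phi> x \<noteq> 0})
                       \<and> closure {x. \<phi> x \<noteq> 0} \<subseteq> \<Omega>"

definition is_weak_grad :: "(real^('d::finite)) set \<Rightarrow> 'd sfun \<Rightarrow> 'd vfun \<Rightarrow> bool" where
  "is_weak_grad \<Omega> u g \<longleftrightarrow> (\<forall>\<phi>. test_fun \<Omega> \<phi> \<longrightarrow> (\<forall>i.
      (LINT x|lebesgue_on \<Omega>. u x * pd i \<phi> x) = - (LINT x|lebesgue_on \<Omega>. g x $ i * \<phi> x)))"

definition is_weak_div :: "(real^('d::finite)) set \<Rightarrow> 'd vfun \<Rightarrow> 'd sfun \<Rightarrow> bool" where
  "is_weak_div \<Omega> \<sigma> w \<longleftrightarrow> (\<forall>\<phi>. test_fun \<Omega> \<phi> \<longrightarrow>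
      (LINT x|lebesgue_on \<Omega>. \<sigma> x \<bullet> grad \<phi> x) = - (LINT x|lebesgue_on \<Omega>. w x * \<phi> x))"

definition wgrad :: "(real^('d::finite)) set \<Rightarrow> 'd sfun \<Rightarrow> 'd vfun" where
  "wgrad \<Omega> u = (SOME g. L2vec \<Omega> g \<and> is_weak_grad \<Omega> u g)"

definition wdiv :: "(real^('d::finite)) set \<Rightarrow> 'd vfun \<Rightarrow> 'd sfun" where
  "wdiv \<Omega> \<sigma> = (SOME w. L2 \<Omega> w \<and> is_weak_div \<Omega> \<sigma> w)"

definition H1 :: "(real^('d::finite)) set \<Rightarrow> 'd sfun set" where
  "H1 \<Omega> = {u. L2 \<Omega> u \<and> (\<exists>g. L2vec \<Omega> g \<and> is_weak_grad \<Omega> u g)}"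

definition H1_dist2 :: "(real^('d::finite)) set \<Rightarrow> 'd sfun \<Rightarrow> 'd sfun \<Rightarrow> 'd vfun \<Rightarrow> 'd vfun \<Rightarrow> real" where
  "H1_dist2 \<Omega> u v gu gv = ip \<Omega> (\<lambda>x. u x - v x) (\<lambda>x. u x - v x)
      + vip \<Omega> (\<lambda>x. gu x - gv x) (\<lambda>x. gu x - gv x)"

definition H10 :: "(real^('d::finite)) set \<Rightarrow> 'd sfun set" where
  "H10 \<Omega> = {u \<in> H1 \<Omega>. \<exists>\<phi>. (\<forall>j. test_fun \<Omega> (\<phi> j))
       \<and> (\<lambda>j. H1_dist2 \<Omega> (\<phi> j) u (grad (\<phi> j)) (wgrad \<Omega> u)) \<longlonglongrightarrow> 0}"

definition Hdiv :: "(real^('d::finite)) set \<Rightarrow> 'd vfun set" where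
  "Hdiv \<Omega> = {\<sigma>. L2vec \<Omega> \<sigma> \<and> (\<exists>w. L2 \<Omega> w \<and> is_weak_div \<Omega> \<sigma> w)}"

definition UU :: "(real^('d::finite)) set \<Rightarrow> ('d sfun \<times> 'd vfun) set" where
  "UU \<Omega> = H10 \<Omega> \<times> Hdiv \<Omega>"

definition U_norm2 :: "(real^('d::finite)) set \<Rightarrow> ('d sfun \<times> 'd vfun) \<Rightarrow> real" where
  "U_norm2 \<Omega> U = ip \<Omega> (fst U) (fst U) + vip \<Omega> (wgrad \<Omega> (fst U)) (wgrad \<Omega> (fst U))
      + vip \<Omega> (snd U) (snd U) + ip \<Omega> (wdiv \<Omega> (snd U)) (wdiv \<Omega> (snd U))"

definition U_add :: "(('d::finite) sfun \<times> 'd vfun) \<Rightarrow> ('d sfun \<times> 'd vfun) \<Rightarrow> ('d sfun \<times> 'd vfun)" where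
  "U_add U V = ((\<lambda>x. fst U x + fst V x), (\<lambda>x. snd U x + snd V x))"

definition U_scale :: "real \<Rightarrow> (('d::finite) sfun \<times> 'd vfun) \<Rightarrow> ('d sfun \<times> 'd vfun)" where
  "U_scale c U = ((\<lambda>x. c * fst U x), (\<lambda>x. c *\<^sub>R snd U x))"

definition U_diff :: "(('d::finite) sfun \<times> 'd vfun) \<Rightarrow> ('d sfun \<times> 'd vfun) \<Rightarrow> ('d sfun \<times> 'd vfun)" where
  "U_diff U V = ((\<lambda>x. fst U x - fst V x), (\<lambda>x. snd U x - snd V x))"

definition closed_subspace_U :: "(real^('d::finite)) set \<Rightarrow> ('d sfun \<times> 'd vfun) set \<Rightarrow> bool" where
  "closed_subspace_U \<Omega> S \<longleftrightarrow> S \<subseteq> UU \<Omega>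
     \<and> ((\<lambda>x. 0), (\<lambda>x. 0)) \<in> S
     \<and> (\<forall>U\<in>S. \<forall>V\<in>S. U_add U V \<in> S)
     \<and> (\<forall>c. \<forall>U\<in>S. U_scale c U \<in> S)
     \<and> (\<forall>X W. (\<forall>j. X j \<in> S) \<longrightarrow> W \<in> UU \<Omega>
              \<longrightarrow> (\<lambda>j. U_norm2 \<Omega> (U_diff (X j) W)) \<longlonglongrightarrow> 0 \<longrightarrow> W \<in> S)"

definition lipschitz_domain :: "(real^('d::finite)) set \<Rightarrow> bool" where
  "lipschitz_domain \<Omega> \<longleftrightarrow> open \<Omega> \<and> connected \<Omega> \<and> \<Omega> \<noteq> {} \<and>
    (\<forall>x0 \<in> frontier \<Omega>. \<exists>r>0. \<exists>Q j h L.
        orthogonal_matrix Q \<and> lipschitz_on L UNIV h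
        \<and> (\<forall>y z. (\<forall>i. i \<noteq> j \<longrightarrow> y $ i = z $ i) \<longrightarrow> h y = h z)
        \<and> \<Omega> \<inter> ball x0 r = {y \<in> ball x0 r. (Q *v (y - x0)) $ j < h (Q *v (y - x0))})"

definition polygonal_boundary :: "(real^('d::finite)) set \<Rightarrow> bool" where
  "polygonal_boundary \<Omega> \<longleftrightarrow> (\<exists>P. finite P \<and> (\<forall>p\<in>P. polytope p \<and> aff_dim p = int CARD('d) - 1)
       \<and> frontier \<Omega> = \<Union>P)"

definition simplicial_mesh :: "(real^('d::finite)) set set \<Rightarrow> (real^'d) set \<Rightarrow> bool" where
  "simplicial_mesh \<T> \<Omega> \<longleftrightarrow> finite \<T> \<and> (\<forall>K\<in>\<T>. int CARD('d) simplex K)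
     \<and> \<Union>\<T> = closure \<Omega>
     \<and> (\<forall>K\<in>\<T>. \<forall>K'\<in>\<T>. K \<noteq> K' \<longrightarrow> interior K \<inter> interior K' = {}
            \<and> (K \<inter> K') face_of K \<and> (K \<inter> K') face_of K')"

definition C1_mesh :: "(real^('d::finite)) set set \<Rightarrow> (real^'d \<Rightarrow> 'b::real_normed_vector) \<Rightarrow> bool" where
  "C1_mesh \<T> f \<longleftrightarrow> (\<forall>K\<in>\<T>. \<exists>V g. open V \<and> K \<subseteq> V
       \<and> (\<forall>x\<in>V. g differentiable (at x))
       \<and> (\<forall>i. continuous_on V (\<lambda>x. frechet_derivative g (at x) (axis i 1)))
       \<and> (\<forall>x\<in>interior K. f x = g x))"

definition eigenvalues_mat :: "real^('d::finite)^'d \<Rightarrow> real set" where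
  "eigenvalues_mat M = {c. \<exists>v. v \<noteq> 0 \<and> M *v v = c *\<^sub>R v}"

definition lambda_min :: "real^('d::finite)^'d \<Rightarrow> real" where
  "lambda_min M = Inf (eigenvalues_mat M)"

definition msqrt :: "real^('d::finite)^'d \<Rightarrow> real^'d^'d" where
  "msqrt M = (THE S. transpose S = S \<and> (\<forall>\<xi>. 0 \<le> \<xi> \<bullet> (S *v \<xi>)) \<and> S ** S = M)"

definition msqrt_inv :: "real^('d::finite)^'d \<Rightarrow> real^'d^'d" where
  "msqrt_inv M = matrix_inv (msqrt M)"

definition Wop :: "(real^('d::finite)) set \<Rightarrow> 'd sfun \<Rightarrow> ('d sfun \<times> 'd vfun) \<Rightarrow> 'd sfun" where
  "Wop \<Omega> \<gamma> U = (\<lambda>x. - wdiv \<Omega> (snd U) x + \<gamma> x * fst U x)"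

definition Zop :: "(real^('d::finite)) set \<Rightarrow> (real^'d \<Rightarrow> real^'d^'d) \<Rightarrow> 'd vfun
                   \<Rightarrow> ('d sfun \<times> 'd vfun) \<Rightarrow> 'd vfun" where
  "Zop \<Omega> A \<beta> U = (\<lambda>x. msqrt_inv (A x) *v snd U x - msqrt (A x) *v wgrad \<Omega> (fst U) x
                       + msqrt_inv (A x) *v (fst U x *\<^sub>R \<beta> x))"

definition bt' :: "(real^('d::finite)) set \<Rightarrow> (real^'d \<Rightarrow> real^'d^'d) \<Rightarrow> 'd vfun \<Rightarrow> 'd sfun \<Rightarrow> real
                  \<Rightarrow> ('d sfun \<times> 'd vfun) \<Rightarrow> ('d sfun \<times> 'd vfun) \<Rightarrow> real" where
  "bt' \<Omega> A \<beta> \<gamma> k U V = ip \<Omega> (Wop \<Omega> \<gamma> U) (fst V) + k * ip \<Omega> (Wop \<Omega> \<gamma> U) (Wop \<Omega> \<gamma> V)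
      + vip \<Omega> (Zop \<Omega> A \<beta> U) (Zop \<Omega> A \<beta> V)"

definition b' :: "(real^('d::finite)) set \<Rightarrow> (real^'d \<Rightarrow> real^'d^'d) \<Rightarrow> 'd vfun \<Rightarrow> 'd sfun \<Rightarrow> real
                  \<Rightarrow> ('d sfun \<times> 'd vfun) \<Rightarrow> ('d sfun \<times> 'd vfun) \<Rightarrow> real" where
  "b' \<Omega> A \<beta> \<gamma> k U V = ip \<Omega> (fst U) (Wop \<Omega> \<gamma> V) + bt' \<Omega> A \<beta> \<gamma> k U V"

definition B' :: "(real^('d::finite)) set \<Rightarrow> (real^'d \<Rightarrow> real^'d^'d) \<Rightarrow> 'd vfun \<Rightarrow> 'd sfun \<Rightarrow> real
                  \<Rightarrow> ('d sfun \<times> 'd vfun) \<Rightarrow> ('d sfun \<times> 'd vfun) \<Rightarrow> real" where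
  "B' \<Omega> A \<beta> \<gamma> k U V = (1 / k) * ip \<Omega> (fst U) (fst V) + b' \<Omega> A \<beta> \<gamma> k U V"

definition F' :: "(real^('d::finite)) set \<Rightarrow> 'd sfun \<Rightarrow> real \<Rightarrow> ('d sfun \<times> 'd vfun)
                  \<Rightarrow> 'd sfun \<Rightarrow> 'd sfun \<Rightarrow> real" where
  "F' \<Omega> \<gamma> k V g w = ip \<Omega> (\<lambda>x. g x + w x / k) (\<lambda>x. fst V x + k * Wop \<Omega> \<gamma> V x)"

definition coeff_assms :: "(real^('d::finite)) set \<Rightarrow> (real^'d) set set \<Rightarrow> (real^'d \<Rightarrow> real^'d^'d)
                            \<Rightarrow> 'd vfun \<Rightarrow> 'd sfun \<Rightarrow> bool" where
  "coeff_assms \<Omega> \<T> A \<beta> \<gamma> \<longleftrightarrow>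
     (\<forall>i j. Linf \<Omega> (\<lambda>x. A x $ i $ j))
   \<and> (AE x in lebesgue_on \<Omega>. transpose (A x) = A x)
   \<and> (\<exists>\<alpha>0>0. AE x in lebesgue_on \<Omega>. lambda_min (A x) \<ge> \<alpha>0)
   \<and> (\<forall>i. Linf \<Omega> (\<lambda>x. \<beta> x $ i))
   \<and> Linf \<Omega> \<gamma>
   \<and> \<beta> \<in> Hdiv \<Omega>
   \<and> Linf \<Omega> (\<lambda>x. wdiv \<Omega> \<beta> x / 2 + \<gamma> x)
   \<and> (AE x in lebesgue_on \<Omega>. wdiv \<Omega> \<beta> x / 2 + \<gamma> x \<ge> 0)
   \<and> C1_mesh \<T> \<beta> \<and> C1_mesh \<T> \<gamma>"

end

theory Submission
  imports Defs
begin

text \<open>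
  Write \<open>W\<close> for \<open>-div \<sigma> + \<gamma> u\<close>, \<open>Z\<close> for the weighted flux residual and \<open>T = u + k W\<close>. Then
  \<open>B'(u,v) = (1/k) (T u, T v) + (Z u, Z v)\<close> is symmetric and positive semidefinite, so each time step is
  a Riesz representation problem once \<open>B'\<close> is equivalent to the squared norm of \<open>U\<close>. For coercivity,
  integration by parts gives \<open>\<integral>(u div \<sigma> + \<sigma> \<bullet> \<nabla>u) = 0\<close> and \<open>\<integral>(2 u \<beta> \<bullet> \<nabla>u + u\<^sup>2 div \<beta>) = 0\<close>. Modulo these
  two null Lagrangians, the integrand of \<open>(k/2) B'(u,u)\<close> dominates
  \<open>u\<^sup>2/2 + (k \<alpha>/2) |\<nabla>u|\<^sup>2\<close> pointwise, since \<open>A\<^sup>1\<^sup>/\<^sup>2 Z = \<sigma> + u \<beta> - A \<nabla>u\<close>. The residuals then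
  control \<open>\<sigma>\<close> and \<open>div \<sigma>\<close>.
  Weak derivatives are only determined almost everywhere, so linearity of \<open>B'\<close> itself rests on the
  fundamental lemma of the calculus of variations.
\<close>

section \<open>Riesz representation for a semi-inner product\<close>

text \<open>Elements of \<open>U\<close> are functions rather than classes, and
  \<open>wgrad\<close>, \<open>wdiv\<close> pick arbitrary representatives. This shapes three
  things: Riesz's theorem is proved for a bare semi-inner form, estimates are made pointwise on jets
  and only then integrated, and uniqueness means \<open>ae_eq\<close>. A second obstacle is
  \<open>msqrt\<close>, given by a description at each point with no evident measurability in
  \<open>x\<close>. It is avoided by Cramer's rule, which makes \<open>Z \<bullet> Z\<close> a
  rational expression in the entries of \<open>A\<close>, the flux, the gradient and
  \<open>\<beta>\<close>. In the coercivity estimate the products of indefinite sign are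
  \<open>w * u\<close>, \<open>\<sigma> \<bullet> g\<close> and
  \<open>u * (\<beta> \<bullet> g)\<close>, where \<open>g\<close> is the gradient and
  \<open>w\<close> the divergence of the flux. The first two cancel each other only after
  integration; the third integrates to minus half of \<open>div \<beta>\<close> against the square
  of \<open>u\<close>, which is why the sign condition concerns
  \<open>div \<beta> / 2 + \<gamma>\<close>. The coercivity constant may blow up as \<open>k\<close>
  tends to 0, since each time step is a separate problem.\<close>

lemma discriminant_le:
  fixes a b d :: real
  assumes "\<And>s. 0 \<le> a + 2 * s * d + s\<^sup>2 * b" and "0 \<le> b"
  shows "d\<^sup>2 \<le> a * b"
proof (cases "b = 0")
  case True
  have "d = 0"
  proof (rule ccontr)
    assume "d \<noteq> 0"
    \<comment> \<open>For \<open>b = 0\<close> the expression is affine in \<open>s\<close>; this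
      \<open>s\<close> gives it the value -1.\<close>
    with assms(1)[of "- (a + 1) / (2 * d)"] True show False
      by (simp add: field_simps)
  qed
  then show ?thesis using True by simp
next
  case False
  with assms(2) have "b > 0" by simp
  \<comment> \<open>The minimiser of the quadratic is \<open>s = - d / b\<close>.\<close>
  have "0 \<le> a - d\<^sup>2 / b"
    using assms(1)[of "- d / b"] \<open>b > 0\<close> by (simp add: field_simps power2_eq_square)
  then show ?thesis using \<open>b > 0\<close> by (simp add: field_simps)
qed

lemma tendsto_0_if_power2_le:
  fixes a b :: "nat \<Rightarrow> real"
  assumes "\<And>j. (a j)\<^sup>2 \<le> b j" "b \<longlonglongrightarrow> 0"
  shows "a \<longlonglongrightarrow> 0"
proof -
  have "(\<lambda>j. (a j)\<^sup>2) \<longlonglongrightarrow> 0"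
    by (rule tendsto_sandwich[OF always_eventually always_eventually tendsto_const assms(2)])
       (simp_all add: assms(1))
  then show ?thesis by simp
qed

text \<open>The form is only semidefinite and no vector space axioms are imposed: the elements will be
  functions that represent classes modulo null sets.\<close>

locale semi_inner =
  fixes S :: "'a set" and add :: "'a \<Rightarrow> 'a \<Rightarrow> 'a" and scale :: "real \<Rightarrow> 'a \<Rightarrow> 'a"
    and B :: "'a \<Rightarrow> 'a \<Rightarrow> real"
  assumes add_closed: "u \<in> S \<Longrightarrow> v \<in> S \<Longrightarrow> add u v \<in> S"
    and scale_closed: "u \<in> S \<Longrightarrow> scale c u \<in> S"
    and B_add: "u \<in> S \<Longrightarrow> v \<in> S \<Longrightarrow> w \<in> S \<Longrightarrow> B (add u v) w = B u w + B v w"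
    and B_scale: "u \<in> S \<Longrightarrow> w \<in> S \<Longrightarrow> B (scale c u) w = c * B u w"
    and B_sym: "u \<in> S \<Longrightarrow> v \<in> S \<Longrightarrow> B u v = B v u"
    and B_nonneg: "u \<in> S \<Longrightarrow> 0 \<le> B u u"
begin

abbreviation "sub u v \<equiv> add u (scale (-1) v)"

lemma B_add_right: "u \<in> S \<Longrightarrow> v \<in> S \<Longrightarrow> w \<in> S \<Longrightarrow> B w (add u v) = B w u + B w v"
  using B_add[of u v w] B_sym[of w "add u v"] B_sym[of u w] B_sym[of v w] by (simp add: add_closed)

lemma B_scale_right: "u \<in> S \<Longrightarrow> w \<in> S \<Longrightarrow> B w (scale c u) = c * B w u"
  using B_scale[of u w c] B_sym[of w "scale c u"] B_sym[of u w] by (simp add: scale_closed)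

lemma B_add_scale:
  assumes "u \<in> S" "v \<in> S"
  shows "B (add u (scale s v)) (add u (scale s v)) = B u u + 2 * s * B u v + s\<^sup>2 * B v v"
  using assms
  by (simp add: B_add B_scale add_closed scale_closed B_add_right B_scale_right
      B_sym[of v u] algebra_simps power2_eq_square)

lemma Cauchy_Schwarz:
  assumes "u \<in> S" "v \<in> S"
  shows "(B u v)\<^sup>2 \<le> B u u * B v v"
proof (rule discriminant_le)
  show "0 \<le> B u u + 2 * s * B u v + s\<^sup>2 * B v v" for s
    using B_nonneg[of "add u (scale s v)"] B_add_scale[OF assms, of s] assms
    by (simp add: add_closed scale_closed)
qed (use assms B_nonneg in auto)

text \<open>Direct method for \<open>J v = B v v - 2 * F v\<close>. The premise on
  \<open>2 * F v\<close> encodes continuity of \<open>F\<close>: applied to multiples of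
  \<open>v\<close>, it bounds the square of \<open>F v\<close> by \<open>C * B v v\<close>. The
  limit \<open>w\<close> is never shown to minimise \<open>J\<close>; the variational equation is
  obtained along the minimising sequence and passed to the limit.\<close>

theorem Riesz_representation:
  assumes ne: "S \<noteq> {}"
    and F_add: "\<And>u v. u \<in> S \<Longrightarrow> v \<in> S \<Longrightarrow> F (add u v) = F u + F v"
    and F_scale: "\<And>c u. u \<in> S \<Longrightarrow> F (scale c u) = c * F u"
    and F_bdd: "\<And>v. v \<in> S \<Longrightarrow> 2 * F v \<le> B v v + C"
    and complete: "\<And>X. (\<And>j. X j \<in> S) \<Longrightarrow>
        (\<And>e. e > 0 \<Longrightarrow> \<exists>M. \<forall>i\<ge>M. \<forall>j\<ge>M. B (sub (X i) (X j)) (sub (X i) (X j)) < e) \<Longrightarrow>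
        \<exists>w\<in>S. (\<lambda>j. B (sub (X j) w) (sub (X j) w)) \<longlonglongrightarrow> 0"
  shows "\<exists>u\<in>S. \<forall>v\<in>S. B u v = F v"
proof -
  define J where "J v = B v v - 2 * F v" for v
  define m where "m = Inf (J ` S)"
  have bdd: "bdd_below (J ` S)"
    by (rule bdd_belowI[of _ "- C"]) (use F_bdd in \<open>fastforce simp: J_def\<close>)
  have m_le: "m \<le> J v" if "v \<in> S" for v
    unfolding m_def using bdd that by (simp add: cInf_lower)
  have "\<exists>v\<in>S. J v < m + inverse (real (Suc j))" for j
    using cInf_lessD[of "J ` S" "m + inverse (real (Suc j))"] ne by (auto simp: m_def)
  then obtain X where X: "\<And>j. X j \<in> S" "\<And>j. J (X j) < m + inverse (real (Suc j))"
    by metis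
  \<comment> \<open>Parallelogram law: \<open>F\<close> is linear, so its terms cancel in
    \<open>2 * J (X i) + 2 * J (X j) - 4 * J mid\<close>, and the midpoint \<open>mid\<close> cannot
    go below the infimum \<open>m\<close>.\<close>
  have XB: "B (sub (X i) (X j)) (sub (X i) (X j))
      < 2 * inverse (real (Suc i)) + 2 * inverse (real (Suc j))" for i j
  proof -
    have mid: "scale (1/2) (add (X i) (X j)) \<in> S"
      using X by (simp add: add_closed scale_closed)
    have "4 * J (scale (1/2) (add (X i) (X j)))
        = B (X i) (X i) + 2 * B (X i) (X j) + B (X j) (X j) - 4 * F (X i) - 4 * F (X j)"
      using X by (simp add: J_def B_add B_scale F_add F_scale add_closed scale_closed
          B_add_right B_scale_right
          B_sym[of "X j" "X i"] algebra_simps)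
    then have "B (sub (X i) (X j)) (sub (X i) (X j))
        = 2 * J (X i) + 2 * J (X j) - 4 * J (scale (1/2) (add (X i) (X j)))"
      using X B_add_scale[of "X i" "X j" "-1"] by (simp add: J_def)
    with X(2)[of i] X(2)[of j] m_le[OF mid] show ?thesis by linarith
  qed
  have "\<exists>M. \<forall>i\<ge>M. \<forall>j\<ge>M. B (sub (X i) (X j)) (sub (X i) (X j)) < e" if "e > 0" for e
  proof -
    obtain M where M: "inverse (real (Suc M)) < e / 4"
      using reals_Archimedean[of "e/4"] \<open>e > 0\<close> by auto
    have le: "inverse (real (Suc i)) < e / 4" if "i \<ge> M" for i
    proof -
      have "inverse (real (Suc i)) \<le> inverse (real (Suc M))"
        using that by (intro le_imp_inverse_le) auto
      with M show ?thesis by linarith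
    qed
    have "B (sub (X i) (X j)) (sub (X i) (X j)) < e" if "i \<ge> M" "j \<ge> M" for i j
      using XB[of i j] le[OF that(1)] le[OF that(2)] by linarith
    then show ?thesis by blast
  qed
  then obtain w where w: "w \<in> S" "(\<lambda>j. B (sub (X j) w) (sub (X j) w)) \<longlonglongrightarrow> 0"
    using complete[of X] X by auto
  have "B w v = F v" if v: "v \<in> S" for v
  proof -
    \<comment> \<open>Quantitative Euler-Lagrange equation: \<open>X j\<close> is within
      \<open>inverse (Suc j)\<close> of the infimum, so moving it by \<open>s\<close> times
      \<open>v\<close> yields a nonnegative quadratic in \<open>s\<close> whose discriminant bounds
      the defect.\<close>
    have "(B (X j) v - F v)\<^sup>2 \<le> inverse (real (Suc j)) * B v v" for j
    proof (rule discriminant_le)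
      fix s
      have "m \<le> J (add (X j) (scale s v))"
        using X v by (intro m_le) (simp add: add_closed scale_closed)
      also have "\<dots> = J (X j) + 2 * s * (B (X j) v - F v) + s\<^sup>2 * B v v"
        using B_add_scale[of "X j" v s] X v
        by (simp add: J_def F_add F_scale scale_closed algebra_simps)
      finally show "0 \<le> inverse (real (Suc j)) + 2 * s * (B (X j) v - F v) + s\<^sup>2 * B v v"
        using X(2)[of j] by linarith
    qed (use v B_nonneg in auto)
    moreover have "(\<lambda>j. inverse (real (Suc j)) * B v v) \<longlonglongrightarrow> 0"
      using tendsto_mult_left_zero[OF LIMSEQ_inverse_real_of_nat] .
    ultimately have 1: "(\<lambda>j. B (X j) v - F v) \<longlonglongrightarrow> 0"
      by (rule tendsto_0_if_power2_le)
    have "(B (X j) v - B w v)\<^sup>2 \<le> B (sub (X j) w) (sub (X j) w) * B v v" for j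
      using Cauchy_Schwarz[of "sub (X j) w" v] X w v
      by (simp add: B_add B_scale add_closed scale_closed)
    moreover have "(\<lambda>j. B (sub (X j) w) (sub (X j) w) * B v v) \<longlonglongrightarrow> 0"
      using tendsto_mult_left_zero[OF w(2)] .
    ultimately have 2: "(\<lambda>j. B (X j) v - B w v) \<longlonglongrightarrow> 0"
      by (rule tendsto_0_if_power2_le)
    from tendsto_diff[OF 1 2] have "(\<lambda>j. B w v - F v) \<longlonglongrightarrow> 0" by simp
    then show ?thesis by (simp add: LIMSEQ_const_iff)
  qed
  with w show ?thesis by blast
qed

end

section \<open>Square-integrable functions\<close>

text \<open>One notion for scalar functions, vector fields and jets, so that convergence and
  completeness are proved once.\<close>

definition sq_integrable :: "'a measure \<Rightarrow> ('a \<Rightarrow> 'b::euclidean_space) \<Rightarrow> bool" where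
  "sq_integrable M f \<longleftrightarrow> f \<in> borel_measurable M \<and> integrable M (\<lambda>x. (norm (f x))\<^sup>2)"

lemma sq_integrableD:
  "sq_integrable M f \<Longrightarrow> f \<in> borel_measurable M"
  "sq_integrable M f \<Longrightarrow> integrable M (\<lambda>x. (norm (f x))\<^sup>2)"
  by (auto simp: sq_integrable_def)

lemma sq_integrable_bound:
  assumes "f \<in> borel_measurable M" "integrable M g" "AE x in M. (norm (f x))\<^sup>2 \<le> g x"
  shows "sq_integrable M f"
  unfolding sq_integrable_def
proof (intro conjI)
  show "integrable M (\<lambda>x. (norm (f x))\<^sup>2)"
    by (rule Bochner_Integration.integrable_bound[OF assms(2)])
       (use assms(1,3) in auto)
qed (fact assms(1))

lemma norm_add_power2_le: "(norm (x + y :: 'a::real_normed_vector))\<^sup>2 \<le> 2 * (norm x)\<^sup>2 + 2 * (norm y)\<^sup>2"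
proof -
  have "(norm (x + y))\<^sup>2 \<le> (norm x + norm y)\<^sup>2"
    by (intro power_mono norm_triangle_ineq) auto
  also have "\<dots> \<le> 2 * (norm x)\<^sup>2 + 2 * (norm y)\<^sup>2"
    using sum_squares_bound[of "norm x" "norm y"] by (simp add: power2_sum)
  finally show ?thesis .
qed

lemma sq_integrable_add:
  assumes "sq_integrable M f" "sq_integrable M g"
  shows "sq_integrable M (\<lambda>x. f x + g x)"
  by (rule sq_integrable_bound[where g = "\<lambda>x. 2 * (norm (f x))\<^sup>2 + 2 * (norm (g x))\<^sup>2"])
     (use assms norm_add_power2_le in \<open>auto simp: sq_integrable_def\<close>)

lemma sq_integrable_scaleR:
  assumes "sq_integrable M f"
  shows "sq_integrable M (\<lambda>x. c *\<^sub>R f x)"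
  using assms by (auto simp: sq_integrable_def power_mult_distrib)

lemma sq_integrable_diff:
  assumes "sq_integrable M f" "sq_integrable M g"
  shows "sq_integrable M (\<lambda>x. f x - g x)"
  using sq_integrable_add[OF assms(1) sq_integrable_scaleR[OF assms(2), of "-1"]] by simp

lemma abs_inner_le: "\<bar>x \<bullet> y\<bar> \<le> ((norm (x::'a::real_inner))\<^sup>2 + (norm y)\<^sup>2) / 2"
  using Cauchy_Schwarz_ineq2[of x y] sum_squares_bound[of "norm x" "norm y"] by simp

lemma integrable_inner_sq:
  assumes "sq_integrable M f" "sq_integrable M g"
  shows "integrable M (\<lambda>x. f x \<bullet> g x)"
  by (rule Bochner_Integration.integrable_bound[where f = "\<lambda>x. ((norm (f x))\<^sup>2 + (norm (g x))\<^sup>2) / 2"])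
     (use assms abs_inner_le in \<open>auto simp: sq_integrable_def\<close>)

lemma integrable_mult_sq:
  fixes f g :: "'a \<Rightarrow> real"
  assumes "sq_integrable M f" "sq_integrable M g"
  shows "integrable M (\<lambda>x. f x * g x)"
  using integrable_inner_sq[OF assms] by simp

text \<open>An instance of the abstract inequality: square-integrable functions, without quotienting
  by null sets, already carry a semi-inner form.\<close>

lemma integral_Cauchy_Schwarz:
  fixes f g :: "'a \<Rightarrow> 'b::euclidean_space"
  assumes "sq_integrable M f" "sq_integrable M g"
  shows "(LINT x|M. f x \<bullet> g x)\<^sup>2 \<le> (LINT x|M. (norm (f x))\<^sup>2) * (LINT x|M. (norm (g x))\<^sup>2)"
proof -
  interpret semi_inner "Collect (sq_integrable M)" "\<lambda>f g x. f x + g x" "\<lambda>c f x. c *\<^sub>R f x"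
    "\<lambda>f g. LINT x|M. f x \<bullet> (g x :: 'b)"
    by unfold_locales
       (auto simp: sq_integrable_add sq_integrable_scaleR inner_add_left integrable_inner_sq
         intro: Bochner_Integration.integral_cong inner_commute)
  show ?thesis using Cauchy_Schwarz[of f g] assms by (simp add: power2_norm_eq_inner)
qed

lemma tendsto_integral_inner:
  fixes f g :: "'a \<Rightarrow> 'b::euclidean_space"
  assumes X: "\<And>j. sq_integrable M (X j)" and f: "sq_integrable M f" and g: "sq_integrable M g"
    and lim: "(\<lambda>j. LINT x|M. (norm (X j x - f x))\<^sup>2) \<longlonglongrightarrow> 0"
  shows "(\<lambda>j. LINT x|M. X j x \<bullet> g x) \<longlonglongrightarrow> (LINT x|M. f x \<bullet> g x)"
proof -
  have "((LINT x|M. X j x \<bullet> g x) - (LINT x|M. f x \<bullet> g x))\<^sup>2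
      \<le> (LINT x|M. (norm (X j x - f x))\<^sup>2) * (LINT x|M. (norm (g x))\<^sup>2)" for j
    using integral_Cauchy_Schwarz[OF sq_integrable_diff[OF X f] g, of j]
    by (simp add: inner_diff_left integrable_inner_sq[OF X g] integrable_inner_sq[OF f g])
  from tendsto_0_if_power2_le[OF this tendsto_mult_left_zero[OF lim]]
  show ?thesis by (rule LIM_zero_cancel)
qed

text \<open>Each sequence is limit plus error; the product splits into error times error and two
  terms with one fixed factor. Needed where a test function and its gradient vary together.\<close>

lemma tendsto_integral_inner_both:
  fixes f g :: "'a \<Rightarrow> 'b::euclidean_space"
  assumes X: "\<And>j. sq_integrable M (X j)" and Y: "\<And>j. sq_integrable M (Y j)"
    and f: "sq_integrable M f" and g: "sq_integrable M g"
    and limX: "(\<lambda>j. LINT x|M. (norm (X j x - f x))\<^sup>2) \<longlonglongrightarrow> 0"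
    and limY: "(\<lambda>j. LINT x|M. (norm (Y j x - g x))\<^sup>2) \<longlonglongrightarrow> 0"
  shows "(\<lambda>j. LINT x|M. X j x \<bullet> Y j x) \<longlonglongrightarrow> (LINT x|M. f x \<bullet> g x)"
proof -
  have "((LINT x|M. (X j x - f x) \<bullet> (Y j x - g x)))\<^sup>2
      \<le> (LINT x|M. (norm (X j x - f x))\<^sup>2) * (LINT x|M. (norm (Y j x - g x))\<^sup>2)" for j
    by (intro integral_Cauchy_Schwarz sq_integrable_diff X Y f g)
  from tendsto_0_if_power2_le[OF this tendsto_mult_zero[OF limX limY]]
  have 1: "(\<lambda>j. LINT x|M. (X j x - f x) \<bullet> (Y j x - g x)) \<longlonglongrightarrow> 0" .
  have 2: "(\<lambda>j. LINT x|M. X j x \<bullet> g x) \<longlonglongrightarrow> (LINT x|M. f x \<bullet> g x)"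
    by (rule tendsto_integral_inner[OF X f g limX])
  have 3: "(\<lambda>j. LINT x|M. f x \<bullet> Y j x) \<longlonglongrightarrow> (LINT x|M. f x \<bullet> g x)"
    using tendsto_integral_inner[OF Y g f limY] by (simp add: inner_commute)
  have eq: "(LINT x|M. X j x \<bullet> Y j x) = (LINT x|M. (X j x - f x) \<bullet> (Y j x - g x))
      + (LINT x|M. X j x \<bullet> g x) + (LINT x|M. f x \<bullet> Y j x) - (LINT x|M. f x \<bullet> g x)" for j
    by (simp add: inner_diff_left inner_diff_right integrable_inner_sq X Y f g)
  show ?thesis unfolding eq
    using tendsto_diff[OF tendsto_add[OF tendsto_add[OF 1 2] 3] tendsto_const[of "LINT x|M. f x \<bullet> g x"]] by simp
qed

text \<open>Sum and integral are exchanged in the extended nonnegative reals, and a function with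
  finite integral is finite almost everywhere.\<close>

lemma AE_norm_summable:
  fixes d :: "nat \<Rightarrow> 'a \<Rightarrow> 'b::euclidean_space"
  assumes int: "\<And>j. integrable M (\<lambda>x. norm (d j x))" and meas: "\<And>j. d j \<in> borel_measurable M"
    and sum: "summable (\<lambda>j. LINT x|M. norm (d j x))"
  shows "AE x in M. summable (\<lambda>j. norm (d j x))"
proof -
  note [measurable] = meas
  have "(\<integral>\<^sup>+x. (\<Sum>j. ennreal (norm (d j x))) \<partial>M) = (\<Sum>j. \<integral>\<^sup>+x. ennreal (norm (d j x)) \<partial>M)"
    by (intro nn_integral_suminf) auto
  also have "\<dots> = (\<Sum>j. ennreal (LINT x|M. norm (d j x)))"
    by (intro suminf_cong nn_integral_eq_integral int) auto
  also have "\<dots> = ennreal (\<Sum>j. LINT x|M. norm (d j x))"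
    by (intro suminf_ennreal2 sum) auto
  finally have "(\<integral>\<^sup>+x. (\<Sum>j. ennreal (norm (d j x))) \<partial>M) \<noteq> \<infinity>" by simp
  then have "AE x in M. (\<Sum>j. ennreal (norm (d j x))) \<noteq> \<infinity>"
    by (intro nn_integral_PInf_AE) auto
  then show ?thesis
    by eventually_elim (auto intro!: summable_suminf_not_top)
qed

text \<open>Finiteness of the measure turns smallness of the differences in the square mean into
  summability in the mean; the telescoping series then converges absolutely almost
  everywhere.\<close>

lemma (in finite_measure) rapidly_Cauchy_AE_convergent:
  fixes Y :: "nat \<Rightarrow> 'a \<Rightarrow> 'b::euclidean_space"
  assumes Y: "\<And>j. sq_integrable M (Y j)"
    and fast: "\<And>j. (LINT x|M. (norm (Y (Suc j) x - Y j x))\<^sup>2) \<le> (1/4) ^ j"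
  shows "AE x in M. convergent (\<lambda>j. Y j x)"
proof -
  define d where "d j x = Y (Suc j) x - Y j x" for j x
  have d: "sq_integrable M (d j)" for j
    unfolding d_def by (intro sq_integrable_diff Y)
  note [measurable] = sq_integrableD(1)[OF d]
  \<comment> \<open>Young's inequality with weight \<open>2 ^ j\<close>, chosen so that under the
    rate \<open>(1/4) ^ j\<close> both terms have integrals of order
    \<open>(1/2) ^ j\<close>.\<close>
  have bound: "norm (d j x) \<le> (2 ^ j * (norm (d j x))\<^sup>2 + (1/2) ^ j) / 2" for j x
  proof -
    have "0 \<le> (2 ^ j * norm (d j x) - 1)\<^sup>2 / 2 ^ j" by simp
    also have "\<dots> = 2 ^ j * (norm (d j x))\<^sup>2 + (1/2) ^ j - 2 * norm (d j x)"
      by (simp add: power2_eq_square field_simps power_one_over)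
    finally show ?thesis by simp
  qed
  have bint: "integrable M (\<lambda>x. (2 ^ j * (norm (d j x))\<^sup>2 + (1/2) ^ j) / 2)" for j
    using sq_integrableD(2)[OF d] by auto
  have int: "integrable M (\<lambda>x. norm (d j x))" for j
    by (rule Bochner_Integration.integrable_bound[OF bint[of j]]) (use order_trans[OF bound abs_ge_self] in auto)
  have L1: "(LINT x|M. norm (d j x)) \<le> ((1 + measure M (space M)) / 2) * (1/2) ^ j" for j
  proof -
    have "(LINT x|M. norm (d j x)) \<le> (LINT x|M. (2 ^ j * (norm (d j x))\<^sup>2 + (1/2) ^ j) / 2)"
      by (intro integral_mono int bint bound)
    also have "\<dots> = (2 ^ j * (LINT x|M. (norm (d j x))\<^sup>2) + measure M (space M) * (1/2) ^ j) / 2"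
      using sq_integrableD(2)[OF d] by simp
    also have "\<dots> \<le> (2 ^ j * (1/4) ^ j + measure M (space M) * (1/2) ^ j) / 2"
      using fast[of j] by (intro divide_right_mono add_mono mult_left_mono) (auto simp: d_def)
    also have "2 ^ j * (1/4) ^ j = ((1/2) ^ j :: real)"
      by (simp flip: power_mult_distrib)
    finally show ?thesis by (simp add: field_simps)
  qed
  have "summable (\<lambda>j. LINT x|M. norm (d j x))"
  proof (rule summable_comparison_test')
    show "summable (\<lambda>j. ((1 + measure M (space M)) / 2) * (1/2) ^ j)"
      by (intro summable_mult summable_geometric) simp
  qed (use L1 in auto)
  then have "AE x in M. summable (\<lambda>j. norm (d j x))"
    by (intro AE_norm_summable int) auto
  then show ?thesis
  proof eventually_elim
    case (elim x)
    then have "summable (\<lambda>j. d j x)" by (rule summable_norm_cancel)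
    then have "convergent (\<lambda>n. \<Sum>j<n. d j x)" by (simp add: summable_iff_convergent)
    then have "convergent (\<lambda>n. Y n x - Y 0 x)"
      unfolding d_def sum_lessThan_telescope[of "\<lambda>n. Y n x"] .
    then show ?case by (simp add: convergent_diff_const_right_iff)
  qed
qed

text \<open>Riesz-Fischer: a rapidly Cauchy subsequence supplies the pointwise limit, and Fatou's
  lemma carries the Cauchy bound over to it.\<close>

theorem (in finite_measure) sq_integrable_complete:
  fixes X :: "nat \<Rightarrow> 'a \<Rightarrow> 'b::euclidean_space"
  assumes X: "\<And>j. sq_integrable M (X j)"
    and Cauchy: "\<And>e. e > 0 \<Longrightarrow> \<exists>K. \<forall>i\<ge>K. \<forall>j\<ge>K. (LINT x|M. (norm (X i x - X j x))\<^sup>2) < e"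
  shows "\<exists>g. sq_integrable M g \<and> (\<lambda>j. LINT x|M. (norm (X j x - g x))\<^sup>2) \<longlonglongrightarrow> 0"
proof -
  note [measurable] = sq_integrableD(1)[OF X]
  have "\<forall>n. \<exists>K. \<forall>i\<ge>K. \<forall>j\<ge>K. (LINT x|M. (norm (X i x - X j x))\<^sup>2) < (1/4) ^ n"
    by (intro allI Cauchy) simp
  from choice[OF this] obtain K
    where K: "\<And>n i j. i \<ge> K n \<Longrightarrow> j \<ge> K n \<Longrightarrow> (LINT x|M. (norm (X i x - X j x))\<^sup>2) < (1/4) ^ n"
    by blast
  \<comment> \<open>The sum puts both \<open>r n\<close> and \<open>r (Suc n)\<close> beyond
    \<open>K n\<close>; the extra \<open>n\<close> sends \<open>r n\<close> to infinity, which the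
    Fatou argument uses.\<close>
  define r where "r n = (\<Sum>i\<le>n. K i) + n" for n
  have r_ge: "r n \<ge> K n" "r (Suc n) \<ge> K n" "r n \<ge> n" for n
    using member_le_sum[of n "{..n}" K] by (auto simp: r_def)
  have conv: "AE x in M. convergent (\<lambda>n. X (r n) x)"
    by (rule rapidly_Cauchy_AE_convergent) (fact X, rule less_imp_le[OF K[OF r_ge(2) r_ge(1)]])
  define g where "g x = lim (\<lambda>n. X (r n) x)" for x
  have [measurable]: "g \<in> borel_measurable M"
    unfolding g_def by (rule borel_measurable_lim_metric) auto
  have lim: "AE x in M. (\<lambda>n. X (r n) x) \<longlonglongrightarrow> g x"
    using conv by eventually_elim (simp add: g_def convergent_LIMSEQ_iff)
  have Fatou: "(\<integral>\<^sup>+x. ennreal ((norm (X j x - g x))\<^sup>2) \<partial>M) \<le> ennreal e"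
    if e: "0 \<le> e" and M: "\<And>i. i \<ge> M' \<Longrightarrow> (LINT x|M. (norm (X j x - X i x))\<^sup>2) \<le> e" for j e M'
  proof -
    have "(\<integral>\<^sup>+x. ennreal ((norm (X j x - g x))\<^sup>2) \<partial>M)
        = (\<integral>\<^sup>+x. liminf (\<lambda>n. ennreal ((norm (X j x - X (r n) x))\<^sup>2)) \<partial>M)"
    proof (rule nn_integral_cong_AE, use lim in eventually_elim)
      case (elim x)
      then have "(\<lambda>n. ennreal ((norm (X j x - X (r n) x))\<^sup>2)) \<longlonglongrightarrow> ennreal ((norm (X j x - g x))\<^sup>2)"
        by (intro tendsto_intros)
      from lim_imp_Liminf[OF trivial_limit_sequentially this] show ?case by (rule sym)
    qed
    also have "\<dots> \<le> liminf (\<lambda>n. \<integral>\<^sup>+x. ennreal ((norm (X j x - X (r n) x))\<^sup>2) \<partial>M)"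
      by (rule nn_integral_liminf) measurable
    also have "\<dots> \<le> ennreal e"
    proof (rule Liminf_le[OF trivial_limit_sequentially eventually_mono[OF eventually_ge_at_top[of M']]])
      fix n assume "n \<ge> M'"
      then have "r n \<ge> M'" using r_ge(3)[of n] by simp
      then show "(\<integral>\<^sup>+x. ennreal ((norm (X j x - X (r n) x))\<^sup>2) \<partial>M) \<le> ennreal e"
        using M[of "r n"]
        by (subst nn_integral_eq_integral) (auto intro!: sq_integrableD(2) sq_integrable_diff X ennreal_leI)
    qed
    finally show ?thesis .
  qed
  have small: "integrable M (\<lambda>x. (norm (X j x - g x))\<^sup>2) \<and> (LINT x|M. (norm (X j x - g x))\<^sup>2) \<le> e"
    if e: "0 \<le> e" and M: "\<And>i. i \<ge> M' \<Longrightarrow> (LINT x|M. (norm (X j x - X i x))\<^sup>2) \<le> e" for j e M'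
  proof
    have le: "(\<integral>\<^sup>+x. ennreal ((norm (X j x - g x))\<^sup>2) \<partial>M) \<le> ennreal e"
      by (rule Fatou[OF e M])
    show int: "integrable M (\<lambda>x. (norm (X j x - g x))\<^sup>2)"
      using le_less_trans[OF le ennreal_less_top] by (intro integrableI_bounded) auto
    show "(LINT x|M. (norm (X j x - g x))\<^sup>2) \<le> e"
      using le nn_integral_eq_integral[OF int] e by (simp add: ennreal_le_iff)
  qed
  \<comment> \<open>At index \<open>K 0\<close> the Cauchy bound is \<open>(1/4) ^ 0 = 1\<close>, so
    \<open>g\<close> differs from \<open>X (K 0)\<close> by a square-integrable function.\<close>
  have "sq_integrable M (\<lambda>x. X (K 0) x - g x)"
    using small[of 1 "K 0" "K 0"] K[of 0 "K 0"] by (auto simp: sq_integrable_def less_imp_le)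
  from sq_integrable_diff[OF X[of "K 0"] this] have g: "sq_integrable M g" by simp
  have "(\<lambda>j. LINT x|M. (norm (X j x - g x))\<^sup>2) \<longlonglongrightarrow> 0"
  proof (rule LIMSEQ_I)
    fix e :: real assume "e > 0"
    then obtain L where L: "\<And>i j. i \<ge> L \<Longrightarrow> j \<ge> L \<Longrightarrow> (LINT x|M. (norm (X i x - X j x))\<^sup>2) < e/2"
      using Cauchy[of "e/2"] by auto
    have "norm ((LINT x|M. (norm (X j x - g x))\<^sup>2) - 0) < e" if "j \<ge> L" for j
    proof -
      have "(LINT x|M. (norm (X j x - g x))\<^sup>2) \<le> e/2"
        using small[of "e/2" L j] L[OF that] \<open>e > 0\<close> by (auto simp: less_imp_le)
      moreover have "0 \<le> (LINT x|M. (norm (X j x - g x))\<^sup>2)" by simp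
      ultimately show ?thesis using \<open>e > 0\<close> by simp
    qed
    then show "\<exists>L. \<forall>j\<ge>L. norm ((LINT x|M. (norm (X j x - g x))\<^sup>2) - 0) < e" by blast
  qed
  with g show ?thesis by blast
qed

section \<open>Square roots of positive definite matrices\<close>

text \<open>\<open>e\<close> minimises the Rayleigh quotient on the compact unit sphere of
  \<open>V\<close>. Its first variation vanishes in every direction of \<open>V\<close>, and
  invariance of \<open>V\<close> admits the direction \<open>f e - c *\<^sub>R e\<close>
  itself.\<close>

lemma selfadjoint_min_eigenvector:
  fixes f :: "'a::euclidean_space \<Rightarrow> 'a"
  assumes lin: "linear f" and sa: "\<And>x y. x \<bullet> f y = f x \<bullet> y"
    and V: "subspace V" "f ` V \<subseteq> V" "V \<noteq> {0}"
  shows "\<exists>e\<in>V. \<exists>c. norm e = 1 \<and> f e = c *\<^sub>R e \<and> (\<forall>v\<in>V. c * (norm v)\<^sup>2 \<le> v \<bullet> f v)"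
proof -
  interpret linear f by (fact lin)
  let ?K = "sphere 0 1 \<inter> V"
  obtain v0 where v0: "v0 \<in> V" "v0 \<noteq> 0" using V(1,3) subspace_0 by blast
  then have "(1 / norm v0) *\<^sub>R v0 \<in> ?K" using V(1) by (simp add: subspace_scale)
  moreover have "compact ?K" using closed_subspace[OF V(1)] by (simp add: compact_Int_closed)
  moreover have "continuous_on ?K (\<lambda>v. v \<bullet> f v)"
    by (intro continuous_intros linear_continuous_on linear_linear[THEN iffD2] lin)
  ultimately obtain e where e: "e \<in> ?K" "\<And>v. v \<in> ?K \<Longrightarrow> e \<bullet> f e \<le> v \<bullet> f v"
    using continuous_attains_inf[of ?K "\<lambda>v. v \<bullet> f v"] by blast
  define c where "c = e \<bullet> f e"
  have min: "c * (norm v)\<^sup>2 \<le> v \<bullet> f v" if "v \<in> V" for v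
  proof (cases "v = 0")
    case False
    have "(1 / norm v) *\<^sub>R v \<in> ?K" using that V(1) False by (simp add: subspace_scale)
    from e(2)[OF this] False show ?thesis
      by (simp add: c_def scale power2_eq_square field_simps)
  qed (simp add: zero)
  \<comment> \<open>The form \<open>v \<bullet> f v - c * (norm v)\<^sup>2\<close> is nonnegative on
    \<open>V\<close> and zero at \<open>e\<close>. Along \<open>e + s *\<^sub>R v\<close> its
    constant term is therefore 0, and the discriminant bound kills the linear term.\<close>
  have orth: "(v \<bullet> (f e - c *\<^sub>R e))\<^sup>2 \<le> 0 * (v \<bullet> f v - c * (norm v)\<^sup>2)" if "v \<in> V" for v
  proof (rule discriminant_le)
    fix s
    have "c * (norm (e + s *\<^sub>R v))\<^sup>2 \<le> (e + s *\<^sub>R v) \<bullet> f (e + s *\<^sub>R v)"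
      using that e V(1) by (intro min) (simp add: subspace_add subspace_scale)
    moreover have "(e + s *\<^sub>R v) \<bullet> f (e + s *\<^sub>R v) = c + 2 * s * (v \<bullet> f e) + s\<^sup>2 * (v \<bullet> f v)"
      using sa[of e v] by (simp add: c_def add scale inner_add_left inner_add_right
          inner_commute[of "f e" v] power2_eq_square algebra_simps)
    moreover have "(norm (e + s *\<^sub>R v))\<^sup>2 = 1 + 2 * s * (v \<bullet> e) + s\<^sup>2 * (norm v)\<^sup>2"
      using e(1) unfolding power2_norm_eq_inner
      by (simp add: inner_add_left inner_add_right inner_commute[of e v] power2_eq_square
          algebra_simps norm_eq_1)
    ultimately show "0 \<le> 0 + 2 * s * (v \<bullet> (f e - c *\<^sub>R e)) + s\<^sup>2 * (v \<bullet> f v - c * (norm v)\<^sup>2)"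
      by (simp add: inner_diff_right algebra_simps)
  qed (use min[OF that] in simp)
  have "f e - c *\<^sub>R e \<in> V"
    using e V by (auto intro!: subspace_diff subspace_scale)
  from orth[OF this] have "f e = c *\<^sub>R e" by simp
  with e min show ?thesis by auto
qed

text \<open>Spectral theorem by induction on the dimension: the orthogonal complement of an
  eigenvector within \<open>V\<close> is invariant because \<open>f\<close> is self-adjoint.\<close>

lemma selfadjoint_orthonormal_eigenbasis:
  fixes f :: "'a::euclidean_space \<Rightarrow> 'a"
  assumes lin: "linear f" and sa: "\<And>x y. x \<bullet> f y = f x \<bullet> y"
    and V: "subspace V" "f ` V \<subseteq> V"
  shows "\<exists>E. pairwise orthogonal E \<and> E \<subseteq> V \<and> span E = V \<and> (\<forall>e\<in>E. norm e = 1 \<and> (\<exists>c. f e = c *\<^sub>R e))"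
  using V
proof (induction "dim V" arbitrary: V rule: less_induct)
  case less
  show ?case
  proof (cases "V = {0}")
    case True
    then show ?thesis by (intro exI[of _ "{}"]) auto
  next
    case False
    obtain e c where e: "e \<in> V" "norm e = 1" "f e = c *\<^sub>R e"
      using selfadjoint_min_eigenvector[OF lin sa less.prems False] by blast
    have ee: "e \<bullet> e = 1" using e(2) by (simp add: norm_eq_1)
    define W where "W = {v \<in> V. v \<bullet> e = 0}"
    have subW: "subspace W"
      using less.prems(1) by (auto simp: W_def subspace_def inner_add_left)
    have fW: "f ` W \<subseteq> W"
      using less.prems(2) e(3) by (auto simp: W_def simp flip: sa)
    have "e \<notin> W" using ee by (simp add: W_def)
    moreover have "W \<subseteq> V" by (auto simp: W_def)
    ultimately have "W \<subset> V" using e(1) by blast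
    then have "dim W < dim V"
      using subW less.prems(1) by (intro dim_psubset) (simp add: span_eq_iff[THEN iffD2])
    from less.hyps[OF this subW fW] obtain E where E: "pairwise orthogonal E" "E \<subseteq> W" "span E = W"
      "\<forall>e\<in>E. norm e = 1 \<and> (\<exists>c. f e = c *\<^sub>R e)" by blast
    have "v \<in> span (insert e E)" if "v \<in> V" for v
    proof -
      have "v - (v \<bullet> e) *\<^sub>R e \<in> W"
        using that e(1) less.prems(1) ee
        by (auto simp: W_def inner_diff_left intro!: subspace_diff subspace_scale)
      then show ?thesis using E(3) by (auto simp: span_insert)
    qed
    moreover have "span (insert e E) \<subseteq> V"
      using e(1) E(2) less.prems(1) by (intro span_minimal) (auto simp: W_def)
    moreover have "pairwise orthogonal (insert e E)"
      using E(1,2) by (auto simp: pairwise_insert orthogonal_def W_def inner_commute)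
    ultimately show ?thesis
      using e E by (intro exI[of _ "insert e E"]) (auto simp: W_def)
  qed
qed

lemma symmetric_matrix_selfadjoint:
  fixes M :: "real^'n^'n"
  assumes "transpose M = M"
  shows "x \<bullet> (M *v y) = (M *v x) \<bullet> y"
  using dot_lmul_matrix[of x M y] assms by (metis transpose_matrix_vector)

text \<open>The minimal Rayleigh value \<open>c\<close> is an eigenvalue and a lower bound for all
  eigenvalues; the lower bound is what makes \<open>Inf\<close> meaningful.\<close>

lemma lambda_min_le_Rayleigh:
  fixes M :: "real^'n^'n"
  assumes sym: "transpose M = M"
  shows "lambda_min M * (norm x)\<^sup>2 \<le> x \<bullet> (M *v x)"
proof -
  obtain e c where e: "norm e = 1" "M *v e = c *\<^sub>R e" "\<And>v. c * (norm v)\<^sup>2 \<le> v \<bullet> (M *v v)"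
  proof -
    have "(UNIV :: (real^'n) set) \<noteq> {0}"
      using axis_eq_0_iff[of undefined "1::real"] by (metis UNIV_I singletonD zero_neq_one)
    then show ?thesis
      using that selfadjoint_min_eigenvector[OF matrix_vector_mul_linear symmetric_matrix_selfadjoint[OF sym] subspace_UNIV]
      by blast
  qed
  have "c \<in> eigenvalues_mat M" using e(1,2) by (auto simp: eigenvalues_mat_def intro!: exI[of _ e])
  moreover have "bdd_below (eigenvalues_mat M)"
  proof (rule bdd_belowI[of _ c])
    fix d assume "d \<in> eigenvalues_mat M"
    then obtain v where "v \<noteq> 0" "M *v v = d *\<^sub>R v" by (auto simp: eigenvalues_mat_def)
    with e(3)[of v] show "c \<le> d" by (simp flip: power2_norm_eq_inner)
  qed
  ultimately have "lambda_min M \<le> c" by (simp add: lambda_min_def cInf_lower)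
  then show ?thesis using e(3)[of x] by (smt (verit) mult_right_mono zero_le_power2)
qed

text \<open>Factorisation of \<open>S ** S - c\<close> into \<open>S + sqrt c\<close> and
  \<open>S - sqrt c\<close>: a nonzero \<open>y\<close> would be an eigenvector of \<open>S\<close>
  for the negative value \<open>- sqrt c\<close>.\<close>

lemma psd_sqrt_unique_on_eigenvector:
  fixes S :: "real^'n^'n"
  assumes S: "\<forall>x. 0 \<le> x \<bullet> (S *v x)" "S ** S = M" and e: "M *v e = c *\<^sub>R e" "c > 0"
  shows "S *v e = sqrt c *\<^sub>R e"
proof -
  define y where "y = S *v e - sqrt c *\<^sub>R e"
  have "S *v (S *v e) = c *\<^sub>R e"
    using S(2) e(1) by (simp add: matrix_vector_mul_assoc)
  then have "S *v y = - sqrt c *\<^sub>R y"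
    using e(2) by (simp add: y_def matrix_vector_mult_diff_distrib matrix_vector_mult_scaleR scaleR_diff_right)
  then have "0 \<le> - sqrt c * (y \<bullet> y)" using S(1)[rule_format, of y] by simp
  then have "y \<bullet> y \<le> 0" using e(2) by (simp add: mult_le_0_iff)
  then have "y = 0" by (metis inner_ge_zero inner_eq_zero_iff order_antisym)
  then show ?thesis by (simp add: y_def)
qed

text \<open>Gives the \<open>THE\<close> in \<open>msqrt\<close> its meaning. Existence rescales an
  orthonormal eigenbasis of \<open>M\<close> by square roots of the eigenvalues; any other root is
  already prescribed on that basis.\<close>

lemma ex1_psd_sqrt:
  fixes M :: "real^'n^'n"
  assumes sym: "transpose M = M" and pos: "\<And>x. x \<noteq> 0 \<Longrightarrow> 0 < x \<bullet> (M *v x)"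
  shows "\<exists>!S. transpose S = S \<and> (\<forall>x. 0 \<le> x \<bullet> (S *v x)) \<and> S ** S = M"
proof -
  obtain E where E: "pairwise orthogonal E" "span E = UNIV"
      "\<And>e. e \<in> E \<Longrightarrow> norm e = 1" "\<And>e. e \<in> E \<Longrightarrow> \<exists>c. M *v e = c *\<^sub>R e"
    using selfadjoint_orthonormal_eigenbasis[OF matrix_vector_mul_linear symmetric_matrix_selfadjoint[OF sym] subspace_UNIV]
    by auto
  have fin: "finite E" using E(1) by (rule pairwise_orthogonal_imp_finite)
  obtain c where c: "\<And>e. e \<in> E \<Longrightarrow> M *v e = c e *\<^sub>R e" using E(4) by metis
  have c_pos: "c e > 0" if "e \<in> E" for e
    using pos[of e] c[OF that] E(3)[OF that] by (cases "e = 0") (auto simp: norm_eq_1)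
  have expand: "(\<Sum>e\<in>E. (x \<bullet> e) *\<^sub>R e) = x" for x
    using E fin by (intro orthonormal_basis_expand) auto
  have orth: "e \<bullet> e' = (if e = e' then 1 else 0)" if "e \<in> E" "e' \<in> E" for e e'
    using E(1,3) that by (auto simp: pairwise_def orthogonal_def norm_eq_1)
  define g where "g x = (\<Sum>e\<in>E. (sqrt (c e) * (x \<bullet> e)) *\<^sub>R e)" for x
  have g_lin: "linear g"
    by (rule linearI) (simp_all add: g_def inner_add_left algebra_simps sum.distrib scaleR_sum_right)
  define S where "S = matrix g"
  have S: "S *v x = g x" for x using g_lin by (simp add: S_def matrix_works)
  have g_e: "g e = sqrt (c e) *\<^sub>R e" if "e \<in> E" for e
  proof -
    have "g e = (\<Sum>e'\<in>E. if e' = e then sqrt (c e) *\<^sub>R e else 0)"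
      unfolding g_def by (rule sum.cong) (auto simp: orth that)
    then show ?thesis using that fin by simp
  qed
  have sa: "x \<bullet> g y = g x \<bullet> y" for x y
    by (simp add: g_def inner_sum_left inner_sum_right inner_commute[of _ y] mult_ac)
  have "transpose S = S"
  proof -
    have "(transpose S *v x) \<bullet> y = (S *v x) \<bullet> y" for x y
      using sa[of x y] S dot_lmul_matrix[of x S y] by simp
    then have "transpose S *v x = S *v x" for x using vector_eq_rdot by blast
    then show ?thesis using matrix_eq by blast
  qed
  moreover have "0 \<le> x \<bullet> (S *v x)" for x
  proof -
    have "x \<bullet> (S *v x) = (\<Sum>e\<in>E. sqrt (c e) * (x \<bullet> e)\<^sup>2)"
      by (simp add: S g_def inner_sum_right power2_eq_square mult_ac)
    also have "\<dots> \<ge> 0"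
      using less_imp_le[OF c_pos] by (intro sum_nonneg mult_nonneg_nonneg) auto
    finally show ?thesis .
  qed
  moreover have "S ** S = M"
  proof -
    have "g (g x) = M *v x" for x
    proof (rule linear_eq_on[of "\<lambda>x. g (g x)" "\<lambda>x. M *v x" x E])
      show "linear (\<lambda>x. g (g x))" using linear_compose[OF g_lin g_lin] by (simp add: o_def)
      show "x \<in> span E" by (simp add: E(2))
      fix e assume "e \<in> E"
      then show "g (g e) = M *v e"
        using g_e[of e] c[of e] c_pos[of e] by (simp add: linear_scale[OF g_lin])
    qed (rule matrix_vector_mul_linear)
    then show ?thesis by (simp add: matrix_eq S flip: matrix_vector_mul_assoc)
  qed
  moreover have "S' = S''"
    if "(\<forall>x. 0 \<le> x \<bullet> (S' *v x)) \<and> S' ** S' = M" "(\<forall>x. 0 \<le> x \<bullet> (S'' *v x)) \<and> S'' ** S'' = M" for S' S''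
  proof -
    have "S' *v x = S'' *v x" for x
    proof (rule linear_eq_on[of "\<lambda>x. S' *v x" "\<lambda>x. S'' *v x" x E])
      show "x \<in> span E" by (simp add: E(2))
      fix e assume "e \<in> E"
      then show "S' *v e = S'' *v e"
        using psd_sqrt_unique_on_eigenvector[OF _ _ c c_pos] that by metis
    qed (rule matrix_vector_mul_linear)+
    then show ?thesis by (simp add: matrix_eq)
  qed
  ultimately show ?thesis by blast
qed

context
  fixes M :: "real^'n^'n" and \<alpha> :: real
  assumes sym: "transpose M = M" and \<alpha>: "\<alpha> > 0" and coercive: "\<And>x. \<alpha> * (norm x)\<^sup>2 \<le> x \<bullet> (M *v x)"
begin

lemma spd_pos: "x \<noteq> 0 \<Longrightarrow> 0 < x \<bullet> (M *v x)"
  using coercive[of x] \<alpha> by (smt (verit) mult_pos_pos zero_less_norm_iff zero_less_power)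

lemma msqrt_spd:
  "transpose (msqrt M) = msqrt M" "msqrt M ** msqrt M = M"
  using theI'[OF ex1_psd_sqrt[OF sym spd_pos]] unfolding msqrt_def by auto

lemma msqrt_mult_msqrt: "msqrt M *v (msqrt M *v x) = M *v x"
  by (simp add: matrix_vector_mul_assoc msqrt_spd)

lemma norm_msqrt: "(norm (msqrt M *v x))\<^sup>2 = x \<bullet> (M *v x)"
  using symmetric_matrix_selfadjoint[OF msqrt_spd(1), of x "msqrt M *v x"]
  by (simp add: power2_norm_eq_inner msqrt_mult_msqrt)

lemma msqrt_inverse:
  "msqrt M ** msqrt_inv M = mat 1" "msqrt_inv M ** msqrt M = mat 1"
proof -
  have "x = 0" if "msqrt M *v x = 0" for x
    using that spd_pos[of x] msqrt_mult_msqrt[of x] by force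
  then have "invertible (msqrt M)"
    using invertible_left_inverse matrix_left_invertible_ker by metis
  then have "\<exists>R. msqrt M ** R = mat 1 \<and> R ** msqrt M = mat 1" by (simp add: invertible_def)
  from someI_ex[OF this] show "msqrt M ** msqrt_inv M = mat 1" "msqrt_inv M ** msqrt M = mat 1"
    by (simp_all add: msqrt_inv_def matrix_inv_def)
qed

lemma msqrt_msqrt_inv: "msqrt M *v (msqrt_inv M *v x) = x"
  by (simp add: matrix_vector_mul_assoc msqrt_inverse)

lemma norm_msqrt_inv: "(norm (msqrt_inv M *v x))\<^sup>2 \<le> (norm x)\<^sup>2 / \<alpha>"
  using coercive[of "msqrt_inv M *v x"] norm_msqrt[of "msqrt_inv M *v x"] \<alpha>
  by (simp add: msqrt_msqrt_inv field_simps)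

lemma msqrt_inner_msqrt_inv: "(msqrt M *v y) \<bullet> (msqrt_inv M *v x) = y \<bullet> x"
  by (simp add: msqrt_msqrt_inv flip: symmetric_matrix_selfadjoint[OF msqrt_spd(1)])

text \<open>Both sides equal \<open>x \<bullet> z\<close> for the solution \<open>z\<close> of
  \<open>M *v z = y\<close>, which Cramer's rule writes with determinants. The right-hand side is
  visibly measurable once the entries of \<open>M\<close>, \<open>x\<close> and \<open>y\<close>
  are.\<close>

lemma msqrt_inv_inner_msqrt_inv:
  "(msqrt_inv M *v x) \<bullet> (msqrt_inv M *v y) = x \<bullet> (\<chi> k. det (\<chi> i j. if j = k then y $ i else M $ i $ j) / det M)"
proof -
  have "det M \<noteq> 0"
    using spd_pos by (metis invertible_det_nz invertible_left_inverse matrix_left_invertible_ker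
        inner_zero_right less_irrefl)
  moreover have "M *v (msqrt_inv M *v (msqrt_inv M *v y)) = y"
    by (metis msqrt_mult_msqrt msqrt_msqrt_inv)
  ultimately have "msqrt_inv M *v (msqrt_inv M *v y) = (\<chi> k. det (\<chi> i j. if j = k then y $ i else M $ i $ j) / det M)"
    by (simp add: cramer)
  moreover have "x \<bullet> (msqrt_inv M *v (msqrt_inv M *v y)) = (msqrt_inv M *v x) \<bullet> (msqrt_inv M *v y)"
    by (metis msqrt_msqrt_inv msqrt_inner_msqrt_inv)
  ultimately show ?thesis by simp
qed

end

section \<open>Smooth bump functions and the fundamental lemma\<close>

lemma pd_eq: "(f has_derivative f') (at x) \<Longrightarrow> pd i f x = f' (axis i 1)"
  unfolding pd_def by (metis frechet_derivative_at)

lemma differentiable_pd: "f differentiable (at x) \<Longrightarrow> (f has_derivative frechet_derivative f (at x)) (at x)"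
  by (simp add: frechet_derivative_works)

lemma pd_add:
  assumes "f differentiable (at x)" "g differentiable (at x)"
  shows "pd i (\<lambda>x. f x + g x) x = pd i f x + pd i g x"
  using pd_eq[OF has_derivative_add[OF assms[THEN differentiable_pd]]] by (simp add: pd_def)

lemma pd_mult:
  assumes "f differentiable (at x)" "g differentiable (at x)"
  shows "pd i (\<lambda>x. f x * g x) x = f x * pd i g x + pd i f x * g x"
  using pd_eq[OF has_derivative_mult[OF assms[THEN differentiable_pd]]] by (simp add: pd_def)

text \<open>Reduces smoothness to exhibiting a family of differentiable functions closed under
  partial derivatives; continuity follows from differentiability, and no formula for iterated
  derivatives is required.\<close>

lemma smooth_coinduct:
  assumes "P f" and diff: "\<And>f x. P f \<Longrightarrow> f differentiable (at x)"
    and pd: "\<And>f i. P f \<Longrightarrow> P (pd i f)"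
  shows "smooth f"
proof -
  have P: "P (iter_pd is f)" for "is" by (induction "is") (use assms in auto)
  have "continuous_on UNIV g" if "P g" for g
    using diff[OF that] by (intro continuous_at_imp_continuous_on)
      (auto intro: differentiable_imp_continuous_within)
  with P diff show ?thesis unfolding smooth_def by blast
qed

lemma smooth_differentiable: "smooth f \<Longrightarrow> f differentiable (at x)"
  unfolding smooth_def by (metis iter_pd.simps(1))

lemma smooth_continuous: "smooth f \<Longrightarrow> continuous_on UNIV f"
  unfolding smooth_def by (metis iter_pd.simps(1))

lemma smooth_pd:
  assumes "smooth f"
  shows "smooth (pd i f)"
proof (rule smooth_coinduct[where P = "\<lambda>g. \<exists>is. g = iter_pd is f"])
  show "\<exists>is. pd i f = iter_pd is f" by (rule exI[of _ "[i]"]) simp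
  show "\<exists>is. pd j g = iter_pd is f" if "\<exists>is. g = iter_pd is f" for g j
    using that by (metis iter_pd.simps(2))
qed (use assms in \<open>auto simp: smooth_def\<close>)

lemma smooth_const: "smooth (\<lambda>x. c)"
proof (rule smooth_coinduct[where P = "\<lambda>g. \<exists>c. g = (\<lambda>x. c)"])
  show "\<exists>c. pd i f = (\<lambda>x. c)" if "\<exists>c. f = (\<lambda>x. c)" for f i
    using that pd_eq[OF has_derivative_const] by (intro exI[of _ 0]) auto
qed auto

text \<open>The Leibniz rule turns a product into a sum of products, so products alone are not
  closed under \<open>pd\<close>; the algebra generated by the smooth functions is.\<close>

inductive smooth_alg :: "(real^'d::finite \<Rightarrow> real) \<Rightarrow> bool" where
  base: "smooth f \<Longrightarrow> smooth_alg f"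
| add: "smooth_alg f \<Longrightarrow> smooth_alg g \<Longrightarrow> smooth_alg (\<lambda>x. f x + g x)"
| mult: "smooth_alg f \<Longrightarrow> smooth_alg g \<Longrightarrow> smooth_alg (\<lambda>x. f x * g x)"

lemma smooth_alg_differentiable: "smooth_alg f \<Longrightarrow> f differentiable (at x)"
  by (induction rule: smooth_alg.induct) (auto simp: smooth_differentiable)

lemma smooth_alg_pd: "smooth_alg f \<Longrightarrow> smooth_alg (pd i f)"
proof (induction rule: smooth_alg.induct)
  case (base f)
  then show ?case by (intro smooth_alg.base smooth_pd)
next
  case (add f g)
  have "pd i (\<lambda>x. f x + g x) = (\<lambda>x. pd i f x + pd i g x)"
    using add by (auto simp: pd_add smooth_alg_differentiable)
  with add show ?case by (simp add: smooth_alg.add)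
next
  case (mult f g)
  have "pd i (\<lambda>x. f x * g x) = (\<lambda>x. f x * pd i g x + pd i f x * g x)"
    using mult by (auto simp: pd_mult smooth_alg_differentiable)
  with mult show ?case by (simp add: smooth_alg.add smooth_alg.mult)
qed

lemma smooth_alg_smooth: "smooth_alg f \<Longrightarrow> smooth f"
  by (rule smooth_coinduct[where P = smooth_alg]) (auto simp: smooth_alg_differentiable smooth_alg_pd)

lemma smooth_add: "smooth f \<Longrightarrow> smooth g \<Longrightarrow> smooth (\<lambda>x. f x + g x)"
  by (rule smooth_alg_smooth[OF smooth_alg.add[OF smooth_alg.base smooth_alg.base]])

lemma smooth_mult: "smooth f \<Longrightarrow> smooth g \<Longrightarrow> smooth (\<lambda>x. f x * g x)"
  by (rule smooth_alg_smooth[OF smooth_alg.mult[OF smooth_alg.base smooth_alg.base]])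

lemma smooth_diff: "smooth f \<Longrightarrow> smooth g \<Longrightarrow> smooth (\<lambda>x. f x - g x)"
  using smooth_add[OF _ smooth_mult[OF smooth_const[of "-1"]], of f g] by simp

lemma smooth_power: "smooth f \<Longrightarrow> smooth (\<lambda>x. f x ^ n)"
  by (induction n) (auto simp: smooth_const smooth_mult)

lemma smooth_prod: "(\<And>i. i \<in> I \<Longrightarrow> smooth (f i)) \<Longrightarrow> smooth (\<lambda>x. \<Prod>i\<in>I. f i x)"
  by (induction I rule: infinite_finite_induct) (auto simp: smooth_const smooth_mult)

section \<open>A flat function of one variable and the bump functions built from it\<close>

text \<open>The factor \<open>poly p (1/y)\<close> makes this family closed under differentiation.\<close>

definition flat :: "real poly \<Rightarrow> real \<Rightarrow> real" where
  "flat p y = (if y \<le> 0 then 0 else poly p (inverse y) * exp (- inverse y))"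

text \<open>With \<open>s = 1 / y\<close>, a polynomial in \<open>s\<close> loses against
  \<open>exp s\<close>; on the other side of 0 the function vanishes.\<close>

lemma flat_tendsto_0: "(flat p \<longlongrightarrow> 0) (at 0)"
proof (rule filterlim_split_at)
  have "eventually (\<lambda>y. 0 = flat p y) (at_left (0::real))"
    by (auto simp: eventually_at_filter flat_def)
  then show "(flat p \<longlongrightarrow> 0) (at_left 0)"
    by (rule Lim_transform_eventually[OF tendsto_const])
  have "((\<lambda>s. \<Sum>i\<le>degree p. coeff p i * (s ^ i / exp s)) \<longlongrightarrow> (\<Sum>i\<le>degree p. coeff p i * 0)) at_top"
    by (intro tendsto_intros tendsto_power_div_exp_0)
  then have "((\<lambda>s. poly p s * exp (- s)) \<longlongrightarrow> 0) at_top"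
    by (simp add: poly_altdef sum_distrib_right exp_minus divide_inverse mult.assoc)
  from filterlim_compose[OF this filterlim_inverse_at_top_right]
  have "((\<lambda>y. poly p (inverse y) * exp (- inverse y)) \<longlongrightarrow> 0) (at_right 0)" .
  moreover have "eventually (\<lambda>y. poly p (inverse y) * exp (- inverse y) = flat p y) (at_right 0)"
    by (auto simp: eventually_at_filter flat_def)
  ultimately show "(flat p \<longlongrightarrow> 0) (at_right 0)"
    by (rule Lim_transform_eventually)
qed

text \<open>For \<open>s = 1 / y\<close> the derivative of \<open>s\<close> is \<open>- s^2\<close>,
  so \<open>p(s) exp(- s)\<close> differentiates to \<open>s^2 (p - p')(s) exp(- s)\<close>;
  \<open>monom 1 2\<close> is the factor \<open>s^2\<close>.\<close>

lemma flat_has_derivative: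
  "(flat p has_real_derivative flat (monom 1 2 * (p - pderiv p)) y) (at y)"
proof (cases y "0::real" rule: linorder_cases)
  case less
  have "((\<lambda>_. 0) has_real_derivative 0) (at y)" by simp
  then have "(flat p has_real_derivative 0) (at y)"
    by (rule has_field_derivative_transform_within_open[of _ _ _ "{..<0}"]) (use less in \<open>auto simp: flat_def\<close>)
  then show ?thesis using less by (simp add: flat_def)
next
  case equal
  have "((\<lambda>h. (flat p (0 + h) - flat p 0) / h) \<longlongrightarrow> 0) (at 0)"
  \<comment> \<open>Dividing by \<open>h\<close> multiplies the polynomial in
    \<open>inverse h\<close> by its variable, so the difference quotient at 0 is itself a
    \<open>flat\<close> function and tends to 0.\<close>
  proof (rule Lim_transform_eventually[OF flat_tendsto_0[of "pCons 0 p"]])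
    show "eventually (\<lambda>h. flat (pCons 0 p) h = (flat p (0 + h) - flat p 0) / h) (at 0)"
      by (auto simp: eventually_at_filter flat_def divide_inverse)
  qed
  then show ?thesis using equal by (simp add: DERIV_def flat_def)
next
  case greater
  have "((\<lambda>y. poly p (inverse y) * exp (- inverse y)) has_real_derivative
      poly (monom 1 2 * (p - pderiv p)) (inverse y) * exp (- inverse y)) (at y)"
    using greater
    by (auto intro!: derivative_eq_intros poly_DERIV DERIV_chain2[of "poly p"]
        simp: poly_monom power2_eq_square algebra_simps)
  then have "(flat p has_real_derivative
      poly (monom 1 2 * (p - pderiv p)) (inverse y) * exp (- inverse y)) (at y)"
    by (rule has_field_derivative_transform_within_open[of _ _ _ "{0<..}"]) (use greater in \<open>auto simp: flat_def\<close>)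
  then show ?thesis using greater by (simp add: flat_def)
qed

lemma smooth_flat: "smooth (\<lambda>x. flat p (s * x $ i + c))"
proof (rule smooth_coinduct[where P = "\<lambda>f. \<exists>p. f = (\<lambda>x. flat p (s * x $ i + c))"])
  have der: "((\<lambda>x. flat p (s * x $ i + c)) has_derivative
      (\<lambda>v. flat (monom 1 2 * (p - pderiv p)) (s * x $ i + c) * (s * v $ i))) (at x)" for p and x :: "real^'a"
    by (rule has_derivative_compose[OF _ flat_has_derivative[THEN has_field_derivative_imp_has_derivative]])
       (auto intro!: derivative_eq_intros bounded_linear.has_derivative[OF bounded_linear_vec_nth])
  show "f differentiable (at x)" if "\<exists>p. f = (\<lambda>x. flat p (s * x $ i + c))" for f x
    using that der by (auto simp: differentiable_def)
  show "\<exists>p. pd j f = (\<lambda>x. flat p (s * x $ i + c))" if ex: "\<exists>p. f = (\<lambda>x. flat p (s * x $ i + c))" for f j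
  proof -
    obtain p where p: "f = (\<lambda>x. flat p (s * x $ i + c))" using ex by blast
    \<comment> \<open>The chain rule factor is constant, and 0 unless \<open>i = j\<close>, so it
      can be absorbed into the polynomial.\<close>
    have "pd j f = (\<lambda>x. flat (smult (s * axis j 1 $ i) (monom 1 2 * (p - pderiv p))) (s * x $ i + c))"
      unfolding p using pd_eq[OF der] by (auto simp: flat_def)
    then show ?thesis by blast
  qed
qed blast

text \<open>\<open>flat 1\<close> is \<open>exp (- 1 / y)\<close> for positive \<open>y\<close>. The
  arguments are spelled so as to match the pattern \<open>s * x $ i + c\<close> of
  \<open>smooth_flat\<close>.\<close>

definition bump :: "real^'d \<Rightarrow> real^'d \<Rightarrow> real^('d::finite) \<Rightarrow> real" where
  "bump a b x = (\<Prod>i\<in>UNIV. flat 1 (1 * x $ i + - a $ i) * flat 1 (- 1 * x $ i + b $ i))"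

lemma smooth_bump: "smooth (bump a b)"
  unfolding bump_def by (intro smooth_prod smooth_mult smooth_flat)

lemma flat_1: "0 \<le> flat 1 y" "flat 1 y \<le> 1" "flat 1 y = 0 \<longleftrightarrow> y \<le> 0"
  by (auto simp: flat_def)

lemma bump_nonneg: "0 \<le> bump a b x" and bump_le_1: "bump a b x \<le> 1"
  unfolding bump_def by (auto intro!: prod_nonneg prod_le_1 mult_le_one simp: flat_1)

lemma bump_eq_0_iff: "bump a b x = 0 \<longleftrightarrow> x \<notin> box a b"
  by (auto simp: bump_def mem_box_cart flat_1(3) not_less)

text \<open>These functions keep the support of the bump and increase to the indicator of the box.\<close>

lemma test_fun_bump_approx:
  assumes "cbox a b \<subseteq> \<Omega>"
  shows "test_fun \<Omega> (\<lambda>x. 1 - (1 - bump a b x) ^ n)"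
proof -
  have "{x. 1 - (1 - bump a b x) ^ n \<noteq> 0} \<subseteq> cbox a b"
  proof
    fix x assume "x \<in> {x. 1 - (1 - bump a b x) ^ n \<noteq> 0}"
    then have "bump a b x \<noteq> 0" by auto
    then show "x \<in> cbox a b" using box_subset_cbox[of a b] by (auto simp: bump_eq_0_iff)
  qed
  then have sub: "closure {x. 1 - (1 - bump a b x) ^ n \<noteq> 0} \<subseteq> cbox a b"
    by (rule closure_minimal) (rule closed_cbox)
  then have "compact (closure {x. 1 - (1 - bump a b x) ^ n \<noteq> 0})"
    using compact_cbox closed_closure by (metis compact_Int_closed inf.absorb_iff2)
  moreover have "smooth (\<lambda>x. 1 - (1 - bump a b x) ^ n)"
    by (intro smooth_diff smooth_const smooth_power smooth_bump)
  ultimately show ?thesis using sub assms unfolding test_fun_def by blast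
qed

lemma bump_approx_tendsto:
  "(\<lambda>n. 1 - (1 - bump a b x) ^ n) \<longlonglongrightarrow> indicator (box a b) x"
proof (cases "x \<in> box a b")
  case True
  then have "bump a b x > 0" using bump_eq_0_iff bump_nonneg by (metis less_eq_real_def)
  then have "(\<lambda>n. (1 - bump a b x) ^ n) \<longlonglongrightarrow> 0"
    using bump_le_1[of a b x] by (intro LIMSEQ_realpow_zero) auto
  from tendsto_diff[OF tendsto_const this, of 1] True show ?thesis by simp
next
  case False
  then show ?thesis using bump_eq_0_iff[of a b x] by simp
qed

text \<open>Dynkin's argument: open boxes are stable under intersection and generate the Borel sets,
  so \<open>h\<close> integrates to 0 over every Borel set.\<close>

lemma AE_zero_if_box_integrals_zero:
  fixes h :: "'a::euclidean_space \<Rightarrow> real"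
  assumes h: "integrable lborel h"
    and box: "\<And>a b. (LINT x|lborel. indicator (box a b) x * h x) = 0"
  shows "AE x in lborel. h x = 0"
proof (rule sigma_finite_measure.density_zero[OF sigma_finite_lborel h])
  have set_int: "set_integrable lborel A h" if "A \<in> sets borel" for A
    using that h unfolding set_integrable_def by (intro integrable_mult_indicator) auto
  \<comment> \<open>The complement step needs the integral over the whole space; boxes exhaust it
    and \<open>norm h\<close> dominates.\<close>
  have total: "(LINT x|lborel. h x) = 0"
  proof -
    have "(\<lambda>n. LINT x|lborel. indicator (box (- real n *\<^sub>R One) (real n *\<^sub>R One)) x * h x)
        \<longlonglongrightarrow> (LINT x|lborel. h x)"
    proof (rule integral_dominated_convergence[where w = "\<lambda>x. norm (h x)"])
      show "AE x in lborel. (\<lambda>n. indicator (box (- real n *\<^sub>R One) (real n *\<^sub>R One)) x * h x) \<longlonglongrightarrow> h x"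
      proof (rule AE_I2)
        fix x :: 'a
        obtain n0 :: nat where n0: "norm x < real n0" using reals_Archimedean2 by blast
        have "x \<in> box (- real n *\<^sub>R One) (real n *\<^sub>R One)" if "n \<ge> n0" for n
        proof -
          have "\<bar>x \<bullet> i\<bar> < real n" if "i \<in> Basis" for i
            using Basis_le_norm[OF that, of x] n0 \<open>n \<ge> n0\<close> by linarith
          then show ?thesis by (auto simp: mem_box abs_less_iff minus_less_iff)
        qed
        then have "eventually (\<lambda>n. h x = indicator (box (- real n *\<^sub>R One) (real n *\<^sub>R One)) x * h x) sequentially"
          by (intro eventually_sequentiallyI[of n0]) simp
        then show "(\<lambda>n. indicator (box (- real n *\<^sub>R One) (real n *\<^sub>R One)) x * h x) \<longlonglongrightarrow> h x"
          by (rule Lim_transform_eventually[OF tendsto_const])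
      qed
    qed (use h in \<open>auto simp: indicator_def\<close>)
    then show ?thesis by (simp add: box LIMSEQ_const_iff)
  qed
  fix A :: "'a set" assume "A \<in> sets lborel"
  then have A: "A \<in> sigma_sets UNIV (range (\<lambda>(a, b). box a b))" by (simp add: borel_eq_box)
  have "Int_stable (range (\<lambda>(a, b). box a b :: 'a set))"
    by (auto simp: Int_stable_def box_Int_box)
  moreover have "range (\<lambda>(a, b). box a b :: 'a set) \<subseteq> Pow UNIV" by auto
  moreover note A
  ultimately show "set_lebesgue_integral lborel A h = 0"
  proof (induction rule: sigma_sets_induct_disjoint)
    case (basic A)
    then show ?case using box by (auto simp: set_lebesgue_integral_def)
  next
    case empty
    show ?case by (simp add: set_lebesgue_integral_def)
  next
    case (compl A)
    then have A: "A \<in> sets borel" by (simp add: borel_eq_box)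
    have "set_lebesgue_integral lborel (UNIV - A) h = (LINT x|lborel. h x - indicator A x *\<^sub>R h x)"
      unfolding set_lebesgue_integral_def
      by (intro Bochner_Integration.integral_cong) (auto simp: indicator_def)
    also have "\<dots> = 0"
      using h set_int[OF A] total compl.IH
      by (simp add: set_lebesgue_integral_def set_integrable_def)
    finally show ?case .
  next
    case (union F)
    then have F: "F i \<in> sets borel" for i by (auto simp: borel_eq_box)
    have "set_lebesgue_integral lborel (\<Union>i. F i) h = (\<Sum>i. set_lebesgue_integral lborel (F i) h)"
      by (rule lebesgue_integral_countable_add)
         (use F union.hyps(1) in \<open>auto simp: disjoint_family_on_def intro!: set_int\<close>)
    then show ?case using union.IH by simp
  qed
qed

text \<open>Bounded convergence from test functions to box indicators makes the integral of
  \<open>g\<close> vanish over every box whose closed box lies in the domain; the claim is proved on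
  each such box and glued over a countable cover.\<close>

theorem fundamental_lemma_calculus_of_variations:
  fixes g :: "real^('d::finite) \<Rightarrow> real"
  assumes "open \<Omega>" and g: "integrable (lebesgue_on \<Omega>) g"
    and zero: "\<And>\<phi>. test_fun \<Omega> \<phi> \<Longrightarrow> (LINT x|lebesgue_on \<Omega>. g x * \<phi> x) = 0"
  shows "AE x in lebesgue_on \<Omega>. g x = 0"
proof -
  have \<Omega>: "\<Omega> \<in> sets lebesgue" using \<open>open \<Omega>\<close> by auto
  have gm: "g \<in> borel_measurable (lebesgue_on \<Omega>)" using g by auto
  have box0: "(LINT x|lebesgue_on \<Omega>. indicator (box a b) x * g x) = 0" if "cbox a b \<subseteq> \<Omega>" for a b
  proof -
    have "(\<lambda>n. LINT x|lebesgue_on \<Omega>. g x * (1 - (1 - bump a b x) ^ n))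
        \<longlonglongrightarrow> (LINT x|lebesgue_on \<Omega>. indicator (box a b) x * g x)"
    proof (rule integral_dominated_convergence[where w = "\<lambda>x. norm (g x)"])
      have bm: "bump a b \<in> borel_measurable (lebesgue_on \<Omega>)"
        using smooth_continuous[OF smooth_bump[of a b]]
        by (intro continuous_imp_measurable_on_sets_lebesgue[OF _ \<Omega>]) (auto intro: continuous_on_subset)
      show "(\<lambda>x. g x * (1 - (1 - bump a b x) ^ n)) \<in> borel_measurable (lebesgue_on \<Omega>)" for n
        using gm bm by measurable
      have "box a b \<in> sets lebesgue" by auto
      then show "(\<lambda>x. indicator (box a b) x * g x) \<in> borel_measurable (lebesgue_on \<Omega>)"
        using gm by (intro borel_measurable_times borel_measurable_indicator') (auto simp: sets_restrict_space)
      show "AE x in lebesgue_on \<Omega>. (\<lambda>n. g x * (1 - (1 - bump a b x) ^ n)) \<longlonglongrightarrow> indicator (box a b) x * g x"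
        unfolding mult.commute[of "indicator _ _" "g _"]
        by (intro AE_I2 tendsto_mult tendsto_const bump_approx_tendsto)
      show "AE x in lebesgue_on \<Omega>. norm (g x * (1 - (1 - bump a b x) ^ n)) \<le> norm (g x)" for n
      proof (rule AE_I2)
        fix x
        have "0 \<le> (1 - bump a b x) ^ n" "(1 - bump a b x) ^ n \<le> 1"
          using bump_le_1[of a b x] bump_nonneg[of a b x] by (auto intro: power_le_one)
        then have "\<bar>1 - (1 - bump a b x) ^ n\<bar> \<le> 1" by simp
        then show "norm (g x * (1 - (1 - bump a b x) ^ n)) \<le> norm (g x)"
          by (simp add: abs_mult mult_left_le)
      qed
    qed (use g in auto)
    then show ?thesis by (simp add: zero test_fun_bump_approx[OF that] LIMSEQ_const_iff)
  qed
  have local: "AE x in lebesgue. x \<in> cbox a b \<longrightarrow> g x = 0" if ab: "cbox a b \<subseteq> \<Omega>" for a b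
  proof -
    \<comment> \<open>After this cut-off, any box \<open>box c d\<close> of the whole space is
      effectively tested only on its part inside \<open>box a b\<close>.\<close>
    define h where "h x = indicator \<Omega> x *\<^sub>R (indicator (box a b) x * g x)" for x
    have hi: "integrable lebesgue h"
    proof -
      have "box a b \<in> sets (lebesgue_on \<Omega>)"
        using ab box_subset_cbox[of a b] \<Omega> by (subst sets_restrict_space_iff) auto
      then have "integrable (lebesgue_on \<Omega>) (\<lambda>x. indicator (box a b) x *\<^sub>R g x)"
        by (intro integrable_mult_indicator g)
      then show ?thesis using \<Omega> by (simp add: integrable_restrict_space h_def[abs_def])
    qed
    \<comment> \<open>A Borel representative is taken because \<open>h\<close> is only Lebesgue
      measurable, while the box criterion works over \<open>lborel\<close>.\<close>
    then obtain h' where h': "h' \<in> borel_measurable lborel" "AE x in lborel. h x = h' x"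
      using completion_ex_borel_measurable_real[of h lborel] by auto
    have ae: "AE x in lebesgue. h x = h' x" using h'(2) by (rule AE_completion)
    have h'm: "h' \<in> borel_measurable lebesgue" using h'(1) by (rule measurable_completion)
    have "integrable lebesgue h'"
      using hi ae h'm integrable_cong_AE[of h lebesgue h'] by auto
    then have h'i: "integrable lborel h'" using h'(1) by (simp add: integrable_completion)
    have "AE x in lborel. h' x = 0"
    proof (rule AE_zero_if_box_integrals_zero[OF h'i])
      fix c d :: "real^'d"
      have "(LINT x|lborel. indicator (box c d) x * h' x) = (LINT x|lebesgue. indicator (box c d) x * h' x)"
        using h'(1) by (subst integral_completion) auto
      also have "\<dots> = (LINT x|lebesgue. indicator (box c d) x * h x)"
        using borel_measurable_integrable[OF hi] h'm ae
        by (intro integral_cong_AE borel_measurable_times borel_measurable_indicator)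
           (auto elim: eventually_mono)
      also have "\<dots> = (LINT x|lebesgue. indicator \<Omega> x *\<^sub>R (indicator (box a b \<inter> box c d) x * g x))"
        by (intro Bochner_Integration.integral_cong) (auto simp: h_def indicator_def)
      also have "\<dots> = (LINT x|lebesgue_on \<Omega>. indicator (box a b \<inter> box c d) x * g x)"
        using \<Omega> by (subst integral_restrict_space) auto
      also have "\<dots> = 0"
      \<comment> \<open>Nonemptiness matters: an empty open box can have a nonempty degenerate
        \<open>cbox\<close>, which need not lie in the domain.\<close>
      proof (cases "box a b \<inter> box c d = {}")
        case False
        obtain p q where pq: "box a b \<inter> box c d = box p q" unfolding box_Int_box by blast
        have "cbox p q = closure (box p q)" using False pq by (simp add: closure_box)
        also have "\<dots> \<subseteq> cbox a b"
          using pq box_subset_cbox[of a b] by (intro closure_minimal) auto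
        finally show ?thesis unfolding pq using ab by (intro box0) auto
      qed simp
      finally show "(LINT x|lborel. indicator (box c d) x * h' x) = 0" .
    qed
    then have "AE x in lebesgue. h' x = 0" by (rule AE_completion)
    moreover have "AE x in lebesgue. x \<notin> cbox a b - box a b"
      using negligible_frontier_interval[of a b] by (intro AE_not_in) (simp add: negligible_iff_null_sets)
    ultimately show ?thesis
      using ae by eventually_elim (use ab in \<open>auto simp: h_def indicator_def split: if_splits\<close>)
  qed
  \<comment> \<open>Boxes with rational corners: a countable family, so the exceptional null sets
    may be united.\<close>
  define I where "I = {f \<in> Basis \<rightarrow>\<^sub>E \<rat> \<times> \<rat>. cbox (\<Sum>i\<in>Basis. fst (f i) *\<^sub>R i) (\<Sum>i\<in>Basis. snd (f i) *\<^sub>R i :: real^'d) \<subseteq> \<Omega>}"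
  have cover: "\<Omega> = (\<Union>f\<in>I. cbox (\<Sum>i\<in>Basis. fst (f i) *\<^sub>R i) (\<Sum>i\<in>Basis. snd (f i) *\<^sub>R i))"
    unfolding I_def by (rule open_UNION_cbox[OF \<open>open \<Omega>\<close>])
  have "countable I"
    unfolding I_def by (rule countable_subset[of _ "Basis \<rightarrow>\<^sub>E \<rat> \<times> \<rat>"])
      (auto intro!: countable_PiE countable_SIGMA countable_rat)
  then have "AE x in lebesgue. \<forall>f\<in>I. x \<in> cbox (\<Sum>i\<in>Basis. fst (f i) *\<^sub>R i) (\<Sum>i\<in>Basis. snd (f i) *\<^sub>R i) \<longrightarrow> g x = 0"
    by (subst AE_ball_countable) (auto simp: I_def intro!: local)
  then have "AE x in lebesgue. x \<in> \<Omega> \<longrightarrow> g x = 0"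
    by eventually_elim (use cover in auto)
  then show ?thesis using \<Omega> by (simp add: AE_restrict_space_iff)
qed

section \<open>Weak derivatives and completeness\<close>

lemma L2_iff_sq_integrable: "L2 \<Omega> f \<longleftrightarrow> sq_integrable (lebesgue_on \<Omega>) f"
  by (simp add: L2_def sq_integrable_def)

lemma norm_vec_power2: "(norm (x::real^'n))\<^sup>2 = (\<Sum>i\<in>UNIV. (x $ i)\<^sup>2)"
  unfolding power2_norm_eq_inner by (simp add: inner_vec_def power2_eq_square)

lemma borel_measurable_vec_nth:
  fixes f :: "'a \<Rightarrow> real^'n"
  shows "f \<in> borel_measurable N \<Longrightarrow> (\<lambda>x. f x $ i) \<in> borel_measurable N"
  unfolding cart_eq_inner_axis by (intro borel_measurable_inner borel_measurable_const)

lemma sq_integrable_vec_nth: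
  fixes f :: "'a \<Rightarrow> real^'n"
  assumes f: "sq_integrable N f"
  shows "sq_integrable N (\<lambda>x. f x $ i)"
proof (rule sq_integrable_bound[OF _ sq_integrableD(2)[OF f]])
  show "(\<lambda>x. f x $ i) \<in> borel_measurable N"
    by (intro borel_measurable_vec_nth sq_integrableD(1)[OF f])
  show "AE x in N. (norm (f x $ i))\<^sup>2 \<le> (norm (f x))\<^sup>2"
    by (intro AE_I2 power_mono) (auto simp: component_le_norm_cart)
qed

lemma L2vec_iff_sq_integrable: "L2vec \<Omega> \<sigma> \<longleftrightarrow> sq_integrable (lebesgue_on \<Omega>) \<sigma>"
proof
  assume \<sigma>: "L2vec \<Omega> \<sigma>"
  have "\<sigma> \<in> borel_measurable (lebesgue_on \<Omega>)"
    using \<sigma> by (subst borel_measurable_euclidean_space) (auto simp: L2vec_def L2_def Basis_vec_def inner_axis)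
  with \<sigma> show "sq_integrable (lebesgue_on \<Omega>) \<sigma>"
    by (auto simp: sq_integrable_def norm_vec_power2 L2vec_def L2_def)
next
  assume "sq_integrable (lebesgue_on \<Omega>) \<sigma>"
  then show "L2vec \<Omega> \<sigma>" by (simp add: L2vec_def L2_iff_sq_integrable sq_integrable_vec_nth)
qed

lemma tendsto_0_integral_dominated:
  assumes lim: "(\<lambda>j. LINT x|M. (norm (X j x))\<^sup>2) \<longlonglongrightarrow> 0"
    and X: "\<And>j. sq_integrable M (X j)" and C: "C \<ge> 0"
    and dom: "\<And>j. AE x in M. (norm (Y j x))\<^sup>2 \<le> C * (norm (X j x))\<^sup>2"
  shows "(\<lambda>j. LINT x|M. (norm (Y j x))\<^sup>2) \<longlonglongrightarrow> 0"
proof (rule tendsto_sandwich[OF always_eventually always_eventually tendsto_const])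
  show "\<forall>j. (LINT x|M. (norm (Y j x))\<^sup>2) \<le> C * (LINT x|M. (norm (X j x))\<^sup>2)"
  proof
    fix j
    have "(LINT x|M. (norm (Y j x))\<^sup>2) \<le> (LINT x|M. C * (norm (X j x))\<^sup>2)"
      using sq_integrableD(2)[OF X] dom C by (intro integral_mono_AE') auto
    then show "(LINT x|M. (norm (Y j x))\<^sup>2) \<le> C * (LINT x|M. (norm (X j x))\<^sup>2)" by simp
  qed
  show "(\<lambda>j. C * (LINT x|M. (norm (X j x))\<^sup>2)) \<longlonglongrightarrow> 0"
    using tendsto_mult_right_zero[OF lim] .
qed simp

lemma integral_norm_diff_triangle:
  fixes a b c :: "'a \<Rightarrow> 'b::euclidean_space"
  assumes "sq_integrable M a" "sq_integrable M b" "sq_integrable M c"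
  shows "(LINT x|M. (norm (a x - c x))\<^sup>2)
    \<le> 2 * (LINT x|M. (norm (a x - b x))\<^sup>2) + 2 * (LINT x|M. (norm (b x - c x))\<^sup>2)"
proof -
  note int = sq_integrableD(2)[OF sq_integrable_diff]
  have "(LINT x|M. (norm (a x - c x))\<^sup>2)
      \<le> (LINT x|M. 2 * (norm (a x - b x))\<^sup>2 + 2 * (norm (b x - c x))\<^sup>2)"
  proof (rule integral_mono)
    show "(norm (a x - c x))\<^sup>2 \<le> 2 * (norm (a x - b x))\<^sup>2 + 2 * (norm (b x - c x))\<^sup>2" for x
      using norm_add_power2_le[of "a x - b x" "b x - c x"] by simp
  qed (use int[OF assms(1,2)] int[OF assms(2,3)] int[OF assms(1,3)] in auto)
  then show ?thesis using int[OF assms(1,2)] int[OF assms(2,3)] by simp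
qed

lemma tendsto_integral_norm_diff_trans:
  fixes a b :: "nat \<Rightarrow> 'a \<Rightarrow> 'b::euclidean_space"
  assumes "\<And>j. sq_integrable M (a j)" "\<And>j. sq_integrable M (b j)" "sq_integrable M c"
    and lim: "(\<lambda>j. LINT x|M. (norm (a j x - b j x))\<^sup>2) \<longlonglongrightarrow> 0" "(\<lambda>j. LINT x|M. (norm (b j x - c x))\<^sup>2) \<longlonglongrightarrow> 0"
  shows "(\<lambda>j. LINT x|M. (norm (a j x - c x))\<^sup>2) \<longlonglongrightarrow> 0"
proof (rule tendsto_sandwich[OF always_eventually always_eventually tendsto_const])
  show "\<forall>j. (LINT x|M. (norm (a j x - c x))\<^sup>2)
    \<le> 2 * (LINT x|M. (norm (a j x - b j x))\<^sup>2) + 2 * (LINT x|M. (norm (b j x - c x))\<^sup>2)"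
    using assms by (intro allI integral_norm_diff_triangle)
  show "(\<lambda>j. 2 * (LINT x|M. (norm (a j x - b j x))\<^sup>2) + 2 * (LINT x|M. (norm (b j x - c x))\<^sup>2)) \<longlonglongrightarrow> 0"
    using tendsto_add_zero[OF tendsto_mult_right_zero[OF lim(1)] tendsto_mult_right_zero[OF lim(2)]] .
qed simp

type_synonym 'd jet = "real \<times> (real^'d) \<times> (real^'d) \<times> real"

lemma norm_jet: "(norm (p :: ('d::finite) jet))\<^sup>2
    = (fst p)\<^sup>2 + (norm (fst (snd p)))\<^sup>2 + (norm (fst (snd (snd p))))\<^sup>2 + (snd (snd (snd p)))\<^sup>2"
  by (cases p) (simp add: norm_Pair)

text \<open>The jet of \<open>(u, \<sigma>)\<close> is \<open>(u, \<nabla>u, \<sigma>, div \<sigma>)\<close>, so that the norm of \<open>U\<close> is the \<open>L\<^sup>2\<close> norm of the jet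
  and all forms are integrals of pointwise quadratic forms in it.\<close>

definition jet :: "(real^('d::finite)) set \<Rightarrow> ((real^'d \<Rightarrow> real) \<times> (real^'d \<Rightarrow> real^'d)) \<Rightarrow> real^'d \<Rightarrow> 'd jet" where
  "jet \<Omega> U x = (fst U x, wgrad \<Omega> (fst U) x, snd U x, wdiv \<Omega> (snd U) x)"

lemma jet_sel:
  "fst (jet \<Omega> U x) = fst U x" "fst (snd (jet \<Omega> U x)) = wgrad \<Omega> (fst U) x"
  "fst (snd (snd (jet \<Omega> U x))) = snd U x" "snd (snd (snd (jet \<Omega> U x))) = wdiv \<Omega> (snd U) x"
  by (simp_all add: jet_def)

text \<open>Boundedness makes the measure finite: continuous functions become square integrable,
  square-integrable functions integrable, and the completeness theorem applies.\<close>

locale bounded_open =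
  fixes \<Omega> :: "(real^('d::finite)) set"
  assumes open_dom: "open \<Omega>" and bounded_dom: "bounded \<Omega>"
begin

abbreviation "M \<equiv> lebesgue_on \<Omega>"

lemma dom_sets: "\<Omega> \<in> sets lebesgue"
  using open_dom by auto

sublocale finite_measure M
  using open_dom bounded_dom by (intro finite_measure_lebesgue_on) (simp add: lmeasurable_open)

lemma sq_integrable_continuous:
  assumes "continuous_on UNIV (f :: _ \<Rightarrow> 'b::euclidean_space)"
  shows "sq_integrable M f"
proof -
  have "compact (f ` closure \<Omega>)"
    using assms bounded_dom by (intro compact_continuous_image) (auto intro: continuous_on_subset simp: compact_closure)
  then obtain C where C: "\<And>x. x \<in> closure \<Omega> \<Longrightarrow> norm (f x) \<le> C"
    using compact_imp_bounded bounded_iff by (metis imageI)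
  show ?thesis
  proof (rule sq_integrable_bound)
    show "f \<in> borel_measurable M"
      using assms by (intro continuous_imp_measurable_on_sets_lebesgue dom_sets) (auto intro: continuous_on_subset)
    show "integrable M (\<lambda>x. C\<^sup>2)" by simp
    show "AE x in M. (norm (f x))\<^sup>2 \<le> C\<^sup>2"
      using C closure_subset[of \<Omega>] by (intro AE_I2 power_mono) auto
  qed
qed

lemma sq_integrable_imp_integrable:
  fixes f :: "_ \<Rightarrow> real"
  shows "sq_integrable M f \<Longrightarrow> integrable M f"
  using integrable_mult_sq[OF _ sq_integrable_continuous[OF continuous_on_const[of _ 1]]] by simp

lemma test_fun_sq_integrable:
  assumes "test_fun \<Omega> \<phi>"
  shows "sq_integrable M \<phi>" "sq_integrable M (pd i \<phi>)" "sq_integrable M (grad \<phi>)"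
proof -
  have s: "smooth \<phi>" using assms by (simp add: test_fun_def)
  show "sq_integrable M \<phi>" "sq_integrable M (pd i \<phi>)" for i
    using s by (intro sq_integrable_continuous smooth_continuous smooth_pd; simp)+
  then show "sq_integrable M (grad \<phi>)"
    by (simp add: grad_def L2vec_def L2_iff_sq_integrable flip: L2vec_iff_sq_integrable)
qed

text \<open>Makes the \<open>SOME\<close> in \<open>wgrad\<close> harmless: each component of the
  difference of two candidates is orthogonal to all test functions.\<close>

lemma weak_grad_unique:
  assumes "sq_integrable M g" "is_weak_grad \<Omega> u g" "sq_integrable M g'" "is_weak_grad \<Omega> u g'"
  shows "AE x in M. g x = g' x"
proof -
  have "AE x in M. g x $ i - g' x $ i = 0" for i
  proof (rule fundamental_lemma_calculus_of_variations[OF open_dom])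
    note c = sq_integrable_vec_nth[OF assms(1), of i] sq_integrable_vec_nth[OF assms(3), of i]
    show "integrable M (\<lambda>x. g x $ i - g' x $ i)"
      by (intro sq_integrable_imp_integrable sq_integrable_diff c)
    fix \<phi> assume \<phi>: "test_fun \<Omega> \<phi>"
    have "(LINT x|M. g x $ i * \<phi> x) = (LINT x|M. g' x $ i * \<phi> x)"
      using assms(2,4)[unfolded is_weak_grad_def, rule_format, OF \<phi>, of i] by simp
    then show "(LINT x|M. (g x $ i - g' x $ i) * \<phi> x) = 0"
      using integrable_mult_sq[OF c(1) test_fun_sq_integrable(1)[OF \<phi>]]
        integrable_mult_sq[OF c(2) test_fun_sq_integrable(1)[OF \<phi>]]
      by (simp add: left_diff_distrib)
  qed
  then have "AE x in M. \<forall>i. g x $ i - g' x $ i = 0" by (simp add: AE_all_countable)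
  then show ?thesis by eventually_elim (simp add: vec_eq_iff)
qed

lemma weak_div_unique:
  assumes "sq_integrable M w" "is_weak_div \<Omega> \<sigma> w" "sq_integrable M w'" "is_weak_div \<Omega> \<sigma> w'"
  shows "AE x in M. w x = w' x"
proof -
  have "AE x in M. w x - w' x = 0"
  proof (rule fundamental_lemma_calculus_of_variations[OF open_dom])
    show "integrable M (\<lambda>x. w x - w' x)"
      by (intro sq_integrable_imp_integrable sq_integrable_diff assms)
    fix \<phi> assume \<phi>: "test_fun \<Omega> \<phi>"
    have "(LINT x|M. w x * \<phi> x) = (LINT x|M. w' x * \<phi> x)"
      using assms(2,4)[unfolded is_weak_div_def, rule_format, OF \<phi>] by simp
    then show "(LINT x|M. (w x - w' x) * \<phi> x) = 0"
      using integrable_mult_sq[OF assms(1) test_fun_sq_integrable(1)[OF \<phi>]]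
        integrable_mult_sq[OF assms(3) test_fun_sq_integrable(1)[OF \<phi>]]
      by (simp add: left_diff_distrib)
  qed
  then show ?thesis by eventually_elim simp
qed

lemma wgrad_H1:
  assumes "u \<in> H1 \<Omega>"
  shows "sq_integrable M u" "sq_integrable M (wgrad \<Omega> u)" "is_weak_grad \<Omega> u (wgrad \<Omega> u)"
proof -
  have "\<exists>g. L2vec \<Omega> g \<and> is_weak_grad \<Omega> u g" using assms by (simp add: H1_def)
  from someI_ex[OF this] show "sq_integrable M (wgrad \<Omega> u)" "is_weak_grad \<Omega> u (wgrad \<Omega> u)"
    by (auto simp: wgrad_def L2vec_iff_sq_integrable)
qed (use assms in \<open>simp add: H1_def L2_iff_sq_integrable\<close>)

lemma wdiv_Hdiv:
  assumes "\<sigma> \<in> Hdiv \<Omega>"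
  shows "sq_integrable M \<sigma>" "sq_integrable M (wdiv \<Omega> \<sigma>)" "is_weak_div \<Omega> \<sigma> (wdiv \<Omega> \<sigma>)"
proof -
  have "\<exists>w. L2 \<Omega> w \<and> is_weak_div \<Omega> \<sigma> w" using assms by (simp add: Hdiv_def)
  from someI_ex[OF this] show "sq_integrable M (wdiv \<Omega> \<sigma>)" "is_weak_div \<Omega> \<sigma> (wdiv \<Omega> \<sigma>)"
    by (auto simp: wdiv_def L2_iff_sq_integrable)
qed (use assms in \<open>simp add: Hdiv_def L2vec_iff_sq_integrable\<close>)

lemma wgrad_eqI:
  assumes "sq_integrable M u" "sq_integrable M g" "is_weak_grad \<Omega> u g"
  shows "u \<in> H1 \<Omega>" "AE x in M. wgrad \<Omega> u x = g x"
proof -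
  show u: "u \<in> H1 \<Omega>"
    using assms by (auto simp: H1_def L2_iff_sq_integrable L2vec_iff_sq_integrable)
  show "AE x in M. wgrad \<Omega> u x = g x"
    using weak_grad_unique[OF wgrad_H1(2,3)[OF u] assms(2,3)] .
qed

lemma wdiv_eqI:
  assumes "sq_integrable M \<sigma>" "sq_integrable M w" "is_weak_div \<Omega> \<sigma> w"
  shows "\<sigma> \<in> Hdiv \<Omega>" "AE x in M. wdiv \<Omega> \<sigma> x = w x"
proof -
  show \<sigma>: "\<sigma> \<in> Hdiv \<Omega>"
    using assms by (auto simp: Hdiv_def L2_iff_sq_integrable L2vec_iff_sq_integrable)
  show "AE x in M. wdiv \<Omega> \<sigma> x = w x"
    using weak_div_unique[OF wdiv_Hdiv(2,3)[OF \<sigma>] assms(2,3)] .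
qed

lemma wgrad_lincomb:
  assumes u: "u \<in> H1 \<Omega>" and v: "v \<in> H1 \<Omega>"
  shows "(\<lambda>x. a * u x + b * v x) \<in> H1 \<Omega>"
    "AE x in M. wgrad \<Omega> (\<lambda>x. a * u x + b * v x) x = a *\<^sub>R wgrad \<Omega> u x + b *\<^sub>R wgrad \<Omega> v x"
proof -
  note U = wgrad_H1[OF u] and V = wgrad_H1[OF v]
  have 1: "sq_integrable M (\<lambda>x. a * u x + b * v x)"
    using sq_integrable_add[OF sq_integrable_scaleR[OF U(1)] sq_integrable_scaleR[OF V(1)]] by simp
  have 2: "sq_integrable M (\<lambda>x. a *\<^sub>R wgrad \<Omega> u x + b *\<^sub>R wgrad \<Omega> v x)"
    by (intro sq_integrable_add sq_integrable_scaleR U V)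
  have 3: "is_weak_grad \<Omega> (\<lambda>x. a * u x + b * v x) (\<lambda>x. a *\<^sub>R wgrad \<Omega> u x + b *\<^sub>R wgrad \<Omega> v x)"
    unfolding is_weak_grad_def
  proof (intro allI impI)
    fix \<phi> i assume \<phi>: "test_fun \<Omega> \<phi>"
    note T = test_fun_sq_integrable[OF \<phi>]
    have "(LINT x|M. u x * pd i \<phi> x) = - (LINT x|M. wgrad \<Omega> u x $ i * \<phi> x)"
      "(LINT x|M. v x * pd i \<phi> x) = - (LINT x|M. wgrad \<Omega> v x $ i * \<phi> x)"
      using U(3) V(3) \<phi> by (auto simp: is_weak_grad_def)
    moreover have "integrable M (\<lambda>x. u x * pd i \<phi> x)" "integrable M (\<lambda>x. v x * pd i \<phi> x)"
      "integrable M (\<lambda>x. wgrad \<Omega> u x $ i * \<phi> x)" "integrable M (\<lambda>x. wgrad \<Omega> v x $ i * \<phi> x)"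
      by (intro integrable_mult_sq sq_integrable_vec_nth U V T)+
    ultimately show "(LINT x|M. (a * u x + b * v x) * pd i \<phi> x)
        = - (LINT x|M. (a *\<^sub>R wgrad \<Omega> u x + b *\<^sub>R wgrad \<Omega> v x) $ i * \<phi> x)"
      by (simp add: distrib_right mult.assoc)
  qed
  from wgrad_eqI[OF 1 2 3] show "(\<lambda>x. a * u x + b * v x) \<in> H1 \<Omega>"
    "AE x in M. wgrad \<Omega> (\<lambda>x. a * u x + b * v x) x = a *\<^sub>R wgrad \<Omega> u x + b *\<^sub>R wgrad \<Omega> v x" .
qed

lemma wdiv_lincomb:
  assumes u: "u \<in> Hdiv \<Omega>" and v: "v \<in> Hdiv \<Omega>"
  shows "(\<lambda>x. a *\<^sub>R u x + b *\<^sub>R v x) \<in> Hdiv \<Omega>"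
    "AE x in M. wdiv \<Omega> (\<lambda>x. a *\<^sub>R u x + b *\<^sub>R v x) x = a * wdiv \<Omega> u x + b * wdiv \<Omega> v x"
proof -
  note U = wdiv_Hdiv[OF u] and V = wdiv_Hdiv[OF v]
  have 1: "sq_integrable M (\<lambda>x. a *\<^sub>R u x + b *\<^sub>R v x)"
    by (intro sq_integrable_add sq_integrable_scaleR U V)
  have 2: "sq_integrable M (\<lambda>x. a * wdiv \<Omega> u x + b * wdiv \<Omega> v x)"
    using sq_integrable_add[OF sq_integrable_scaleR[OF U(2)] sq_integrable_scaleR[OF V(2)]] by simp
  have 3: "is_weak_div \<Omega> (\<lambda>x. a *\<^sub>R u x + b *\<^sub>R v x) (\<lambda>x. a * wdiv \<Omega> u x + b * wdiv \<Omega> v x)"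
    unfolding is_weak_div_def
  proof (intro allI impI)
    fix \<phi> assume \<phi>: "test_fun \<Omega> \<phi>"
    note T = test_fun_sq_integrable[OF \<phi>]
    have "(LINT x|M. u x \<bullet> grad \<phi> x) = - (LINT x|M. wdiv \<Omega> u x * \<phi> x)"
      "(LINT x|M. v x \<bullet> grad \<phi> x) = - (LINT x|M. wdiv \<Omega> v x * \<phi> x)"
      using U(3) V(3) \<phi> by (auto simp: is_weak_div_def)
    moreover have "integrable M (\<lambda>x. u x \<bullet> grad \<phi> x)" "integrable M (\<lambda>x. v x \<bullet> grad \<phi> x)"
      "integrable M (\<lambda>x. wdiv \<Omega> u x * \<phi> x)" "integrable M (\<lambda>x. wdiv \<Omega> v x * \<phi> x)"
      by (intro integrable_mult_sq integrable_inner_sq U V T)+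
    ultimately show "(LINT x|M. (a *\<^sub>R u x + b *\<^sub>R v x) \<bullet> grad \<phi> x)
        = - (LINT x|M. (a * wdiv \<Omega> u x + b * wdiv \<Omega> v x) * \<phi> x)"
      by (simp add: distrib_right inner_add_left mult.assoc)
  qed
  from wdiv_eqI[OF 1 2 3] show "(\<lambda>x. a *\<^sub>R u x + b *\<^sub>R v x) \<in> Hdiv \<Omega>"
    "AE x in M. wdiv \<Omega> (\<lambda>x. a *\<^sub>R u x + b *\<^sub>R v x) x = a * wdiv \<Omega> u x + b * wdiv \<Omega> v x" .
qed

section \<open>Jets and the norm of \<open>U\<close>\<close>

lemma UU_subset: "UU \<Omega> \<subseteq> H1 \<Omega> \<times> Hdiv \<Omega>"
  by (auto simp: UU_def H10_def)

lemma jet_components_sq_integrable: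
  assumes "U \<in> H1 \<Omega> \<times> Hdiv \<Omega>"
  shows "sq_integrable M (fst U)" "sq_integrable M (wgrad \<Omega> (fst U))"
    "sq_integrable M (snd U)" "sq_integrable M (wdiv \<Omega> (snd U))"
  using assms wgrad_H1 wdiv_Hdiv by auto

lemma sq_integrable_jet:
  assumes "U \<in> H1 \<Omega> \<times> Hdiv \<Omega>"
  shows "sq_integrable M (jet \<Omega> U)"
proof -
  note c = jet_components_sq_integrable[OF assms]
  have "jet \<Omega> U \<in> borel_measurable M"
    unfolding jet_def[abs_def] by (intro borel_measurable_Pair sq_integrableD(1) c)
  moreover have "integrable M (\<lambda>x. (norm (jet \<Omega> U x))\<^sup>2)"
    using c[THEN sq_integrableD(2)] by (simp add: norm_jet jet_def)
  ultimately show ?thesis by (simp add: sq_integrable_def)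
qed

lemma U_norm2_eq:
  assumes "U \<in> H1 \<Omega> \<times> Hdiv \<Omega>"
  shows "U_norm2 \<Omega> U = (LINT x|M. (norm (jet \<Omega> U x))\<^sup>2)"
  using jet_components_sq_integrable[OF assms, THEN sq_integrableD(2)]
  by (simp add: U_norm2_def norm_jet jet_def ip_def vip_def flip: power2_norm_eq_inner power2_eq_square)

text \<open>One statement covers sums, multiples and differences. Membership is asserted only in
  \<open>H1\<close> times \<open>Hdiv\<close>, which suffices for the norm identities; membership in
  a discrete space comes from its closure properties.\<close>

lemma jet_lincomb:
  fixes a b :: real
  assumes "U \<in> H1 \<Omega> \<times> Hdiv \<Omega>" "V \<in> H1 \<Omega> \<times> Hdiv \<Omega>"
  defines "W \<equiv> ((\<lambda>x. a * fst U x + b * fst V x), (\<lambda>x. a *\<^sub>R snd U x + b *\<^sub>R snd V x))"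
  shows "W \<in> H1 \<Omega> \<times> Hdiv \<Omega>" "AE x in M. jet \<Omega> W x = a *\<^sub>R jet \<Omega> U x + b *\<^sub>R jet \<Omega> V x"
proof -
  have m: "fst U \<in> H1 \<Omega>" "fst V \<in> H1 \<Omega>" "snd U \<in> Hdiv \<Omega>" "snd V \<in> Hdiv \<Omega>" using assms by auto
  note g = wgrad_lincomb[OF m(1,2), of a b] and d = wdiv_lincomb[OF m(3,4), of a b]
  show "W \<in> H1 \<Omega> \<times> Hdiv \<Omega>" using g(1) d(1) by (simp add: W_def)
  show "AE x in M. jet \<Omega> W x = a *\<^sub>R jet \<Omega> U x + b *\<^sub>R jet \<Omega> V x"
    using g(2) d(2) by eventually_elim (simp add: jet_def W_def)
qed

lemma jet_add:
  "U \<in> UU \<Omega> \<Longrightarrow> V \<in> UU \<Omega> \<Longrightarrow> AE x in M. jet \<Omega> (U_add U V) x = jet \<Omega> U x + jet \<Omega> V x"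
  using jet_lincomb(2)[of U V 1 1] UU_subset by (auto simp: U_add_def)

lemma jet_scale: "U \<in> UU \<Omega> \<Longrightarrow> AE x in M. jet \<Omega> (U_scale c U) x = c *\<^sub>R jet \<Omega> U x"
  using jet_lincomb(2)[of U U c 0] UU_subset by (auto simp: U_scale_def)

lemma U_diff_eq: "U_diff U V = U_add U (U_scale (-1) V)"
  by (simp add: U_diff_def U_add_def U_scale_def)

lemma jet_diff:
  assumes "U \<in> UU \<Omega>" "V \<in> UU \<Omega>"
  shows "U_diff U V \<in> H1 \<Omega> \<times> Hdiv \<Omega>" "AE x in M. jet \<Omega> (U_diff U V) x = jet \<Omega> U x - jet \<Omega> V x"
  using jet_lincomb[of U V 1 "-1"] UU_subset assms by (auto simp: U_diff_def)

lemma U_norm2_diff: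
  assumes "U \<in> UU \<Omega>" "V \<in> UU \<Omega>"
  shows "U_norm2 \<Omega> (U_diff U V) = (LINT x|M. (norm (jet \<Omega> U x - jet \<Omega> V x))\<^sup>2)"
proof -
  have s: "sq_integrable M (jet \<Omega> U)" "sq_integrable M (jet \<Omega> V)" "sq_integrable M (jet \<Omega> (U_diff U V))"
    using sq_integrable_jet jet_diff(1)[OF assms] assms UU_subset by auto
  have "(LINT x|M. (norm (jet \<Omega> (U_diff U V) x))\<^sup>2) = (LINT x|M. (norm (jet \<Omega> U x - jet \<Omega> V x))\<^sup>2)"
    using jet_diff(2)[OF assms] sq_integrableD(1)[OF s(3)] sq_integrableD(1)[OF sq_integrable_diff[OF s(1,2)]]
    by (intro integral_cong_AE) (auto elim: eventually_mono)
  then show ?thesis using U_norm2_eq[OF jet_diff(1)[OF assms]] by simp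
qed

section \<open>Integration by parts by density of test functions\<close>

lemma H1_dist2_eq:
  "H1_dist2 \<Omega> u v gu gv = (LINT x|M. (norm (u x - v x))\<^sup>2) + (LINT x|M. (norm (gu x - gv x))\<^sup>2)"
  by (simp add: H1_dist2_def ip_def vip_def flip: power2_norm_eq_inner power2_eq_square)

lemma H10_approx:
  assumes "u \<in> H10 \<Omega>"
  obtains \<phi> where "\<And>j. test_fun \<Omega> (\<phi> j)"
    "(\<lambda>j. LINT x|M. (norm (\<phi> j x - u x))\<^sup>2) \<longlonglongrightarrow> 0"
    "(\<lambda>j. LINT x|M. (norm (grad (\<phi> j) x - wgrad \<Omega> u x))\<^sup>2) \<longlonglongrightarrow> 0"
proof -
  obtain \<phi> where \<phi>: "\<And>j. test_fun \<Omega> (\<phi> j)"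
    "(\<lambda>j. (LINT x|M. (norm (\<phi> j x - u x))\<^sup>2) + (LINT x|M. (norm (grad (\<phi> j) x - wgrad \<Omega> u x))\<^sup>2)) \<longlonglongrightarrow> 0"
    using assms unfolding H10_def H1_dist2_eq by blast
  have "(\<lambda>j. LINT x|M. (norm (\<phi> j x - u x))\<^sup>2) \<longlonglongrightarrow> 0"
    by (rule tendsto_sandwich[OF always_eventually always_eventually tendsto_const \<phi>(2)]) auto
  moreover have "(\<lambda>j. LINT x|M. (norm (grad (\<phi> j) x - wgrad \<Omega> u x))\<^sup>2) \<longlonglongrightarrow> 0"
    by (rule tendsto_sandwich[OF always_eventually always_eventually tendsto_const \<phi>(2)]) auto
  ultimately show ?thesis using that \<phi>(1) by blast
qed

text \<open>For test functions this is the definition of the weak divergence; both sides are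
  continuous in \<open>u\<close> for the \<open>H1\<close> distance.\<close>

lemma integration_by_parts:
  assumes u: "u \<in> H10 \<Omega>" and \<sigma>: "\<sigma> \<in> Hdiv \<Omega>"
  shows "(LINT x|M. \<sigma> x \<bullet> wgrad \<Omega> u x) = - (LINT x|M. wdiv \<Omega> \<sigma> x * u x)"
proof -
  obtain \<phi> where \<phi>: "\<And>j. test_fun \<Omega> (\<phi> j)"
    and lim: "(\<lambda>j. LINT x|M. (norm (\<phi> j x - u x))\<^sup>2) \<longlonglongrightarrow> 0"
    "(\<lambda>j. LINT x|M. (norm (grad (\<phi> j) x - wgrad \<Omega> u x))\<^sup>2) \<longlonglongrightarrow> 0"
    using H10_approx[OF u] by blast
  have "u \<in> H1 \<Omega>" using u by (simp add: H10_def)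
  note g = wgrad_H1[OF this] and d = wdiv_Hdiv[OF \<sigma>]
  have A: "(\<lambda>j. LINT x|M. grad (\<phi> j) x \<bullet> \<sigma> x) \<longlonglongrightarrow> (LINT x|M. wgrad \<Omega> u x \<bullet> \<sigma> x)"
    by (rule tendsto_integral_inner[OF test_fun_sq_integrable(3)[OF \<phi>] g(2) d(1) lim(2)])
  have eq: "(LINT x|M. grad (\<phi> j) x \<bullet> \<sigma> x) = - (LINT x|M. \<phi> j x \<bullet> wdiv \<Omega> \<sigma> x)" for j
    using d(3) \<phi>[of j] by (simp add: is_weak_div_def inner_commute mult.commute)
  have B: "(\<lambda>j. LINT x|M. \<phi> j x \<bullet> wdiv \<Omega> \<sigma> x) \<longlonglongrightarrow> (LINT x|M. u x \<bullet> wdiv \<Omega> \<sigma> x)"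
    by (rule tendsto_integral_inner[OF test_fun_sq_integrable(1)[OF \<phi>] g(1) d(2) lim(1)])
  from LIMSEQ_unique[OF A[unfolded eq] tendsto_minus[OF B]]
  show ?thesis by (simp add: inner_commute mult.commute)
qed

lemma test_fun_power2:
  assumes "test_fun \<Omega> \<phi>"
  shows "test_fun \<Omega> (\<lambda>x. (\<phi> x)\<^sup>2)" "grad (\<lambda>x. (\<phi> x)\<^sup>2) x = (2 * \<phi> x) *\<^sub>R grad \<phi> x"
proof -
  have s: "smooth \<phi>" using assms by (simp add: test_fun_def)
  show "test_fun \<Omega> (\<lambda>x. (\<phi> x)\<^sup>2)"
    using assms smooth_power[OF s, of 2] by (simp add: test_fun_def)
  show "grad (\<lambda>x. (\<phi> x)\<^sup>2) x = (2 * \<phi> x) *\<^sub>R grad \<phi> x"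
    using pd_mult[OF smooth_differentiable[OF s] smooth_differentiable[OF s]]
    by (simp add: grad_def vec_eq_iff power2_eq_square)
qed

text \<open>The weak divergence of \<open>\<beta>\<close> is tested with squares of the
  approximating test functions, which avoids differentiating the square of \<open>u\<close>.
  Boundedness of \<open>\<beta>\<close> and its divergence makes all products converge.\<close>

lemma integration_by_parts_square:
  assumes u: "u \<in> H10 \<Omega>" and \<beta>: "\<beta> \<in> Hdiv \<Omega>"
    and C: "AE x in M. norm (\<beta> x) \<le> C" "AE x in M. \<bar>wdiv \<Omega> \<beta> x\<bar> \<le> C"
  shows "2 * (LINT x|M. u x * (\<beta> x \<bullet> wgrad \<Omega> u x)) = - (LINT x|M. wdiv \<Omega> \<beta> x * (u x)\<^sup>2)"
proof -
  obtain \<phi> where \<phi>: "\<And>j. test_fun \<Omega> (\<phi> j)"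
    and lim: "(\<lambda>j. LINT x|M. (norm (\<phi> j x - u x))\<^sup>2) \<longlonglongrightarrow> 0"
    "(\<lambda>j. LINT x|M. (norm (grad (\<phi> j) x - wgrad \<Omega> u x))\<^sup>2) \<longlonglongrightarrow> 0"
    using H10_approx[OF u] by blast
  have "u \<in> H1 \<Omega>" using u by (simp add: H10_def)
  note g = wgrad_H1[OF this] and d = wdiv_Hdiv[OF \<beta>] and T = test_fun_sq_integrable[OF \<phi>]
  have AE1: "AE x in M. (norm (f x *\<^sub>R \<beta> x))\<^sup>2 \<le> C\<^sup>2 * (norm (f x))\<^sup>2" for f :: "_ \<Rightarrow> real"
    using C(1) by eventually_elim
      (simp add: power_mult_distrib mult.commute[of "(f _)\<^sup>2"] mult_right_mono power_mono)
  have AE2: "AE x in M. (norm (f x * wdiv \<Omega> \<beta> x))\<^sup>2 \<le> C\<^sup>2 * (norm (f x))\<^sup>2" for f :: "_ \<Rightarrow> real"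
    using C(2)
  proof eventually_elim
    case (elim x)
    from power_mono[OF this abs_ge_zero, of 2] show ?case
      by (simp add: power_mult_distrib mult.commute[of "(f _)\<^sup>2"] mult_right_mono)
  qed
  have S1: "sq_integrable M (\<lambda>x. f x *\<^sub>R \<beta> x)" if "sq_integrable M f" for f :: "_ \<Rightarrow> real"
    using that d(1) AE1 by (intro sq_integrable_bound[where g = "\<lambda>x. C\<^sup>2 * (norm (f x))\<^sup>2"])
      (auto simp: sq_integrable_def)
  have S2: "sq_integrable M (\<lambda>x. f x * wdiv \<Omega> \<beta> x)" if "sq_integrable M f" for f :: "_ \<Rightarrow> real"
    using that d(2) AE2 by (intro sq_integrable_bound[where g = "\<lambda>x. C\<^sup>2 * (norm (f x))\<^sup>2"])
      (auto simp: sq_integrable_def)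
  have lim1: "(\<lambda>j. LINT x|M. (norm (\<phi> j x *\<^sub>R \<beta> x - u x *\<^sub>R \<beta> x))\<^sup>2) \<longlonglongrightarrow> 0"
    unfolding scaleR_left_diff_distrib[symmetric]
    by (rule tendsto_0_integral_dominated[OF lim(1) sq_integrable_diff[OF T(1) g(1)] zero_le_power2 AE1])
  have lim2: "(\<lambda>j. LINT x|M. (norm (\<phi> j x * wdiv \<Omega> \<beta> x - u x * wdiv \<Omega> \<beta> x))\<^sup>2) \<longlonglongrightarrow> 0"
    unfolding left_diff_distrib[symmetric]
    by (rule tendsto_0_integral_dominated[OF lim(1) sq_integrable_diff[OF T(1) g(1)] zero_le_power2 AE2])
  have "(\<lambda>j. LINT x|M. (\<phi> j x *\<^sub>R \<beta> x) \<bullet> grad (\<phi> j) x) \<longlonglongrightarrow> (LINT x|M. (u x *\<^sub>R \<beta> x) \<bullet> wgrad \<Omega> u x)"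
    by (rule tendsto_integral_inner_both[OF S1[OF T(1)] T(3) S1[OF g(1)] g(2) lim1 lim(2)])
  then have A: "(\<lambda>j. 2 * (LINT x|M. (\<phi> j x *\<^sub>R \<beta> x) \<bullet> grad (\<phi> j) x))
      \<longlonglongrightarrow> 2 * (LINT x|M. (u x *\<^sub>R \<beta> x) \<bullet> wgrad \<Omega> u x)"
    by (rule tendsto_mult_left)
  have "(\<lambda>j. LINT x|M. (\<phi> j x * wdiv \<Omega> \<beta> x) \<bullet> \<phi> j x) \<longlonglongrightarrow> (LINT x|M. (u x * wdiv \<Omega> \<beta> x) \<bullet> u x)"
    by (rule tendsto_integral_inner_both[OF S2[OF T(1)] T(1) S2[OF g(1)] g(1) lim2 lim(1)])
  then have B: "(\<lambda>j. - (LINT x|M. (\<phi> j x * wdiv \<Omega> \<beta> x) \<bullet> \<phi> j x)) \<longlonglongrightarrow> - (LINT x|M. (u x * wdiv \<Omega> \<beta> x) \<bullet> u x)"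
    by (rule tendsto_minus)
  have eq: "2 * (LINT x|M. (\<phi> j x *\<^sub>R \<beta> x) \<bullet> grad (\<phi> j) x) = - (LINT x|M. (\<phi> j x * wdiv \<Omega> \<beta> x) \<bullet> \<phi> j x)" for j
  proof -
    have "(LINT x|M. \<beta> x \<bullet> grad (\<lambda>x. (\<phi> j x)\<^sup>2) x) = - (LINT x|M. wdiv \<Omega> \<beta> x * (\<phi> j x)\<^sup>2)"
      using d(3) test_fun_power2(1)[OF \<phi>[of j]] by (simp add: is_weak_div_def)
    then show ?thesis
      unfolding test_fun_power2(2)[OF \<phi>] by (simp add: power2_eq_square mult.assoc mult.left_commute)
  qed
  from LIMSEQ_unique[OF A[unfolded eq] B] show ?thesis by (simp add: power2_eq_square mult_ac)
qed

section \<open>Completeness of \<open>U\<close>\<close>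

lemma sq_integrable_jet_components:
  fixes G :: "_ \<Rightarrow> 'd jet"
  assumes "sq_integrable M G"
  shows "sq_integrable M (\<lambda>x. fst (G x))" "sq_integrable M (\<lambda>x. fst (snd (G x)))"
    "sq_integrable M (\<lambda>x. fst (snd (snd (G x))))" "sq_integrable M (\<lambda>x. snd (snd (snd (G x))))"
proof -
  note m = borel_measurable_continuous_on[OF _ sq_integrableD(1)[OF assms]]
  have "(\<lambda>x. fst (G x)) \<in> borel_measurable M" "(\<lambda>x. fst (snd (G x))) \<in> borel_measurable M"
    "(\<lambda>x. fst (snd (snd (G x)))) \<in> borel_measurable M" "(\<lambda>x. snd (snd (snd (G x)))) \<in> borel_measurable M"
    by (rule m[of "\<lambda>p. fst p"] m[of "\<lambda>p. fst (snd p)"] m[of "\<lambda>p. fst (snd (snd p))"]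
          m[of "\<lambda>p. snd (snd (snd p))"], intro continuous_on_fst continuous_on_snd continuous_on_id)+
  then show "sq_integrable M (\<lambda>x. fst (G x))" "sq_integrable M (\<lambda>x. fst (snd (G x)))"
    "sq_integrable M (\<lambda>x. fst (snd (snd (G x))))" "sq_integrable M (\<lambda>x. snd (snd (snd (G x))))"
    by (auto intro!: sq_integrable_bound[OF _ sq_integrableD(2)[OF assms]] simp: norm_jet)
qed

text \<open>The jets converge in the square mean. Weak derivative identities survive the limit
  because they are pairings with a fixed test function; membership in \<open>H10\<close> requires a
  diagonal sequence.\<close>

theorem UU_complete:
  assumes X: "\<And>j. X j \<in> UU \<Omega>"
    and Cauchy: "\<And>e. e > 0 \<Longrightarrow> \<exists>K. \<forall>i\<ge>K. \<forall>j\<ge>K. (LINT x|M. (norm (jet \<Omega> (X i) x - jet \<Omega> (X j) x))\<^sup>2) < e"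
  shows "\<exists>W\<in>UU \<Omega>. (\<lambda>j. LINT x|M. (norm (jet \<Omega> (X j) x - jet \<Omega> W x))\<^sup>2) \<longlonglongrightarrow> 0"
proof -
  have X': "X j \<in> H1 \<Omega> \<times> Hdiv \<Omega>" for j using X UU_subset by blast
  note J = sq_integrable_jet[OF X']
  obtain G where G: "sq_integrable M G" and lim: "(\<lambda>j. LINT x|M. (norm (jet \<Omega> (X j) x - G x))\<^sup>2) \<longlonglongrightarrow> 0"
    using sq_integrable_complete[OF J Cauchy] by blast
  define u g \<sigma> w where "u = (\<lambda>x. fst (G x))" and "g = (\<lambda>x. fst (snd (G x)))"
    and "\<sigma> = (\<lambda>x. fst (snd (snd (G x))))" and "w = (\<lambda>x. snd (snd (snd (G x))))"
  have s: "sq_integrable M u" "sq_integrable M g" "sq_integrable M \<sigma>" "sq_integrable M w"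
    using sq_integrable_jet_components[OF G] by (simp_all add: u_def g_def \<sigma>_def w_def)
  note c = jet_components_sq_integrable[OF X']
  note dom = tendsto_0_integral_dominated[OF lim sq_integrable_diff[OF J G] zero_le_one]
  have lu: "(\<lambda>j. LINT x|M. (norm (fst (X j) x - u x))\<^sup>2) \<longlonglongrightarrow> 0"
    and lg: "(\<lambda>j. LINT x|M. (norm (wgrad \<Omega> (fst (X j)) x - g x))\<^sup>2) \<longlonglongrightarrow> 0"
    and ls: "(\<lambda>j. LINT x|M. (norm (snd (X j) x - \<sigma> x))\<^sup>2) \<longlonglongrightarrow> 0"
    and lw: "(\<lambda>j. LINT x|M. (norm (wdiv \<Omega> (snd (X j)) x - w x))\<^sup>2) \<longlonglongrightarrow> 0"
    by (intro dom AE_I2; simp add: norm_jet jet_def u_def g_def \<sigma>_def w_def)+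
  have lgi: "(\<lambda>j. LINT x|M. (norm (wgrad \<Omega> (fst (X j)) x $ i - g x $ i))\<^sup>2) \<longlonglongrightarrow> 0" for i
  proof (rule tendsto_0_integral_dominated[OF lg sq_integrable_diff[OF c(2) s(2)] zero_le_one AE_I2])
    show "(norm (wgrad \<Omega> (fst (X j)) x $ i - g x $ i))\<^sup>2 \<le> 1 * (norm (wgrad \<Omega> (fst (X j)) x - g x))\<^sup>2" for j x
      using component_le_norm_cart[of "wgrad \<Omega> (fst (X j)) x - g x" i] by (simp add: power2_le_iff_abs_le)
  qed
  have wg: "is_weak_grad \<Omega> u g"
    unfolding is_weak_grad_def
  proof (intro allI impI)
    fix \<phi> i assume \<phi>: "test_fun \<Omega> \<phi>"
    note T = test_fun_sq_integrable[OF \<phi>]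
    have A: "(\<lambda>j. LINT x|M. fst (X j) x \<bullet> pd i \<phi> x) \<longlonglongrightarrow> (LINT x|M. u x \<bullet> pd i \<phi> x)"
      by (rule tendsto_integral_inner[OF c(1) s(1) T(2) lu])
    have B: "(\<lambda>j. - (LINT x|M. (wgrad \<Omega> (fst (X j)) x $ i) \<bullet> \<phi> x)) \<longlonglongrightarrow> - (LINT x|M. (g x $ i) \<bullet> \<phi> x)"
      by (rule tendsto_minus[OF tendsto_integral_inner[OF sq_integrable_vec_nth[OF c(2)] sq_integrable_vec_nth[OF s(2)] T(1) lgi]])
    have eq: "(LINT x|M. fst (X j) x \<bullet> pd i \<phi> x) = - (LINT x|M. (wgrad \<Omega> (fst (X j)) x $ i) \<bullet> \<phi> x)" for j
      using wgrad_H1(3)[of "fst (X j)"] X'[of j] \<phi> by (auto simp: is_weak_grad_def)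
    from LIMSEQ_unique[OF A[unfolded eq] B] show "(LINT x|M. u x * pd i \<phi> x) = - (LINT x|M. g x $ i * \<phi> x)"
      by simp
  qed
  have wd: "is_weak_div \<Omega> \<sigma> w"
    unfolding is_weak_div_def
  proof (intro allI impI)
    fix \<phi> assume \<phi>: "test_fun \<Omega> \<phi>"
    note T = test_fun_sq_integrable[OF \<phi>]
    have A: "(\<lambda>j. LINT x|M. snd (X j) x \<bullet> grad \<phi> x) \<longlonglongrightarrow> (LINT x|M. \<sigma> x \<bullet> grad \<phi> x)"
      by (rule tendsto_integral_inner[OF c(3) s(3) T(3) ls])
    have B: "(\<lambda>j. - (LINT x|M. wdiv \<Omega> (snd (X j)) x \<bullet> \<phi> x)) \<longlonglongrightarrow> - (LINT x|M. w x \<bullet> \<phi> x)"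
      by (rule tendsto_minus[OF tendsto_integral_inner[OF c(4) s(4) T(1) lw]])
    have eq: "(LINT x|M. snd (X j) x \<bullet> grad \<phi> x) = - (LINT x|M. wdiv \<Omega> (snd (X j)) x \<bullet> \<phi> x)" for j
      using wdiv_Hdiv(3)[of "snd (X j)"] X'[of j] \<phi> by (auto simp: is_weak_div_def)
    from LIMSEQ_unique[OF A[unfolded eq] B] show "(LINT x|M. \<sigma> x \<bullet> grad \<phi> x) = - (LINT x|M. w x * \<phi> x)"
      by simp
  qed
  note u = wgrad_eqI[OF s(1,2) wg] and d = wdiv_eqI[OF s(3,4) wd]
  \<comment> \<open>\<open>g\<close> is one weak gradient of the limit and
    \<open>wgrad \<Omega> u\<close> the chosen one; they agree almost everywhere.\<close>
  have lg': "(\<lambda>j. LINT x|M. (norm (wgrad \<Omega> (fst (X j)) x - wgrad \<Omega> u x))\<^sup>2) \<longlonglongrightarrow> 0"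
  proof (rule tendsto_0_integral_dominated[OF lg sq_integrable_diff[OF c(2) s(2)] zero_le_one])
    show "AE x in M. (norm (wgrad \<Omega> (fst (X j)) x - wgrad \<Omega> u x))\<^sup>2 \<le> 1 * (norm (wgrad \<Omega> (fst (X j)) x - g x))\<^sup>2" for j
      using u(2) by eventually_elim simp
  qed
  \<comment> \<open>Diagonal choice: one test function per \<open>j\<close>, within
    \<open>inverse (Suc j)\<close> of the \<open>j\<close>-th member of the sequence.\<close>
  have "\<forall>j. \<exists>\<psi>. test_fun \<Omega> \<psi> \<and> (LINT x|M. (norm (\<psi> x - fst (X j) x))\<^sup>2)
      + (LINT x|M. (norm (grad \<psi> x - wgrad \<Omega> (fst (X j)) x))\<^sup>2) < inverse (real (Suc j))"
  proof
    fix j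
    have "fst (X j) \<in> H10 \<Omega>" using X[of j] by (auto simp: UU_def)
    then obtain \<phi> where \<phi>: "\<And>n. test_fun \<Omega> (\<phi> n)"
      "(\<lambda>n. LINT x|M. (norm (\<phi> n x - fst (X j) x))\<^sup>2) \<longlonglongrightarrow> 0"
      "(\<lambda>n. LINT x|M. (norm (grad (\<phi> n) x - wgrad \<Omega> (fst (X j)) x))\<^sup>2) \<longlonglongrightarrow> 0"
      using H10_approx by blast
    have "eventually (\<lambda>n. (LINT x|M. (norm (\<phi> n x - fst (X j) x))\<^sup>2)
        + (LINT x|M. (norm (grad (\<phi> n) x - wgrad \<Omega> (fst (X j)) x))\<^sup>2) < inverse (real (Suc j))) sequentially"
      by (rule order_tendstoD(2)[OF tendsto_add_zero[OF \<phi>(2,3)]]) simp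
    from eventually_happens'[OF trivial_limit_sequentially this] \<phi>(1)
    show "\<exists>\<psi>. test_fun \<Omega> \<psi> \<and> (LINT x|M. (norm (\<psi> x - fst (X j) x))\<^sup>2)
      + (LINT x|M. (norm (grad \<psi> x - wgrad \<Omega> (fst (X j)) x))\<^sup>2) < inverse (real (Suc j))" by blast
  qed
  from choice[OF this] obtain \<psi> where \<psi>: "\<And>j. test_fun \<Omega> (\<psi> j)"
    "\<And>j. (LINT x|M. (norm (\<psi> j x - fst (X j) x))\<^sup>2)
      + (LINT x|M. (norm (grad (\<psi> j) x - wgrad \<Omega> (fst (X j)) x))\<^sup>2) < inverse (real (Suc j))"
    by blast
  have "(LINT x|M. (norm (\<psi> j x - fst (X j) x))\<^sup>2) \<le> inverse (real (Suc j))"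
    and "(LINT x|M. (norm (grad (\<psi> j) x - wgrad \<Omega> (fst (X j)) x))\<^sup>2) \<le> inverse (real (Suc j))" for j
  proof -
    have "0 \<le> (LINT x|M. (norm (\<psi> j x - fst (X j) x))\<^sup>2)"
      "0 \<le> (LINT x|M. (norm (grad (\<psi> j) x - wgrad \<Omega> (fst (X j)) x))\<^sup>2)" by simp_all
    with \<psi>(2)[of j] show "(LINT x|M. (norm (\<psi> j x - fst (X j) x))\<^sup>2) \<le> inverse (real (Suc j))"
      "(LINT x|M. (norm (grad (\<psi> j) x - wgrad \<Omega> (fst (X j)) x))\<^sup>2) \<le> inverse (real (Suc j))"
      by linarith+
  qed
  then have l1: "(\<lambda>j. LINT x|M. (norm (\<psi> j x - fst (X j) x))\<^sup>2) \<longlonglongrightarrow> 0"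
    and l2: "(\<lambda>j. LINT x|M. (norm (grad (\<psi> j) x - wgrad \<Omega> (fst (X j)) x))\<^sup>2) \<longlonglongrightarrow> 0"
    by (auto intro!: tendsto_sandwich[OF always_eventually always_eventually tendsto_const LIMSEQ_inverse_real_of_nat])
  note T = test_fun_sq_integrable[OF \<psi>(1)]
  have "(\<lambda>j. H1_dist2 \<Omega> (\<psi> j) u (grad (\<psi> j)) (wgrad \<Omega> u)) \<longlonglongrightarrow> 0"
    unfolding H1_dist2_eq
    by (rule tendsto_add_zero[OF tendsto_integral_norm_diff_trans[OF T(1) c(1) s(1) l1 lu]
          tendsto_integral_norm_diff_trans[OF T(3) c(2) wgrad_H1(2)[OF u(1)] l2 lg']])
  then have "u \<in> H10 \<Omega>" using u(1) \<psi>(1) by (auto simp: H10_def)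
  then have W: "(u, \<sigma>) \<in> UU \<Omega>" using d(1) by (simp add: UU_def)
  have "(\<lambda>j. LINT x|M. (norm (jet \<Omega> (X j) x - jet \<Omega> (u, \<sigma>) x))\<^sup>2) \<longlonglongrightarrow> 0"
  proof (rule tendsto_0_integral_dominated[OF lim sq_integrable_diff[OF J G] zero_le_one])
    show "AE x in M. (norm (jet \<Omega> (X j) x - jet \<Omega> (u, \<sigma>) x))\<^sup>2 \<le> 1 * (norm (jet \<Omega> (X j) x - G x))\<^sup>2" for j
      using u(2) d(2) by eventually_elim (simp add: jet_def u_def g_def \<sigma>_def w_def)
  qed
  with W show ?thesis by blast
qed

end

section \<open>The least-squares form\<close>

text \<open>Rests on completeness of Lebesgue measure, reached by extending both functions by zero
  outside \<open>S\<close>.\<close>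

lemma borel_measurable_lebesgue_on_AE:
  fixes f g :: "'a::euclidean_space \<Rightarrow> 'b::euclidean_space"
  assumes S: "S \<in> sets lebesgue" and f: "f \<in> borel_measurable (lebesgue_on S)"
    and ae: "AE x in lebesgue_on S. f x = g x"
  shows "g \<in> borel_measurable (lebesgue_on S)"
proof -
  have "(\<lambda>x. indicator S x *\<^sub>R f x) \<in> borel_measurable lebesgue"
    using f S by (simp add: borel_measurable_restrict_space_iff)
  moreover have "AE x in lebesgue. x \<in> S \<longrightarrow> f x = g x"
    using ae S by (simp add: AE_restrict_space_iff)
  then have "AE x in lebesgue. indicator S x *\<^sub>R f x = indicator S x *\<^sub>R g x"
    by eventually_elim (auto simp: indicator_def)
  ultimately have "(\<lambda>x. indicator S x *\<^sub>R g x) \<in> borel_measurable lebesgue"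
    by (rule borel_measurable_AE)
  then show ?thesis using S by (simp add: borel_measurable_restrict_space_iff)
qed

lemma borel_measurable_det:
  fixes F :: "'a \<Rightarrow> real^'n^'n"
  assumes "\<And>i j. (\<lambda>x. F x $ i $ j) \<in> borel_measurable N"
  shows "(\<lambda>x. det (F x)) \<in> borel_measurable N"
  unfolding det_def by (intro borel_measurable_sum borel_measurable_times borel_measurable_prod borel_measurable_const assms)

lemma borel_measurable_vec:
  fixes f :: "'a \<Rightarrow> real^'n"
  assumes "\<And>i. (\<lambda>x. f x $ i) \<in> borel_measurable N"
  shows "f \<in> borel_measurable N"
  using assms by (subst borel_measurable_euclidean_space) (auto simp: Basis_vec_def inner_axis)

text \<open>The coefficient hypotheses in quantitative form, with a single \<open>C\<close> for all
  upper bounds. \<open>A\<close> is bounded through its quadratic form, the shape in which bounds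
  pass to \<open>msqrt\<close>.\<close>

locale least_squares = bounded_open \<Omega> for \<Omega> :: "(real^('d::finite)) set" +
  fixes A :: "real^'d \<Rightarrow> real^'d^'d" and \<beta> :: "real^'d \<Rightarrow> real^'d" and \<gamma> :: "real^'d \<Rightarrow> real"
    and \<alpha> C k :: real
  assumes \<alpha>_pos: "\<alpha> > 0" and C_nonneg: "C \<ge> 0" and k_pos: "k > 0"
    and A_meas: "\<And>i j. (\<lambda>x. A x $ i $ j) \<in> borel_measurable (lebesgue_on \<Omega>)"
    and \<gamma>_meas: "\<gamma> \<in> borel_measurable (lebesgue_on \<Omega>)"
    and \<beta>_Hdiv: "\<beta> \<in> Hdiv \<Omega>"
    and A_sym: "AE x in lebesgue_on \<Omega>. transpose (A x) = A x"
    and A_coercive: "AE x in lebesgue_on \<Omega>. \<forall>\<xi>. \<alpha> * (norm \<xi>)\<^sup>2 \<le> \<xi> \<bullet> (A x *v \<xi>)"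
    and A_bounded: "AE x in lebesgue_on \<Omega>. \<forall>\<xi>. \<xi> \<bullet> (A x *v \<xi>) \<le> C * (norm \<xi>)\<^sup>2"
    and \<beta>_bounded: "AE x in lebesgue_on \<Omega>. norm (\<beta> x) \<le> C"
    and \<gamma>_bounded: "AE x in lebesgue_on \<Omega>. \<bar>\<gamma> x\<bar> \<le> C"
    and div\<beta>_bounded: "AE x in lebesgue_on \<Omega>. \<bar>wdiv \<Omega> \<beta> x\<bar> \<le> C"
    and reaction_nonneg: "AE x in lebesgue_on \<Omega>. 0 \<le> wdiv \<Omega> \<beta> x / 2 + \<gamma> x"
begin

text \<open>Collects what the linear algebra at a single point uses. The bound on
  \<open>wdiv \<Omega> \<beta>\<close> stays outside: it enters only under integrals.\<close>

definition good :: "real^'d \<Rightarrow> bool" where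
  "good x \<longleftrightarrow> transpose (A x) = A x \<and> (\<forall>\<xi>. \<alpha> * (norm \<xi>)\<^sup>2 \<le> \<xi> \<bullet> (A x *v \<xi>))
    \<and> (\<forall>\<xi>. \<xi> \<bullet> (A x *v \<xi>) \<le> C * (norm \<xi>)\<^sup>2)
    \<and> norm (\<beta> x) \<le> C \<and> \<bar>\<gamma> x\<bar> \<le> C \<and> 0 \<le> wdiv \<Omega> \<beta> x / 2 + \<gamma> x"

lemma AE_good: "AE x in M. good x"
  using A_sym A_coercive A_bounded \<beta>_bounded \<gamma>_bounded reaction_nonneg
  by eventually_elim (simp add: good_def)

definition W :: "real^'d \<Rightarrow> 'd jet \<Rightarrow> real" where
  "W x p = - snd (snd (snd p)) + \<gamma> x * fst p"

definition T :: "real^'d \<Rightarrow> 'd jet \<Rightarrow> real" where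
  "T x p = fst p + k * W x p"

definition Z :: "real^'d \<Rightarrow> 'd jet \<Rightarrow> real^'d" where
  "Z x p = msqrt_inv (A x) *v fst (snd (snd p)) - msqrt (A x) *v fst (snd p)
    + msqrt_inv (A x) *v (fst p *\<^sub>R \<beta> x)"

definition q :: "real^'d \<Rightarrow> 'd jet \<Rightarrow> 'd jet \<Rightarrow> real" where
  "q x p r = (1 / k) * (T x p * T x r) + Z x p \<bullet> Z x r"

lemma T_add: "T x (p + r) = T x p + T x r" and T_scale: "T x (c *\<^sub>R p) = c * T x p"
  by (simp_all add: T_def W_def algebra_simps)

lemma Z_add: "Z x (p + r) = Z x p + Z x r" and Z_scale: "Z x (c *\<^sub>R p) = c *\<^sub>R Z x p"
  by (simp_all add: Z_def matrix_vector_right_distrib matrix_vector_mult_scaleR scaleR_add_left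
      scaleR_add_right scaleR_diff_right flip: scaleR_scaleR)

lemma q_add: "q x (p + p') r = q x p r + q x p' r" and q_scale: "q x (c *\<^sub>R p) r = c * q x p r"
  by (simp_all add: q_def T_add T_scale Z_add Z_scale inner_add_left algebra_simps)

lemma q_sym: "q x p r = q x r p"
  by (simp add: q_def inner_commute mult.commute)

lemma q_self: "q x p p = (T x p)\<^sup>2 / k + (norm (Z x p))\<^sup>2"
  unfolding q_def power2_norm_eq_inner by (simp add: power2_eq_square)

lemma Wop_eq: "Wop \<Omega> \<gamma> U x = W x (jet \<Omega> U x)"
  by (simp add: Wop_def W_def jet_def)

lemma Zop_eq: "Zop \<Omega> A \<beta> U x = Z x (jet \<Omega> U x)"
  by (simp add: Zop_def Z_def jet_def)

section \<open>Pointwise estimates of the quadratic form on jets\<close>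

context
  fixes x assumes good: "good x"
begin

lemma A_facts: "transpose (A x) = A x" "\<alpha> * (norm \<xi>)\<^sup>2 \<le> \<xi> \<bullet> (A x *v \<xi>)"
  "\<xi> \<bullet> (A x *v \<xi>) \<le> C * (norm \<xi>)\<^sup>2"
  using good by (auto simp: good_def)

lemmas S_simps = msqrt_mult_msqrt[OF A_facts(1) \<alpha>_pos A_facts(2)] norm_msqrt[OF A_facts(1) \<alpha>_pos A_facts(2)]
  msqrt_msqrt_inv[OF A_facts(1) \<alpha>_pos A_facts(2)]

lemma norm_S_le: "(norm (msqrt (A x) *v \<xi>))\<^sup>2 \<le> C * (norm \<xi>)\<^sup>2"
  using A_facts(3)[of \<xi>] by (simp add: S_simps)

text \<open>\<open>A x\<close> is the square of \<open>msqrt (A x)\<close>, so the bound for the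
  root is applied twice.\<close>

lemma norm_A_le: "(norm (A x *v \<xi>))\<^sup>2 \<le> C\<^sup>2 * (norm \<xi>)\<^sup>2"
proof -
  have "(norm (A x *v \<xi>))\<^sup>2 \<le> C * (norm (msqrt (A x) *v \<xi>))\<^sup>2"
    using norm_S_le[of "msqrt (A x) *v \<xi>"] by (simp add: S_simps(1))
  also have "\<dots> \<le> C * (C * (norm \<xi>)\<^sup>2)"
    by (intro mult_left_mono norm_S_le C_nonneg)
  finally show ?thesis by (simp add: power2_eq_square mult.assoc)
qed

lemma norm_b_le: "(norm (c *\<^sub>R \<beta> x))\<^sup>2 \<le> C\<^sup>2 * c\<^sup>2"
proof -
  have "(norm (\<beta> x))\<^sup>2 \<le> C\<^sup>2" using good by (simp add: good_def power_mono)
  then show ?thesis by (simp add: power_mult_distrib mult.commute[of "c\<^sup>2"] mult_right_mono)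
qed

lemma \<gamma>_le: "(\<gamma> x * c)\<^sup>2 \<le> C\<^sup>2 * c\<^sup>2"
proof -
  have "(\<gamma> x)\<^sup>2 \<le> C\<^sup>2" using good power_mono[of "\<bar>\<gamma> x\<bar>" C 2] by (simp add: good_def)
  then show ?thesis by (simp add: power_mult_distrib mult_right_mono)
qed

lemma Z_eq: "Z x p = msqrt_inv (A x) *v (fst (snd (snd p)) + fst p *\<^sub>R \<beta> x) - msqrt (A x) *v fst (snd p)"
  by (simp add: Z_def matrix_vector_right_distrib)

lemma S_Z: "msqrt (A x) *v Z x p = fst (snd (snd p)) + fst p *\<^sub>R \<beta> x - A x *v fst (snd p)"
  by (simp add: Z_eq matrix_vector_mult_diff_distrib S_simps)

text \<open>The right-hand side does not mention the matrix square root; it yields the measurability of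
  \<open>Z \<bullet> Z\<close> without that of \<open>msqrt\<close>.\<close>

lemma Z_inner_Z:
  fixes p r :: "'d jet"
  defines "a \<equiv> fst (snd (snd p)) + fst p *\<^sub>R \<beta> x" and "c \<equiv> fst (snd (snd r)) + fst r *\<^sub>R \<beta> x"
  shows "Z x p \<bullet> Z x r = a \<bullet> (\<chi> l. det (\<chi> i j. if j = l then c $ i else A x $ i $ j) / det (A x))
    - fst (snd r) \<bullet> a - fst (snd p) \<bullet> c + fst (snd p) \<bullet> (A x *v fst (snd r))"
proof -
  note h = A_facts(1) \<alpha>_pos A_facts(2)
  let ?R = "msqrt_inv (A x)" and ?S = "msqrt (A x)"
  have "Z x p \<bullet> Z x r = (?R *v a) \<bullet> (?R *v c) - (?S *v fst (snd r)) \<bullet> (?R *v a)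
      - (?S *v fst (snd p)) \<bullet> (?R *v c) + (?S *v fst (snd p)) \<bullet> (?S *v fst (snd r))"
    by (simp add: Z_eq a_def c_def inner_diff_left inner_diff_right
        inner_commute[of "?R *v _" "?S *v fst (snd r)"])
  also have "(?S *v fst (snd p)) \<bullet> (?S *v fst (snd r)) = fst (snd p) \<bullet> (A x *v fst (snd r))"
    using symmetric_matrix_selfadjoint[OF msqrt_spd(1)[OF h], of "fst (snd p)" "?S *v fst (snd r)"]
    by (simp add: S_simps)
  finally show ?thesis
    by (simp add: msqrt_inv_inner_msqrt_inv[OF h] msqrt_inner_msqrt_inv[OF h])
qed

lemma T_le: "(T x p)\<^sup>2 \<le> (2 + 4 * k\<^sup>2 + 4 * k\<^sup>2 * C\<^sup>2) * (norm p)\<^sup>2"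
proof -
  have s: "(a + b)\<^sup>2 \<le> 2 * a\<^sup>2 + 2 * b\<^sup>2" for a b :: real
    using norm_add_power2_le[of a b] by simp
  have "(T x p)\<^sup>2 \<le> 2 * (fst p)\<^sup>2 + 2 * (k * W x p)\<^sup>2"
    unfolding T_def by (rule s)
  also have "(k * W x p)\<^sup>2 = k\<^sup>2 * (W x p)\<^sup>2" by (simp add: power_mult_distrib)
  also have "(W x p)\<^sup>2 \<le> 2 * (snd (snd (snd p)))\<^sup>2 + 2 * (C\<^sup>2 * (fst p)\<^sup>2)"
    unfolding W_def using s[of "- snd (snd (snd p))" "\<gamma> x * fst p"] \<gamma>_le[of "fst p"] by simp
  finally have "(T x p)\<^sup>2 \<le> 2 * (fst p)\<^sup>2 + 2 * (k\<^sup>2 * (2 * (snd (snd (snd p)))\<^sup>2 + 2 * (C\<^sup>2 * (fst p)\<^sup>2)))"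
    by (simp add: mult_left_mono)
  also have "\<dots> = (2 + 4 * k\<^sup>2 * C\<^sup>2) * (fst p)\<^sup>2 + 4 * k\<^sup>2 * (snd (snd (snd p)))\<^sup>2"
    by (simp add: algebra_simps)
  also have "\<dots> \<le> (2 + 4 * k\<^sup>2 * C\<^sup>2) * (norm p)\<^sup>2 + 4 * k\<^sup>2 * (norm p)\<^sup>2"
    by (intro add_mono mult_left_mono) (auto simp: norm_jet)
  finally show ?thesis by (simp add: algebra_simps)
qed

lemma Z_le: "(norm (Z x p))\<^sup>2 \<le> (4 / \<alpha> + 4 * C\<^sup>2 / \<alpha> + 2 * C) * (norm p)\<^sup>2"
proof -
  let ?a = "fst (snd (snd p)) + fst p *\<^sub>R \<beta> x"
  have "(norm (Z x p))\<^sup>2 \<le> 2 * (norm (msqrt_inv (A x) *v ?a))\<^sup>2 + 2 * (norm (msqrt (A x) *v fst (snd p)))\<^sup>2"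
    unfolding Z_eq using norm_add_power2_le[of "msqrt_inv (A x) *v ?a" "- (msqrt (A x) *v fst (snd p))"] by simp
  also have "\<dots> \<le> 2 * ((norm ?a)\<^sup>2 / \<alpha>) + 2 * (C * (norm (fst (snd p)))\<^sup>2)"
    by (intro add_mono mult_left_mono norm_S_le norm_msqrt_inv[OF A_facts(1) \<alpha>_pos A_facts(2)]) auto
  also have "(norm ?a)\<^sup>2 \<le> 2 * (norm (fst (snd (snd p))))\<^sup>2 + 2 * (C\<^sup>2 * (fst p)\<^sup>2)"
    using norm_add_power2_le[of "fst (snd (snd p))" "fst p *\<^sub>R \<beta> x"] norm_b_le[of "fst p"] by simp
  finally have "(norm (Z x p))\<^sup>2 \<le> 2 * ((2 * (norm (fst (snd (snd p))))\<^sup>2 + 2 * (C\<^sup>2 * (fst p)\<^sup>2)) / \<alpha>)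
      + 2 * (C * (norm (fst (snd p)))\<^sup>2)"
    using \<alpha>_pos by (simp add: divide_right_mono)
  also have "\<dots> = (4 / \<alpha>) * (norm (fst (snd (snd p))))\<^sup>2 + (4 * C\<^sup>2 / \<alpha>) * (fst p)\<^sup>2
      + 2 * C * (norm (fst (snd p)))\<^sup>2"
    by (simp add: algebra_simps add_divide_distrib)
  also have "\<dots> \<le> (4 / \<alpha>) * (norm p)\<^sup>2 + (4 * C\<^sup>2 / \<alpha>) * (norm p)\<^sup>2 + 2 * C * (norm p)\<^sup>2"
    using \<alpha>_pos C_nonneg by (intro add_mono mult_left_mono) (auto simp: norm_jet)
  finally show ?thesis by (simp add: algebra_simps)
qed

text \<open>Two Young inequalities, for \<open>t * u\<close> and for \<open>z\<close> against
  \<open>msqrt (A x) *v g\<close>, each giving away half of a square. In their sum the terms with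
  \<open>\<gamma>\<close> alone cancel, and the remaining products of indefinite sign form exactly
  the two null Lagrangians.\<close>

lemma q_coercive_mod_null:
  "(fst p)\<^sup>2 / 2 + (k * \<alpha> / 2) * (norm (fst (snd p)))\<^sup>2
    \<le> (k / 2) * q x p p + k * (snd (snd (snd p)) * fst p + fst (snd (snd p)) \<bullet> fst (snd p))
      + (k / 2) * (2 * (fst p * (\<beta> x \<bullet> fst (snd p))) + wdiv \<Omega> \<beta> x * (fst p)\<^sup>2)"
proof -
  define u g \<sigma> w where "u = fst p" and "g = fst (snd p)" and "\<sigma> = fst (snd (snd p))" and "w = snd (snd (snd p))"
  define z t where "z = Z x p" and "t = T x p"
  define a where "a = g \<bullet> (A x *v g)"
  have "z \<bullet> (msqrt (A x) *v g) = (msqrt (A x) *v z) \<bullet> g"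
    by (rule symmetric_matrix_selfadjoint[OF msqrt_spd(1)[OF A_facts(1) \<alpha>_pos A_facts(2)]])
  also have "\<dots> = \<sigma> \<bullet> g + u * (\<beta> x \<bullet> g) - a"
    by (simp add: z_def S_Z u_def g_def \<sigma>_def a_def inner_add_left inner_diff_left
        inner_commute[of "A x *v _"])
  finally have zg: "z \<bullet> (msqrt (A x) *v g) = \<sigma> \<bullet> g + u * (\<beta> x \<bullet> g) - a" .
  have "- (((norm z)\<^sup>2 + a) / 2) \<le> z \<bullet> (msqrt (A x) *v g)"
    using abs_inner_le[of z "msqrt (A x) *v g"] unfolding S_simps a_def by linarith
  then have 1: "a / 2 - (norm z)\<^sup>2 / 2 \<le> \<sigma> \<bullet> g + u * (\<beta> x \<bullet> g)" unfolding zg add_divide_distrib by linarith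
  have a: "\<alpha> * (norm g)\<^sup>2 \<le> a" unfolding a_def by (rule A_facts(2))
  \<comment> \<open>Added on the right: its \<open>\<gamma>\<close> part cancels the one produced by
    \<open>t * u\<close>, its divergence part completes the second null Lagrangian.\<close>
  have "0 \<le> (wdiv \<Omega> \<beta> x / 2 + \<gamma> x) * u\<^sup>2"
    using good by (simp add: good_def)
  then have 2: "\<alpha> * (norm g)\<^sup>2 / 2 - (norm z)\<^sup>2 / 2
      \<le> \<sigma> \<bullet> g + u * (\<beta> x \<bullet> g) + (wdiv \<Omega> \<beta> x / 2 + \<gamma> x) * u\<^sup>2"
    using 1 a by linarith
  have 3: "k * (\<alpha> * (norm g)\<^sup>2 / 2 - (norm z)\<^sup>2 / 2)
      \<le> k * (\<sigma> \<bullet> g + u * (\<beta> x \<bullet> g) + (wdiv \<Omega> \<beta> x / 2 + \<gamma> x) * u\<^sup>2)"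
    using 2 k_pos by (intro mult_left_mono) auto
  have 4: "t * u \<le> (t\<^sup>2 + u\<^sup>2) / 2" using sum_squares_bound[of t u] by simp
  have 5: "t * u = u\<^sup>2 + k * (\<gamma> x * u\<^sup>2 - w * u)"
    by (simp add: t_def T_def W_def u_def w_def power2_eq_square algebra_simps)
  have 6: "(k / 2) * q x p p = t\<^sup>2 / 2 + k * (norm z)\<^sup>2 / 2"
    using k_pos by (simp add: q_self t_def z_def field_simps)
  show ?thesis
    unfolding 6 u_def[symmetric] g_def[symmetric] \<sigma>_def[symmetric] w_def[symmetric]
    using 3 4 unfolding 5 by (simp add: algebra_simps)
qed

text \<open>The flux is solved from \<open>msqrt (A x) *v z\<close>, the divergence from
  \<open>t\<close>. The three-term split of the flux gives \<open>3 * C\<close> in front of the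
  square of \<open>z\<close>; \<open>4 / k\<close> turns \<open>t\<^sup>2 / k\<close> into
  \<open>4 * t\<^sup>2 / k\<^sup>2\<close>. In the last constant \<open>5\<close> is 3 from the flux
  plus 2 from the divergence.\<close>

lemma norm_le_q:
  "(norm p)\<^sup>2 \<le> (3 * C + 4 / k) * q x p p + (1 + 5 * C\<^sup>2 + 4 / k\<^sup>2) * ((fst p)\<^sup>2 + (norm (fst (snd p)))\<^sup>2)"
proof -
  define u g \<sigma> w where "u = fst p" and "g = fst (snd p)" and "\<sigma> = fst (snd (snd p))" and "w = snd (snd (snd p))"
  define z t where "z = Z x p" and "t = T x p"
  have s: "(a + b)\<^sup>2 \<le> 2 * a\<^sup>2 + 2 * b\<^sup>2" for a b :: real
    using norm_add_power2_le[of a b] by simp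
  have s3: "(norm (a + b + c))\<^sup>2 \<le> 3 * (norm a)\<^sup>2 + 3 * (norm b)\<^sup>2 + 3 * (norm c)\<^sup>2" for a b c :: "real^'d"
  proof -
    have "0 \<le> (norm (a - b))\<^sup>2 + (norm (a - c))\<^sup>2 + (norm (b - c))\<^sup>2" by simp
    then show ?thesis
      unfolding power2_norm_eq_inner
      by (simp add: inner_add_left inner_add_right inner_diff_left inner_diff_right
          inner_commute[of b a] inner_commute[of c a] inner_commute[of c b])
  qed
  have "\<sigma> = msqrt (A x) *v z + A x *v g + (- u) *\<^sub>R \<beta> x"
    by (simp add: z_def S_Z u_def g_def \<sigma>_def)
  then have "(norm \<sigma>)\<^sup>2 \<le> 3 * (norm (msqrt (A x) *v z))\<^sup>2 + 3 * (norm (A x *v g))\<^sup>2 + 3 * (norm ((- u) *\<^sub>R \<beta> x))\<^sup>2"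
    using s3 by metis
  then have \<sigma>: "(norm \<sigma>)\<^sup>2 \<le> 3 * (C * (norm z)\<^sup>2) + 3 * (C\<^sup>2 * (norm g)\<^sup>2) + 3 * (C\<^sup>2 * u\<^sup>2)"
    using norm_S_le[of z] norm_A_le[of g] norm_b_le[of "- u"] by simp
  have "w = \<gamma> x * u + (u - t) / k"
    using k_pos by (simp add: t_def T_def W_def u_def w_def field_simps)
  then have "w\<^sup>2 \<le> 2 * (\<gamma> x * u)\<^sup>2 + 2 * ((u - t) / k)\<^sup>2" using s by metis
  also have "((u - t) / k)\<^sup>2 \<le> (2 * u\<^sup>2 + 2 * t\<^sup>2) / k\<^sup>2"
    using s[of u "- t"] by (simp add: power_divide divide_right_mono)
  finally have w: "w\<^sup>2 \<le> 2 * (C\<^sup>2 * u\<^sup>2) + 4 * (u\<^sup>2 / k\<^sup>2) + 4 * (t\<^sup>2 / k\<^sup>2)"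
    using \<gamma>_le[of u] by (simp add: add_divide_distrib)
  have q: "q x p p = t\<^sup>2 / k + (norm z)\<^sup>2" by (simp add: q_self t_def z_def)
  have n: "(norm p)\<^sup>2 = u\<^sup>2 + (norm g)\<^sup>2 + (norm \<sigma>)\<^sup>2 + w\<^sup>2"
    by (simp add: norm_jet u_def g_def \<sigma>_def w_def)
  have e: "(3 * C + 4 / k) * (t\<^sup>2 / k + (norm z)\<^sup>2)
      = 3 * (C * (norm z)\<^sup>2) + 4 * (t\<^sup>2 / k\<^sup>2) + (3 * C * t\<^sup>2 / k + 4 * (norm z)\<^sup>2 / k)"
    using k_pos by (simp add: field_simps power2_eq_square)
  have e2: "(1 + 5 * C\<^sup>2 + 4 / k\<^sup>2) * (u\<^sup>2 + (norm g)\<^sup>2) = u\<^sup>2 + 5 * (C\<^sup>2 * u\<^sup>2) + 4 * (u\<^sup>2 / k\<^sup>2)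
      + ((norm g)\<^sup>2 + 5 * (C\<^sup>2 * (norm g)\<^sup>2) + 4 * ((norm g)\<^sup>2 / k\<^sup>2))"
    by (simp add: algebra_simps)
  have "0 \<le> 3 * C * t\<^sup>2 / k + 4 * (norm z)\<^sup>2 / k" using C_nonneg k_pos by simp
  moreover have "0 \<le> C\<^sup>2 * (norm g)\<^sup>2" "0 \<le> (norm g)\<^sup>2 / k\<^sup>2" by simp_all
  ultimately show ?thesis
    unfolding q n e u_def[symmetric] g_def[symmetric] e2 using \<sigma> w by linarith
qed

end

section \<open>Integrability of the residuals\<close>

lemma sq_integrable_T:
  assumes "sq_integrable M G"
  shows "sq_integrable M (\<lambda>x. T x (G x))"
proof (rule sq_integrable_bound)
  note c = sq_integrable_jet_components[OF assms, THEN sq_integrableD(1)]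
  show "(\<lambda>x. T x (G x)) \<in> borel_measurable M"
    unfolding T_def W_def using c \<gamma>_meas by measurable
  show "integrable M (\<lambda>x. (2 + 4 * k\<^sup>2 + 4 * k\<^sup>2 * C\<^sup>2) * (norm (G x))\<^sup>2)"
    using sq_integrableD(2)[OF assms] by simp
  show "AE x in M. (norm (T x (G x)))\<^sup>2 \<le> (2 + 4 * k\<^sup>2 + 4 * k\<^sup>2 * C\<^sup>2) * (norm (G x))\<^sup>2"
    using AE_good by eventually_elim (use T_le in simp)
qed

lemma sq_integrable_W:
  assumes "sq_integrable M G"
  shows "sq_integrable M (\<lambda>x. W x (G x))"
proof -
  have "W x (G x) = (1 / k) *\<^sub>R (T x (G x) - fst (G x))" for x
    using k_pos by (simp add: T_def)
  then show ?thesis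
    by (simp only:) (intro sq_integrable_scaleR sq_integrable_diff sq_integrable_T sq_integrable_jet_components(1) assms)
qed

text \<open>Measurability is transferred from the determinant formula, which agrees almost
  everywhere; domination comes from \<open>Z_le\<close>. Later integrals involve \<open>Z\<close>
  only through this product.\<close>

lemma integrable_Z_inner_Z:
  assumes G: "sq_integrable M G" and H: "sq_integrable M H"
  shows "integrable M (\<lambda>x. Z x (G x) \<bullet> Z x (H x))"
proof -
  let ?K = "4 / \<alpha> + 4 * C\<^sup>2 / \<alpha> + 2 * C"
  let ?a = "\<lambda>x. fst (snd (snd (G x))) + fst (G x) *\<^sub>R \<beta> x" and ?c = "\<lambda>x. fst (snd (snd (H x))) + fst (H x) *\<^sub>R \<beta> x"
  note mG = sq_integrable_jet_components[OF G, THEN sq_integrableD(1)]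
    and mH = sq_integrable_jet_components[OF H, THEN sq_integrableD(1)]
    and mb = sq_integrableD(1)[OF wdiv_Hdiv(1)[OF \<beta>_Hdiv]]
  have ma: "?a \<in> borel_measurable M" and mc: "?c \<in> borel_measurable M"
    by (intro borel_measurable_add borel_measurable_scaleR mG mH mb)+
  have m1: "(\<lambda>x. \<chi> l. det (\<chi> i j. if j = l then ?c x $ i else A x $ i $ j) / det (A x)) \<in> borel_measurable M"
  proof (rule borel_measurable_vec)
    fix l
    have "(\<lambda>x. (\<chi> i j. if j = l then ?c x $ i else A x $ i $ j) $ i $ j) \<in> borel_measurable M" for i j
      using borel_measurable_vec_nth[OF mc, of i] A_meas[of i j] by (cases "j = l") simp_all
    then have "(\<lambda>x. det (\<chi> i j. if j = l then ?c x $ i else A x $ i $ j) / det (A x)) \<in> borel_measurable M"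
      by (intro borel_measurable_divide borel_measurable_det A_meas)
    then show "(\<lambda>x. (\<chi> l. det (\<chi> i j. if j = l then ?c x $ i else A x $ i $ j) / det (A x)) $ l) \<in> borel_measurable M"
      by simp
  qed
  have m2: "(\<lambda>x. A x *v fst (snd (H x))) \<in> borel_measurable M"
    by (rule borel_measurable_vec)
       (simp add: matrix_vector_mult_def, intro borel_measurable_sum borel_measurable_times A_meas borel_measurable_vec_nth mH)
  have "(\<lambda>x. ?a x \<bullet> (\<chi> l. det (\<chi> i j. if j = l then ?c x $ i else A x $ i $ j) / det (A x))
    - fst (snd (H x)) \<bullet> ?a x - fst (snd (G x)) \<bullet> ?c x + fst (snd (G x)) \<bullet> (A x *v fst (snd (H x)))) \<in> borel_measurable M"
    by (intro borel_measurable_add borel_measurable_diff borel_measurable_inner ma mc m1 m2 mG mH)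
  moreover have "AE x in M. ?a x \<bullet> (\<chi> l. det (\<chi> i j. if j = l then ?c x $ i else A x $ i $ j) / det (A x))
    - fst (snd (H x)) \<bullet> ?a x - fst (snd (G x)) \<bullet> ?c x + fst (snd (G x)) \<bullet> (A x *v fst (snd (H x)))
    = Z x (G x) \<bullet> Z x (H x)"
    using AE_good by eventually_elim (simp only: Z_inner_Z)
  ultimately have meas: "(\<lambda>x. Z x (G x) \<bullet> Z x (H x)) \<in> borel_measurable M"
    by (rule borel_measurable_lebesgue_on_AE[OF dom_sets])
  show ?thesis
  proof (rule Bochner_Integration.integrable_bound[OF _ meas])
    show "integrable M (\<lambda>x. ?K * ((norm (G x))\<^sup>2 + (norm (H x))\<^sup>2) / 2)"
      using sq_integrableD(2)[OF G] sq_integrableD(2)[OF H] by simp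
    show "AE x in M. norm (Z x (G x) \<bullet> Z x (H x)) \<le> norm (?K * ((norm (G x))\<^sup>2 + (norm (H x))\<^sup>2) / 2)"
      using AE_good
    proof eventually_elim
      case (elim x)
      have "\<bar>Z x (G x) \<bullet> Z x (H x)\<bar> \<le> ((norm (Z x (G x)))\<^sup>2 + (norm (Z x (H x)))\<^sup>2) / 2"
        by (rule abs_inner_le)
      also have "\<dots> \<le> ?K * ((norm (G x))\<^sup>2 + (norm (H x))\<^sup>2) / 2"
        using Z_le[OF elim, of "G x"] Z_le[OF elim, of "H x"] by (simp add: distrib_left)
      also have "\<dots> \<le> \<bar>?K * ((norm (G x))\<^sup>2 + (norm (H x))\<^sup>2) / 2\<bar>" by (rule abs_ge_self)
      finally show ?case by simp
    qed
  qed
qed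

lemma integrable_q:
  assumes "sq_integrable M G" "sq_integrable M H"
  shows "integrable M (\<lambda>x. q x (G x) (H x))"
  unfolding q_def
  by (intro Bochner_Integration.integrable_add integrable_mult_right integrable_Z_inner_Z integrable_mult_sq
      sq_integrable_T assms)

section \<open>The form as an integral over jets; its bounds from both sides\<close>

abbreviation "BB \<equiv> B' \<Omega> A \<beta> \<gamma> k"

lemma jet_UU: "U \<in> UU \<Omega> \<Longrightarrow> sq_integrable M (jet \<Omega> U)"
  using sq_integrable_jet UU_subset by blast

lemma B_eq:
  assumes "U \<in> UU \<Omega>" "V \<in> UU \<Omega>"
  shows "BB U V = (LINT x|M. q x (jet \<Omega> U x) (jet \<Omega> V x))"
proof -
  note J = jet_UU[OF assms(1)] jet_UU[OF assms(2)]
  have fs: "sq_integrable M (fst U)" "sq_integrable M (fst V)"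
    using jet_components_sq_integrable(1) assms UU_subset by blast+
  note Ws = sq_integrable_W[OF J(1)] sq_integrable_W[OF J(2)]
  have i: "integrable M (\<lambda>x. fst U x * fst V x)" "integrable M (\<lambda>x. fst U x * W x (jet \<Omega> V x))"
    "integrable M (\<lambda>x. W x (jet \<Omega> U x) * fst V x)" "integrable M (\<lambda>x. W x (jet \<Omega> U x) * W x (jet \<Omega> V x))"
    "integrable M (\<lambda>x. Z x (jet \<Omega> U x) \<bullet> Z x (jet \<Omega> V x))"
    by (intro integrable_mult_sq fs Ws integrable_Z_inner_Z J)+
  have "q x (jet \<Omega> U x) (jet \<Omega> V x) = (1 / k) * (fst U x * fst V x) + (fst U x * W x (jet \<Omega> V x)
      + (W x (jet \<Omega> U x) * fst V x + k * (W x (jet \<Omega> U x) * W x (jet \<Omega> V x))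
      + Z x (jet \<Omega> U x) \<bullet> Z x (jet \<Omega> V x)))" for x
    using k_pos by (simp add: q_def T_def jet_def field_simps)
  then show ?thesis
    using i by (simp add: B'_def b'_def bt'_def ip_def vip_def Wop_eq Zop_eq)
qed

lemma B_add:
  assumes "U \<in> UU \<Omega>" "V \<in> UU \<Omega>" "U_add U V \<in> UU \<Omega>" "Y \<in> UU \<Omega>"
  shows "BB (U_add U V) Y = BB U Y + BB V Y"
proof -
  have "(LINT x|M. q x (jet \<Omega> (U_add U V) x) (jet \<Omega> Y x))
      = (LINT x|M. q x (jet \<Omega> U x) (jet \<Omega> Y x) + q x (jet \<Omega> V x) (jet \<Omega> Y x))"
  proof (rule integral_cong_AE)
    show "AE x in M. q x (jet \<Omega> (U_add U V) x) (jet \<Omega> Y x) = q x (jet \<Omega> U x) (jet \<Omega> Y x) + q x (jet \<Omega> V x) (jet \<Omega> Y x)"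
      using jet_add[OF assms(1,2)] by eventually_elim (simp add: q_add)
  qed (intro borel_measurable_integrable Bochner_Integration.integrable_add integrable_q jet_UU assms)+
  also have "\<dots> = BB U Y + BB V Y"
    unfolding B_eq[OF assms(1,4)] B_eq[OF assms(2,4)]
    by (intro Bochner_Integration.integral_add integrable_q jet_UU assms)
  finally show ?thesis by (simp add: B_eq assms)
qed

lemma B_scale:
  assumes "U \<in> UU \<Omega>" "U_scale c U \<in> UU \<Omega>" "Y \<in> UU \<Omega>"
  shows "BB (U_scale c U) Y = c * BB U Y"
proof -
  have "(LINT x|M. q x (jet \<Omega> (U_scale c U) x) (jet \<Omega> Y x)) = (LINT x|M. c * q x (jet \<Omega> U x) (jet \<Omega> Y x))"
  proof (rule integral_cong_AE)
    show "AE x in M. q x (jet \<Omega> (U_scale c U) x) (jet \<Omega> Y x) = c * q x (jet \<Omega> U x) (jet \<Omega> Y x)"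
      using jet_scale[OF assms(1), of c] by eventually_elim (simp add: q_scale)
  qed (intro borel_measurable_integrable integrable_mult_right integrable_q jet_UU assms)+
  then show ?thesis by (simp add: B_eq assms)
qed

lemma B_sym: "U \<in> UU \<Omega> \<Longrightarrow> V \<in> UU \<Omega> \<Longrightarrow> BB U V = BB V U"
  using q_sym by (simp add: B_eq)

lemma q_nonneg: "0 \<le> q x p p"
  using k_pos by (simp add: q_self)

lemma B_nonneg: "U \<in> UU \<Omega> \<Longrightarrow> 0 \<le> BB U U"
  by (simp add: B_eq q_nonneg)

text \<open>Carries convergence in the norm of \<open>U\<close> over to the form, in terms of which
  the Riesz theorem states completeness.\<close>

lemma B_bounded: "\<exists>K\<ge>0. \<forall>U\<in>UU \<Omega>. BB U U \<le> K * U_norm2 \<Omega> U"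
proof -
  define K where "K = (2 + 4 * k\<^sup>2 + 4 * k\<^sup>2 * C\<^sup>2) / k + (4 / \<alpha> + 4 * C\<^sup>2 / \<alpha> + 2 * C)"
  have "K \<ge> 0" using k_pos \<alpha>_pos C_nonneg by (simp add: K_def)
  moreover have "BB U U \<le> K * U_norm2 \<Omega> U" if "U \<in> UU \<Omega>" for U
  proof -
    note J = jet_UU[OF that]
    have "BB U U \<le> (LINT x|M. K * (norm (jet \<Omega> U x))\<^sup>2)"
      unfolding B_eq[OF that that]
    proof (rule integral_mono_AE[OF integrable_q[OF J J]])
      show "integrable M (\<lambda>x. K * (norm (jet \<Omega> U x))\<^sup>2)" using sq_integrableD(2)[OF J] by simp
      show "AE x in M. q x (jet \<Omega> U x) (jet \<Omega> U x) \<le> K * (norm (jet \<Omega> U x))\<^sup>2"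
        using AE_good
      proof eventually_elim
        case (elim x)
        have "(T x (jet \<Omega> U x))\<^sup>2 / k \<le> (2 + 4 * k\<^sup>2 + 4 * k\<^sup>2 * C\<^sup>2) * (norm (jet \<Omega> U x))\<^sup>2 / k"
          using k_pos T_le[OF elim] by (intro divide_right_mono) auto
        with Z_le[OF elim, of "jet \<Omega> U x"] show ?case
          by (simp add: q_self K_def distrib_right)
      qed
    qed
    then show ?thesis using that UU_subset by (auto simp: U_norm2_eq)
  qed
  ultimately show ?thesis by blast
qed

text \<open>Integrating the pointwise inequality removes the null Lagrangians and bounds
  \<open>E0\<close>, the part of the norm from \<open>u\<close> and its gradient;
  \<open>norm_le_q\<close> then recovers the rest.\<close>

lemma B_coercive: "\<exists>K\<ge>0. \<forall>U\<in>UU \<Omega>. U_norm2 \<Omega> U \<le> K * BB U U"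
proof -
  \<comment> \<open>The smaller of the two coefficients on the left of
    \<open>q_coercive_mod_null\<close>.\<close>
  define c0 where "c0 = min (1/2) (k * \<alpha> / 2)"
  define K1 K2 where "K1 = 3 * C + 4 / k" and "K2 = 1 + 5 * C\<^sup>2 + 4 / k\<^sup>2"
  have c0: "c0 > 0" using k_pos \<alpha>_pos by (simp add: c0_def)
  have K12: "K1 \<ge> 0" "K2 \<ge> 0" using k_pos C_nonneg by (simp_all add: K1_def K2_def)
  have "U_norm2 \<Omega> U \<le> (K1 + K2 * (k / 2) / c0) * BB U U" if U: "U \<in> UU \<Omega>" for U
  proof -
    note J = jet_UU[OF U]
    have U': "U \<in> H1 \<Omega> \<times> Hdiv \<Omega>" using U UU_subset by blast
    have uv: "fst U \<in> H10 \<Omega>" "snd U \<in> Hdiv \<Omega>" using U by (auto simp: UU_def)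
    note c = jet_components_sq_integrable[OF U']
    let ?u = "fst U" and ?g = "wgrad \<Omega> (fst U)" and ?s = "snd U" and ?w = "wdiv \<Omega> (snd U)"
    define E0 where "E0 x = (?u x)\<^sup>2 + (norm (?g x))\<^sup>2" for x
    have iE0: "integrable M E0"
      unfolding E0_def[abs_def] using sq_integrableD(2)[OF c(1)] sq_integrableD(2)[OF c(2)] by simp
    have i1: "integrable M (\<lambda>x. ?w x * ?u x)" "integrable M (\<lambda>x. ?s x \<bullet> ?g x)"
      by (intro integrable_mult_sq integrable_inner_sq c)+
    have iu2: "integrable M (\<lambda>x. (?u x)\<^sup>2)" using sq_integrableD(2)[OF c(1)] by simp
    have i2: "integrable M (\<lambda>x. wdiv \<Omega> \<beta> x * (?u x)\<^sup>2)"
    proof (rule Bochner_Integration.integrable_bound[where f = "\<lambda>x. C * (?u x)\<^sup>2"])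
      show "integrable M (\<lambda>x. C * (?u x)\<^sup>2)" using iu2 by simp
      show "(\<lambda>x. wdiv \<Omega> \<beta> x * (?u x)\<^sup>2) \<in> borel_measurable M"
        by (intro borel_measurable_times borel_measurable_power sq_integrableD(1) c wdiv_Hdiv \<beta>_Hdiv)
      show "AE x in M. norm (wdiv \<Omega> \<beta> x * (?u x)\<^sup>2) \<le> norm (C * (?u x)\<^sup>2)"
        using div\<beta>_bounded by eventually_elim (simp add: abs_mult mult_right_mono C_nonneg)
    qed
    have "sq_integrable M (\<lambda>x. ?u x *\<^sub>R \<beta> x)"
    proof (rule sq_integrable_bound[where g = "\<lambda>x. C\<^sup>2 * (?u x)\<^sup>2"])
      show "(\<lambda>x. ?u x *\<^sub>R \<beta> x) \<in> borel_measurable M"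
        by (intro borel_measurable_scaleR sq_integrableD(1) c wdiv_Hdiv \<beta>_Hdiv)
      show "AE x in M. (norm (?u x *\<^sub>R \<beta> x))\<^sup>2 \<le> C\<^sup>2 * (?u x)\<^sup>2"
        using AE_good by eventually_elim (rule norm_b_le)
    qed (use iu2 in simp)
    from integrable_inner_sq[OF this c(2)] have i3: "integrable M (\<lambda>x. ?u x * (\<beta> x \<bullet> ?g x))" by simp
    have n1: "(LINT x|M. ?w x * ?u x + ?s x \<bullet> ?g x) = 0"
      using i1 integration_by_parts[OF uv] by simp
    have n2: "(LINT x|M. 2 * (?u x * (\<beta> x \<bullet> ?g x)) + wdiv \<Omega> \<beta> x * (?u x)\<^sup>2) = 0"
      using i2 i3 integration_by_parts_square[OF uv(1) \<beta>_Hdiv \<beta>_bounded div\<beta>_bounded] by simp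
    have "c0 * (LINT x|M. E0 x) = (LINT x|M. c0 * E0 x)" by simp
    also have "\<dots> \<le> (LINT x|M. (k / 2) * q x (jet \<Omega> U x) (jet \<Omega> U x) + k * (?w x * ?u x + ?s x \<bullet> ?g x)
      + (k / 2) * (2 * (?u x * (\<beta> x \<bullet> ?g x)) + wdiv \<Omega> \<beta> x * (?u x)\<^sup>2))"
    proof (rule integral_mono_AE)
      show "AE x in M. c0 * E0 x \<le> (k / 2) * q x (jet \<Omega> U x) (jet \<Omega> U x) + k * (?w x * ?u x + ?s x \<bullet> ?g x)
        + (k / 2) * (2 * (?u x * (\<beta> x \<bullet> ?g x)) + wdiv \<Omega> \<beta> x * (?u x)\<^sup>2)"
        using AE_good
      proof eventually_elim
        case (elim x)
        have "c0 * E0 x \<le> (?u x)\<^sup>2 / 2 + (k * \<alpha> / 2) * (norm (?g x))\<^sup>2"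
        proof -
          have "c0 * (?u x)\<^sup>2 \<le> (1/2) * (?u x)\<^sup>2" "c0 * (norm (?g x))\<^sup>2 \<le> (k * \<alpha> / 2) * (norm (?g x))\<^sup>2"
            by (intro mult_right_mono; simp add: c0_def)+
          then show ?thesis by (simp add: E0_def distrib_left)
        qed
        also note q_coercive_mod_null[OF elim, of "jet \<Omega> U x", unfolded jet_sel]
        finally show ?case .
      qed
    qed (use iE0 integrable_q[OF J J] i1 i2 i3 in auto)
    also have "\<dots> = (k / 2) * BB U U"
      using integrable_q[OF J J] i1 i2 i3 n1 n2 by (simp add: B_eq U)
    finally have E0: "(LINT x|M. E0 x) \<le> (k / 2) * BB U U / c0" using c0 by (simp add: field_simps)
    have "U_norm2 \<Omega> U = (LINT x|M. (norm (jet \<Omega> U x))\<^sup>2)" by (rule U_norm2_eq[OF U'])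
    also have "\<dots> \<le> (LINT x|M. K1 * q x (jet \<Omega> U x) (jet \<Omega> U x) + K2 * E0 x)"
    proof (rule integral_mono_AE)
      show "AE x in M. (norm (jet \<Omega> U x))\<^sup>2 \<le> K1 * q x (jet \<Omega> U x) (jet \<Omega> U x) + K2 * E0 x"
        using AE_good
      proof eventually_elim
        case (elim x)
        from norm_le_q[OF elim, of "jet \<Omega> U x"] show ?case
          by (simp only: K1_def K2_def E0_def jet_sel)
      qed
    qed (use iE0 integrable_q[OF J J] sq_integrableD(2)[OF J] in auto)
    also have "\<dots> = K1 * BB U U + K2 * (LINT x|M. E0 x)"
      using iE0 integrable_q[OF J J] by (simp add: B_eq U)
    also have "\<dots> \<le> K1 * BB U U + K2 * ((k / 2) * BB U U / c0)"
      using E0 K12 by (intro add_mono mult_left_mono) auto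
    finally show ?thesis by (simp add: algebra_simps)
  qed
  moreover have "K1 + K2 * (k / 2) / c0 \<ge> 0" using K12 c0 k_pos by simp
  ultimately show ?thesis by blast
qed

end

section \<open>Well-posedness of the scheme\<close>

context least_squares
begin

text \<open>The data are paired with the same \<open>T\<close> that occurs in the form, so
  \<open>F'\<close> is bounded by the first square of \<open>BB\<close> alone.\<close>

lemma F_eq: "F' \<Omega> \<gamma> k V g w = (LINT x|M. (g x + w x / k) * T x (jet \<Omega> V x))"
  by (simp add: F'_def ip_def Wop_eq T_def) (simp add: jet_def)

theorem step_well_posed:
  assumes S: "closed_subspace_U \<Omega> S" and g: "L2 \<Omega> g" and w: "L2 \<Omega> w"
  shows "\<exists>u\<in>S. (\<forall>v\<in>S. BB u v = F' \<Omega> \<gamma> k v g w)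
    \<and> (\<forall>u'\<in>S. (\<forall>v\<in>S. BB u' v = F' \<Omega> \<gamma> k v g w) \<longrightarrow> ae_eq \<Omega> u' u)"
proof -
  have SU: "U \<in> UU \<Omega>" if "U \<in> S" for U using S that by (auto simp: closed_subspace_U_def)
  have S_add: "U_add U V \<in> S" if "U \<in> S" "V \<in> S" for U V using S that by (simp add: closed_subspace_U_def)
  have S_scale: "U_scale c U \<in> S" if "U \<in> S" for c U using S that by (simp add: closed_subspace_U_def)
  have S_diff: "U_diff U V \<in> S" if "U \<in> S" "V \<in> S" for U V
    unfolding U_diff_eq by (intro S_add S_scale that)
  interpret form: semi_inner S U_add U_scale BB
    by unfold_locales (use SU S_add S_scale B_add B_scale B_sym B_nonneg in auto)
  define r where "r x = g x + (1 / k) *\<^sub>R w x" for x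
  have r: "sq_integrable M r"
    unfolding r_def[abs_def] using g w
    by (intro sq_integrable_add sq_integrable_scaleR) (simp_all add: L2_iff_sq_integrable)
  define F where "F V = F' \<Omega> \<gamma> k V g w" for V
  have F: "F V = (LINT x|M. r x * T x (jet \<Omega> V x))" for V
    unfolding F_def F_eq r_def by simp
  have iT: "integrable M (\<lambda>x. r x * T x (jet \<Omega> V x))" if "V \<in> S" for V
    by (intro integrable_mult_sq r sq_integrable_T jet_UU SU that)
  obtain K where K: "K \<ge> 0" "\<And>U. U \<in> UU \<Omega> \<Longrightarrow> U_norm2 \<Omega> U \<le> K * BB U U"
    using B_coercive by blast
  obtain L where L: "L \<ge> 0" "\<And>U. U \<in> UU \<Omega> \<Longrightarrow> BB U U \<le> L * U_norm2 \<Omega> U"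
    using B_bounded by blast
  have "\<exists>u\<in>S. \<forall>v\<in>S. BB u v = F v"
  \<comment> \<open>The constant comes from completing the square,
    \<open>0 \<le> (t - k * r)\<^sup>2 / k\<close>.\<close>
  proof (rule form.Riesz_representation[where C = "k * (LINT x|M. (r x)\<^sup>2)"])
    show "S \<noteq> {}" using S by (auto simp: closed_subspace_U_def)
    show "F (U_add U V) = F U + F V" if "U \<in> S" "V \<in> S" for U V
    proof -
      have "F (U_add U V) = (LINT x|M. r x * T x (jet \<Omega> U x) + r x * T x (jet \<Omega> V x))"
        unfolding F
      proof (rule integral_cong_AE)
        show "AE x in M. r x * T x (jet \<Omega> (U_add U V) x) = r x * T x (jet \<Omega> U x) + r x * T x (jet \<Omega> V x)"
          using jet_add[OF SU[OF that(1)] SU[OF that(2)]] by eventually_elim (simp add: T_add distrib_left)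
      qed (intro borel_measurable_integrable Bochner_Integration.integrable_add iT S_add that)+
      then show ?thesis using iT that by (simp add: F)
    qed
    show "F (U_scale c U) = c * F U" if "U \<in> S" for c U
    proof -
      have "F (U_scale c U) = (LINT x|M. c * (r x * T x (jet \<Omega> U x)))"
        unfolding F
      proof (rule integral_cong_AE)
        show "AE x in M. r x * T x (jet \<Omega> (U_scale c U) x) = c * (r x * T x (jet \<Omega> U x))"
          using jet_scale[OF SU[OF that], of c] by eventually_elim (simp add: T_scale)
      qed (intro borel_measurable_integrable integrable_mult_right iT S_scale that)+
      then show ?thesis by (simp add: F)
    qed
    show "2 * F V \<le> BB V V + k * (LINT x|M. (r x)\<^sup>2)" if "V \<in> S" for V
    proof -
      note J = jet_UU[OF SU[OF that]]
      have ir: "integrable M (\<lambda>x. (r x)\<^sup>2)" using sq_integrableD(2)[OF r] by simp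
      have "2 * F V = (LINT x|M. 2 * (r x * T x (jet \<Omega> V x)))" by (simp add: F)
      also have "\<dots> \<le> (LINT x|M. q x (jet \<Omega> V x) (jet \<Omega> V x) + k * (r x)\<^sup>2)"
      proof (rule integral_mono)
        fix x
        define t where "t = T x (jet \<Omega> V x)"
        have "0 \<le> (t - k * r x)\<^sup>2 / k" using k_pos by simp
        also have "\<dots> = t\<^sup>2 / k + k * (r x)\<^sup>2 - 2 * (r x * t)"
          using k_pos by (simp add: field_simps power2_eq_square)
        finally show "2 * (r x * T x (jet \<Omega> V x)) \<le> q x (jet \<Omega> V x) (jet \<Omega> V x) + k * (r x)\<^sup>2"
          unfolding q_self t_def[symmetric] using zero_le_power2[of "norm (Z x (jet \<Omega> V x))"] by linarith
      qed (use iT[OF that] ir integrable_q[OF J J] in auto)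
      also have "\<dots> = BB V V + k * (LINT x|M. (r x)\<^sup>2)"
        using ir integrable_q[OF J J] by (simp add: B_eq SU[OF that])
      finally show ?thesis .
    qed
  next
    fix X :: "nat \<Rightarrow> _" assume X: "\<And>j. X j \<in> S"
      and Cauchy: "\<And>e. e > 0 \<Longrightarrow> \<exists>m. \<forall>i\<ge>m. \<forall>j\<ge>m. BB (form.sub (X i) (X j)) (form.sub (X i) (X j)) < e"
    have "\<exists>m. \<forall>i\<ge>m. \<forall>j\<ge>m. (LINT x|M. (norm (jet \<Omega> (X i) x - jet \<Omega> (X j) x))\<^sup>2) < e" if "e > 0" for e
    proof -
      \<comment> \<open>\<open>K + 1\<close> instead of \<open>K\<close>, because only
        \<open>K \<ge> 0\<close> is known.\<close>
      have "e / (K + 1) > 0" using \<open>e > 0\<close> K(1) by simp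
      from Cauchy[OF this] obtain m
        where m: "\<And>i j. i \<ge> m \<Longrightarrow> j \<ge> m \<Longrightarrow> BB (U_diff (X i) (X j)) (U_diff (X i) (X j)) < e / (K + 1)"
        unfolding U_diff_eq by blast
      have "(LINT x|M. (norm (jet \<Omega> (X i) x - jet \<Omega> (X j) x))\<^sup>2) < e" if "i \<ge> m" "j \<ge> m" for i j
      proof -
        let ?D = "U_diff (X i) (X j)"
        have D: "?D \<in> UU \<Omega>" by (intro SU S_diff X)
        have "U_norm2 \<Omega> ?D \<le> K * BB ?D ?D" by (rule K(2)[OF D])
        also have "\<dots> \<le> (K + 1) * BB ?D ?D" using B_nonneg[OF D] by (simp add: distrib_right)
        also have "\<dots> < (K + 1) * (e / (K + 1))" using m[OF that] K(1) by (intro mult_strict_left_mono) auto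
        also have "\<dots> = e" using K(1) by simp
        finally show ?thesis using U_norm2_diff[OF SU[OF X] SU[OF X], of i j] by simp
      qed
      then show ?thesis by blast
    qed
    from UU_complete[of X, OF SU[OF X] this] obtain V where V: "V \<in> UU \<Omega>"
      and lim: "(\<lambda>j. LINT x|M. (norm (jet \<Omega> (X j) x - jet \<Omega> V x))\<^sup>2) \<longlonglongrightarrow> 0"
      by blast
    have lim': "(\<lambda>j. U_norm2 \<Omega> (U_diff (X j) V)) \<longlonglongrightarrow> 0"
      unfolding U_norm2_diff[OF SU[OF X] V] by (rule lim)
    with S X V have VS: "V \<in> S" unfolding closed_subspace_U_def by blast
    have "(\<lambda>j. BB (U_diff (X j) V) (U_diff (X j) V)) \<longlonglongrightarrow> 0"
    proof (rule tendsto_sandwich[OF always_eventually always_eventually tendsto_const tendsto_mult_right_zero[OF lim']])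
      show "\<forall>j. 0 \<le> BB (U_diff (X j) V) (U_diff (X j) V)"
        by (intro allI B_nonneg SU S_diff X VS)
      show "\<forall>j. BB (U_diff (X j) V) (U_diff (X j) V) \<le> L * U_norm2 \<Omega> (U_diff (X j) V)"
        by (intro allI L(2) SU S_diff X VS)
    qed
    then show "\<exists>V\<in>S. (\<lambda>j. BB (form.sub (X j) V) (form.sub (X j) V)) \<longlonglongrightarrow> 0"
      using VS unfolding U_diff_eq by blast
  qed
  then obtain u where u: "u \<in> S" "\<And>v. v \<in> S \<Longrightarrow> BB u v = F v" by blast
  have "ae_eq \<Omega> u' u" if u': "u' \<in> S" "\<And>v. v \<in> S \<Longrightarrow> BB u' v = F v" for u'
  proof -
    let ?D = "U_diff u' u"
    have D: "?D \<in> S" using u u' by (intro S_diff)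
    \<comment> \<open>The difference of two solutions is an admissible test element; coercivity
      makes its jet vanish almost everywhere.\<close>
    have "BB ?D ?D = BB u' ?D - BB u ?D"
      using u(1) u'(1) D unfolding U_diff_eq[of u' u] by (simp add: form.B_add form.B_scale S_scale)
    then have "BB ?D ?D = 0" using u(2)[OF D] u'(2)[OF D] by simp
    with K(2)[OF SU[OF D]] have "U_norm2 \<Omega> ?D \<le> 0" by simp
    then have "(LINT x|M. (norm (jet \<Omega> u' x - jet \<Omega> u x))\<^sup>2) \<le> 0"
      by (simp add: U_norm2_diff SU u u')
    then have "(LINT x|M. (norm (jet \<Omega> u' x - jet \<Omega> u x))\<^sup>2) = 0"
      by (simp add: order_antisym)
    moreover have "integrable M (\<lambda>x. (norm (jet \<Omega> u' x - jet \<Omega> u x))\<^sup>2)"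
      by (intro sq_integrableD(2) sq_integrable_diff jet_UU SU u u')
    ultimately have "AE x in M. (norm (jet \<Omega> u' x - jet \<Omega> u x))\<^sup>2 = 0"
      by (simp add: integral_nonneg_eq_0_iff_AE)
    then show ?thesis
      unfolding ae_eq_def by eventually_elim (simp add: jet_def zero_prod_def)
  qed
  then show ?thesis using u unfolding F_def by blast
qed

end

section \<open>From the coefficient hypotheses to uniform constants\<close>

lemma AE_quadratic_form_bounded:
  fixes A :: "real^'d \<Rightarrow> real^'d^'d"
  assumes "\<And>i j. Linf \<Omega> (\<lambda>x. A x $ i $ j)"
  shows "\<exists>C. AE x in lebesgue_on \<Omega>. \<forall>\<xi>. \<xi> \<bullet> (A x *v \<xi>) \<le> C * (norm \<xi>)\<^sup>2"
proof -
  have "\<exists>C. \<forall>i j. AE x in lebesgue_on \<Omega>. \<bar>A x $ i $ j\<bar> \<le> C i j"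
    using assms unfolding Linf_def by metis
  then obtain c where c: "\<And>i j. AE x in lebesgue_on \<Omega>. \<bar>A x $ i $ j\<bar> \<le> c i j" by blast
  then have "AE x in lebesgue_on \<Omega>. \<forall>i j. \<bar>A x $ i $ j\<bar> \<le> c i j" by (simp add: AE_all_countable)
  then have "AE x in lebesgue_on \<Omega>. \<forall>\<xi>. \<xi> \<bullet> (A x *v \<xi>) \<le> (\<Sum>i\<in>UNIV. \<Sum>j\<in>UNIV. c i j) * (norm \<xi>)\<^sup>2"
  proof eventually_elim
    case (elim x)
    show ?case
    proof
      fix \<xi> :: "real^'d"
      have "\<xi> \<bullet> (A x *v \<xi>) = (\<Sum>i\<in>UNIV. \<Sum>j\<in>UNIV. \<xi> $ i * (A x $ i $ j * \<xi> $ j))"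
        by (simp add: inner_vec_def matrix_vector_mult_def sum_distrib_left)
      also have "\<dots> \<le> (\<Sum>i\<in>UNIV. \<Sum>j\<in>UNIV. c i j * (norm \<xi>)\<^sup>2)"
      proof (intro sum_mono)
        fix i j
        have "\<xi> $ i * (A x $ i $ j * \<xi> $ j) \<le> \<bar>A x $ i $ j\<bar> * (\<bar>\<xi> $ i\<bar> * \<bar>\<xi> $ j\<bar>)"
          using abs_ge_self[of "\<xi> $ i * (A x $ i $ j * \<xi> $ j)"] by (simp add: abs_mult mult_ac)
        also have "\<dots> \<le> c i j * (norm \<xi> * norm \<xi>)"
        proof (rule mult_mono)
          show "0 \<le> c i j" using elim[rule_format, of i j] by linarith
        qed (use elim in \<open>auto intro!: mult_mono simp: component_le_norm_cart\<close>)
        finally show "\<xi> $ i * (A x $ i $ j * \<xi> $ j) \<le> c i j * (norm \<xi>)\<^sup>2"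
          by (simp add: power2_eq_square)
      qed
      also have "\<dots> = (\<Sum>i\<in>UNIV. \<Sum>j\<in>UNIV. c i j) * (norm \<xi>)\<^sup>2"
        by (simp add: sum_distrib_right)
      finally show "\<xi> \<bullet> (A x *v \<xi>) \<le> (\<Sum>i\<in>UNIV. \<Sum>j\<in>UNIV. c i j) * (norm \<xi>)\<^sup>2" .
    qed
  qed
  then show ?thesis by blast
qed

lemma AE_norm_bounded:
  fixes \<beta> :: "real^'d \<Rightarrow> real^'d"
  assumes "\<And>i. Linf \<Omega> (\<lambda>x. \<beta> x $ i)"
  shows "\<exists>C. AE x in lebesgue_on \<Omega>. norm (\<beta> x) \<le> C"
proof -
  have "\<exists>C. \<forall>i. AE x in lebesgue_on \<Omega>. \<bar>\<beta> x $ i\<bar> \<le> C i"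
    using assms unfolding Linf_def by metis
  then obtain c where "\<And>i. AE x in lebesgue_on \<Omega>. \<bar>\<beta> x $ i\<bar> \<le> c i" by blast
  then have "AE x in lebesgue_on \<Omega>. \<forall>i. \<bar>\<beta> x $ i\<bar> \<le> c i" by (simp add: AE_all_countable)
  then have "AE x in lebesgue_on \<Omega>. norm (\<beta> x) \<le> (\<Sum>i\<in>UNIV. c i)"
    by eventually_elim (rule order_trans[OF norm_le_l1_cart], rule sum_mono, simp)
  then show ?thesis by blast
qed

text \<open>\<open>\<alpha>\<close> and \<open>C\<close> are chosen before \<open>k\<close>, so one
  choice serves every time step.\<close>

lemma least_squares_if_coeff_assms:
  assumes "open \<Omega>" "bounded \<Omega>" and coeff: "coeff_assms \<Omega> \<T> A \<beta> \<gamma>"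
  shows "\<exists>\<alpha> C. \<forall>k>0. least_squares \<Omega> A \<beta> \<gamma> \<alpha> C k"
proof -
  let ?M = "lebesgue_on \<Omega>"
  note c = coeff[unfolded coeff_assms_def]
  obtain \<alpha> where \<alpha>: "\<alpha> > 0" "AE x in ?M. \<alpha> \<le> lambda_min (A x)" using c by blast
  obtain C1 where C1: "AE x in ?M. \<forall>\<xi>. \<xi> \<bullet> (A x *v \<xi>) \<le> C1 * (norm \<xi>)\<^sup>2"
    using AE_quadratic_form_bounded[of \<Omega> A] c by blast
  obtain C2 where C2: "AE x in ?M. norm (\<beta> x) \<le> C2"
    using AE_norm_bounded[of \<Omega> \<beta>] c by blast
  obtain C3 where C3: "AE x in ?M. \<bar>\<gamma> x\<bar> \<le> C3" using c unfolding Linf_def by blast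
  obtain C4 where C4: "AE x in ?M. \<bar>wdiv \<Omega> \<beta> x / 2 + \<gamma> x\<bar> \<le> C4" using c unfolding Linf_def by blast
  \<comment> \<open>The factors 2 come from \<open>div \<beta> = 2 * (div \<beta> / 2 + \<gamma>) -
    2 * \<gamma>\<close>; the absolute values give \<open>C \<ge> 0\<close>.\<close>
  define C where "C = \<bar>C1\<bar> + \<bar>C2\<bar> + 2 * \<bar>C3\<bar> + 2 * \<bar>C4\<bar>"
  have "least_squares \<Omega> A \<beta> \<gamma> \<alpha> C k" if "k > 0" for k
  proof unfold_locales
    have sym: "AE x in ?M. transpose (A x) = A x" using c by blast
    show "AE x in ?M. \<forall>\<xi>. \<alpha> * (norm \<xi>)\<^sup>2 \<le> \<xi> \<bullet> (A x *v \<xi>)"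
      using sym \<alpha>(2)
    proof eventually_elim
      case (elim x)
      then show ?case
        using lambda_min_le_Rayleigh[OF elim(1)] mult_right_mono[OF elim(2) zero_le_power2] order_trans by blast
    qed
    show "AE x in ?M. \<forall>\<xi>. \<xi> \<bullet> (A x *v \<xi>) \<le> C * (norm \<xi>)\<^sup>2"
      using C1
    proof eventually_elim
      case (elim x)
      have "C1 \<le> C" by (simp add: C_def)
      then show ?case using elim mult_right_mono[OF _ zero_le_power2] order_trans by blast
    qed
    show "AE x in ?M. norm (\<beta> x) \<le> C" using C2 by eventually_elim (simp add: C_def)
    show "AE x in ?M. \<bar>\<gamma> x\<bar> \<le> C" using C3 by eventually_elim (simp add: C_def)
    show "AE x in ?M. \<bar>wdiv \<Omega> \<beta> x\<bar> \<le> C"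
      using C3 C4 by eventually_elim (unfold C_def, linarith)
  qed (use assms(1,2) c \<alpha>(1) that in \<open>auto simp: C_def Linf_def\<close>)
  then show ?thesis by blast
qed

theorem theorem4p1:
  fixes \<Omega> :: "(real^'d) set"
    and \<T> :: "(real^'d) set set"
    and A :: "real^'d \<Rightarrow> real^'d^'d" and \<beta> :: "real^'d \<Rightarrow> real^'d" and \<gamma> :: "real^'d \<Rightarrow> real"
    and N :: nat and t :: "nat \<Rightarrow> real" and T :: real
    and f :: "nat \<Rightarrow> real^'d \<Rightarrow> real" and u0 :: "real^'d \<Rightarrow> real"
    and Uh :: "nat \<Rightarrow> ((real^'d \<Rightarrow> real) \<times> (real^'d \<Rightarrow> real^'d)) set"
  assumes dom: "bounded \<Omega>" "lipschitz_domain \<Omega>" "polygonal_boundary \<Omega>"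
    and mesh: "simplicial_mesh \<T> \<Omega>"
    and coeff: "coeff_assms \<Omega> \<T> A \<beta> \<gamma>"
    and t0: "t 0 = 0" and tN: "t N = T"
    and tmono: "\<And>n. n < N \<Longrightarrow> t n < t (Suc n)"
    and fL2: "\<And>n. n \<in> {1..N} \<Longrightarrow> L2 \<Omega> (f n)"
    and u0L2: "L2 \<Omega> u0"
    and Uh: "\<And>n. n \<in> {1..N} \<Longrightarrow> closed_subspace_U \<Omega> (Uh n)"
  shows "\<exists>sol :: nat \<Rightarrow> ((real^'d \<Rightarrow> real) \<times> (real^'d \<Rightarrow> real^'d)).
           \<forall>n \<in> {1..N}.
             (let k = t n - t (n - 1);
                  prev = (if n = 1 then u0 else fst (sol (n - 1)))
              in sol n \<in> Uh n
                 \<and> (\<forall>v \<in> Uh n. B' \<Omega> A \<beta> \<gamma> k (sol n) v = F' \<Omega> \<gamma> k v (f n) prev)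
                 \<and> (\<forall>w \<in> Uh n. (\<forall>v \<in> Uh n. B' \<Omega> A \<beta> \<gamma> k w v = F' \<Omega> \<gamma> k v (f n) prev)
                        \<longrightarrow> ae_eq \<Omega> w (sol n)))"
proof -
  have "open \<Omega>" using dom(2) by (simp add: lipschitz_domain_def)
  then obtain \<alpha> C where LS: "\<And>k. k > 0 \<Longrightarrow> least_squares \<Omega> A \<beta> \<gamma> \<alpha> C k"
    using least_squares_if_coeff_assms[OF _ dom(1) coeff] by blast
  \<comment> \<open>Uniqueness is part of the predicate, so the element later picked by
    \<open>SOME\<close> carries it along.\<close>
  define solves where "solves n prev u \<longleftrightarrow> u \<in> Uh n
      \<and> (\<forall>v \<in> Uh n. B' \<Omega> A \<beta> \<gamma> (t n - t (n - 1)) u v = F' \<Omega> \<gamma> (t n - t (n - 1)) v (f n) prev)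
      \<and> (\<forall>w \<in> Uh n. (\<forall>v \<in> Uh n. B' \<Omega> A \<beta> \<gamma> (t n - t (n - 1)) w v = F' \<Omega> \<gamma> (t n - t (n - 1)) v (f n) prev)
            \<longrightarrow> ae_eq \<Omega> w u)" for n prev u
  have step: "\<exists>u. solves n prev u" if n: "n \<in> {1..N}" and prev: "L2 \<Omega> prev" for n prev
  proof -
    have "t n - t (n - 1) > 0" using tmono[of "n - 1"] n by (cases n) auto
    from least_squares.step_well_posed[OF LS[OF this] Uh[OF n] fL2[OF n] prev]
    show ?thesis unfolding solves_def by blast
  qed
  have L2_sol: "L2 \<Omega> (fst u)" if "n \<in> {1..N}" "solves n prev u" for n prev u
  proof -
    have "u \<in> UU \<Omega>" using Uh[OF that(1)] that(2) unfolding solves_def closed_subspace_U_def by blast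
    then show ?thesis by (auto simp: UU_def H10_def H1_def)
  qed
  \<comment> \<open>The flux of the initial value is a dummy: only its first component enters the scheme.\<close>
  define sol where "sol = rec_nat (u0, \<lambda>_. 0) (\<lambda>n s. SOME u. solves (Suc n) (fst s) u)"
  \<comment> \<open>Solvability of the next step presupposes a square-integrable previous value, and
    this in turn holds because the previous solution lies in \<open>U\<close>.\<close>
  have L2: "n \<le> N \<Longrightarrow> L2 \<Omega> (fst (sol n))"
    and solves: "n < N \<Longrightarrow> solves (Suc n) (fst (sol n)) (sol (Suc n))" for n
  proof -
    have s: "solves (Suc n) (fst (sol n)) (sol (Suc n))" if "n < N" "L2 \<Omega> (fst (sol n))" for n
      using someI_ex[OF step[of "Suc n" "fst (sol n)"]] that by (simp add: sol_def)
    show *: "n \<le> N \<Longrightarrow> L2 \<Omega> (fst (sol n))" for n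
    proof (induction n)
      case 0
      then show ?case using u0L2 by (simp add: sol_def)
    next
      case (Suc n)
      then show ?case using L2_sol[OF _ s[of n]] by simp
    qed
    show "n < N \<Longrightarrow> solves (Suc n) (fst (sol n)) (sol (Suc n))" using s * by simp
  qed
  have "solves n (if n = 1 then u0 else fst (sol (n - 1))) (sol n)" if n: "n \<in> {1..N}" for n
  proof -
    obtain m where m: "n = Suc m" "m < N" using n by (cases n) auto
    \<comment> \<open>The recursion starts from a pair with first component \<open>u0\<close>, which
      absorbs the case distinction at \<open>n = 1\<close>.\<close>
    have "(if n = 1 then u0 else fst (sol (n - 1))) = fst (sol m)"
      using m by (auto simp: sol_def)
    then show ?thesis using solves[OF m(2)] m(1) by simp
  qed
  then show ?thesis unfolding solves_def Let_def by blast
qed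

end
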